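(* Let $U\subset D(0,T)$ be an open set, where $Tg'(T)=2$, such that there exists a sequence of open sets $(U_n)_{n\ge1}$ with $\overline U\subset U_n\subseteq D(0,T)$ and $U_{n+1}\subseteq U_n$ for all $n$, $\bigcap_nU_n=\overline U$, and such that the balayage measure $\nu_n$ on $\partial U_n$ with respect to $\mu_n=\mu|_{U_n}$ converges weakly, as $n\to\infty$, to the balayage measure $\nu$ on $\partial U$ with respect to $\mu|_U$. Then $$\liminf_{n\to\infty}\frac1{n^2}\log\mathbf P\big[\mathcal X_n^{(g)}(U)=0\big]\ge-R_U^{(g)}-\limsup_{n\to\infty}\frac1{n^2}\log Z_n^{(g)}.$$
   Context: $m$ is Lebesgue measure on $\mathbb C$; $D(0,t)$ is the disk of radius $t$ centred at $0$; $U^c=\mathbb C\setminus U$. The function $g:[0,\infty)\to[0,\infty)$ satisfies: (a) $g$ is increasing and $re^{-g(r)/2}\to0$ as $r\to\infty$; (b) $g$ is twice differentiable on $(0,\infty)$; (c) $\lim_{r\to0^+}rg'(r)=0$ and $rg'(r)$ is increasing on $(0,\infty)$; (d) $\int_0^\infty r^{2k+1}e^{-g(r)}dr<\infty$ for all $k=0,1,2,\dots$. $T>0$ is the (unique) solution of $tg'(t)=2$. $\mathcal X_n^{(g)}$ is the determinantal point process of $n$ points in $\mathbb C$ whose vector of points (in uniform random order) has density $\frac1{Z_n^{(g)}}\prod_{i<j}|z_i-z_j|^2e^{-n\sum_{k=1}^ng(|z_k|)}$ with respect to Lebesgue measure on $\mathbb C^n$, where $Z_n^{(g)}=\int_{\mathbb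 C}\cdots\int_{\mathbb C}\prod_{i<j}|z_i-z_j|^2e^{-n\sum_{k=1}^ng(|z_k|)}\prod_{k=1}^ndm(z_k)$. $\mathcal X_n^{(g)}(\Omega)$ is the number of its points in $\Omega$. $\mathcal P(E)$ is the set of compactly supported probability measures with support in $E$. For $\mu'\in\mathcal P(\mathbb C)$, $R_{\mu'}^{(g)}=\iint\log\frac1{|z-w|}d\mu'(z)d\mu'(w)+\int g(|z|)d\mu'(z)$, and $R_U^{(g)}=\inf\{R_{\mu'}^{(g)}:\mu'\in\mathcal P(U^c)\}$. $\mu$ is the probability measure $d\mu(z)=\frac1{4\pi}[g''(r)+\frac1rg'(r)]dm(z)$, $r=|z|$, on $D(0,T)$ (zero outside), and $\mu|_V$ is its restriction to $V$. Balayage: the potential of a finite compactly supported measure $\sigma$ is $p_\sigma(z)=-\int\log|z-w|d\sigma(w)$. A set is polar if $\int p_\sigma d\sigma=\infty$ for every compactly supported probability measure $\sigma$ with support in it; a property holds quasi-everywhere (q.e.) on a set if it holds there outside a Borel polar set. For a bounded open set $V$ and a finite Borel measure $\sigma$ on $V$, the balayage measure of (with respect to) $\sigma$ is the unique measure $\hat\sigma$ on $\partial V$ with $\hat\sigma(\partial V)=\sigma(V)$, $\hat\sigma(B)=0$ for every Borel polar set $B$, and $p_{\hat\sigma}=p_\sigma$ q.e. on $V^c$. *)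

theory Defs
  imports "HOL-Probability.Probability"
begin

section \<open>Extended-real logarithm and integral\<close>

definition elog :: "ennreal \<Rightarrow> ereal" where
  "elog x = (if x = 0 then -\<infinity> else if x = \<infinity> then \<infinity> else ereal (ln (enn2real x)))"

text \<open>Positive part minus negative part. In every use below the negative part has a
  finite integral, so the convention \<open>\<infinity> - \<infinity> = \<infinity>\<close> of \<^typ>\<open>ereal\<close> plays no role.\<close>

definition eintegral :: "'a measure \<Rightarrow> ('a \<Rightarrow> ereal) \<Rightarrow> ereal" where
  "eintegral M f =
     enn2ereal (\<integral>\<^sup>+x. e2ennreal (f x) \<partial>M) - enn2ereal (\<integral>\<^sup>+x. e2ennreal (- f x) \<partial>M)"


section \<open>Logarithmic potential theory in the plane\<close>

definition measure_support :: "'a::topological_space measure \<Rightarrow> 'a set" where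
  "measure_support M = {x. \<forall>V. open V \<and> x \<in> V \<longrightarrow> emeasure M V > 0}"

definition compact_probs :: "complex set \<Rightarrow> complex measure set" where
  "compact_probs E = {M. prob_space M \<and> sets M = sets borel \<and>
     compact (measure_support M) \<and> measure_support M \<subseteq> E}"

definition log_potential :: "complex measure \<Rightarrow> complex \<Rightarrow> ereal" where
  "log_potential \<sigma> z = eintegral \<sigma> (\<lambda>w. - elog (ennreal (norm (z - w))))"

definition log_energy :: "complex measure \<Rightarrow> ereal" where
  "log_energy \<sigma> = eintegral \<sigma> (log_potential \<sigma>)"

definition polar :: "complex set \<Rightarrow> bool" where
  "polar E \<longleftrightarrow> (\<forall>\<sigma>\<in>compact_probs E. log_energy \<sigma> = \<infinity>)"

definition quasi_everywhere :: "complex set \<Rightarrow> (complex \<Rightarrow> bool) \<Rightarrow> bool" where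
  "quasi_everywhere A P \<longleftrightarrow> (\<exists>B\<in>sets borel. polar B \<and> (\<forall>z\<in>A - B. P z))"

text \<open>A measure on a subset of the plane is represented by the Borel measure on the
  whole plane that gives mass zero to the complement of that subset.\<close>

definition is_balayage :: "complex set \<Rightarrow> complex measure \<Rightarrow> complex measure \<Rightarrow> bool" where
  "is_balayage V \<sigma> \<nu> \<longleftrightarrow>
     sets \<nu> = sets borel \<and>
     emeasure \<nu> (- frontier V) = 0 \<and>
     emeasure \<nu> (frontier V) = emeasure \<sigma> V \<and>
     (\<forall>B\<in>sets borel. polar B \<longrightarrow> emeasure \<nu> B = 0) \<and>
     quasi_everywhere (- V) (\<lambda>z. log_potential \<nu> z = log_potential \<sigma> z)"

definition weakly_converges ::
  "(nat \<Rightarrow> 'a::topological_space measure) \<Rightarrow> 'a measure \<Rightarrow> bool" where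
  "weakly_converges N \<nu> \<longleftrightarrow>
     (\<forall>f :: 'a \<Rightarrow> real. continuous_on UNIV f \<and> bounded (range f) \<longrightarrow>
        (\<lambda>n. \<integral>x. f x \<partial>N n) \<longlonglongrightarrow> (\<integral>x. f x \<partial>\<nu>))"


section \<open>The weighted energy and the measure \<open>\<mu>\<close>\<close>

definition weighted_energy :: "(real \<Rightarrow> real) \<Rightarrow> complex measure \<Rightarrow> ereal" where
  "weighted_energy g M = log_energy M + eintegral M (\<lambda>z. ereal (g (norm z)))"

definition hole_energy :: "(real \<Rightarrow> real) \<Rightarrow> complex set \<Rightarrow> ereal" where
  "hole_energy g U = (INF M\<in>compact_probs (- U). weighted_energy g M)"

definition radial_measure :: "(real \<Rightarrow> real) \<Rightarrow> real \<Rightarrow> complex measure" where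
  "radial_measure g T = density lborel (\<lambda>z.
     ennreal (1 / (4 * pi) * (deriv (deriv g) (norm z) + 1 / norm z * deriv g (norm z)))
       * indicator (ball 0 T) z)"

definition restrict_measure :: "'a measure \<Rightarrow> 'a set \<Rightarrow> 'a measure" where
  "restrict_measure M V = density M (indicator V)"


section \<open>The point process\<close>

text \<open>The process is given by the joint law of its points, listed as \<open>z 0, \<dots>, z (n - 1)\<close>.
  The density is symmetric, so this is the law of the points in uniform random order.\<close>

definition gibbs_weight :: "(real \<Rightarrow> real) \<Rightarrow> nat \<Rightarrow> (nat \<Rightarrow> complex) \<Rightarrow> real" where
  "gibbs_weight g n z =
     (\<Prod>j<n. \<Prod>i<j. (norm (z i - z j))\<^sup>2) * exp (- real n * (\<Sum>k<n. g (norm (z k))))"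

definition partition_function :: "(real \<Rightarrow> real) \<Rightarrow> nat \<Rightarrow> ennreal" where
  "partition_function g n =
     (\<integral>\<^sup>+z. ennreal (gibbs_weight g n z) \<partial>(\<Pi>\<^sub>M i\<in>{..<n}. lborel))"

definition points_law :: "(real \<Rightarrow> real) \<Rightarrow> nat \<Rightarrow> (nat \<Rightarrow> complex) measure" where
  "points_law g n = density (\<Pi>\<^sub>M i\<in>{..<n}. lborel)
     (\<lambda>z. ennreal (gibbs_weight g n z) / partition_function g n)"

definition num_points :: "nat \<Rightarrow> complex set \<Rightarrow> (nat \<Rightarrow> complex) \<Rightarrow> nat" where
  "num_points n \<Omega> z = card {i. i < n \<and> z i \<in> \<Omega>}"

definition hole_prob :: "(real \<Rightarrow> real) \<Rightarrow> nat \<Rightarrow> complex set \<Rightarrow> ennreal" where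
  "hole_prob g n U =
     emeasure (points_law g n) {z \<in> space (points_law g n). num_points n U z = 0}"

end

theory Submission
  imports Defs "HOL-Complex_Analysis.Complex_Analysis" "HOL-Real_Asymp.Real_Asymp"
begin

text \<open>The hole probability is the integral of the Gibbs weight over the configurations that avoid
  \<open>U\<close>, divided by the partition function. If a probability measure has a bounded density that
  vanishes on \<open>U\<close>, then Jensen's inequality for its \<open>n\<close>-fold product bounds this integral below by
  \<open>exp (- n\<^sup>2 r + o(n\<^sup>2))\<close>, where \<open>r\<close> is the weighted energy of the measure (\<open>hole_integral_ge\<close>,
  \<open>liminf_hole_prob_ge\<close>). It remains to find such measures whose weighted energy exceeds the hole
  energy, an infimum over compactly supported probability measures off \<open>U\<close>, by arbitrarily little.

  Let \<open>\<sigma>\<close> arise from the equilibrium measure \<open>\<mu>\<close> by replacing its part in \<open>U\<close> by the balayage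
  \<open>\<nu>\<close>. Its potential equals that of \<open>\<mu>\<close> quasi-everywhere off \<open>U\<close>. The potential of \<open>\<mu>\<close> satisfies
  the Euler-Lagrange conditions (\<open>potential_mu_inside\<close>, \<open>potential_mu_ge\<close>), the logarithmic kernel
  is positive definite on differences of probability measures (\<open>mutual_energy_le\<close>), and measures of
  finite energy do not charge polar sets (\<open>emeasure_polar_eq_0\<close>). Together these show that the
  weighted energy of \<open>\<sigma>\<close> is \<open>g(T)/2 - log T + \<integral> g/2 d\<sigma>\<close> and is at most the hole energy
  (\<open>weighted_energy_sigma\<close>, \<open>weighted_energy_ge\<close>). The same formula holds for the measures \<open>\<sigma>\<^sub>n\<close> swept
  out of \<open>Us n\<close>, and weak convergence of the balayage measures makes their energies at most the
  energy of \<open>\<sigma>\<close> in the limit. Unlike \<open>\<sigma>\<close>, the measure \<open>\<sigma>\<^sub>n\<close> lies at positive distance from \<open>U\<close>, so it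
  can be convolved with a small disc without reaching \<open>U\<close>; this yields a bounded density and, the
  kernel being superharmonic, does not increase the logarithmic energy (\<open>exists_bounded_density\<close>).

  Potentials and energies are computed with the kernel \<open>log (R / |z|)\<close> for \<open>R\<close> at least the diameter of
  the discs in question. This kernel is nonnegative there, so all of them become integrals in
  \<^typ>\<open>ennreal\<close> and no integrability conditions arise.\<close>

section \<open>Nonnegative logarithmic kernels\<close>

text \<open>A function that is \<open>[0, \<infinity>]\<close>-valued up to a constant has an extended integral that reduces
  to a single nonnegative integral; this turns all potentials and energies below into
  nonnegative integrals.\<close>

lemma eintegral_shift:
  fixes f :: "'a \<Rightarrow> ennreal"
  assumes "finite_measure M" and f[measurable]: "f \<in> borel_measurable M" and c: "c \<ge> 0"
    and h: "AE x in M. h x = enn2ereal (f x) - ereal c"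
  shows "eintegral M h = enn2ereal (\<integral>\<^sup>+x. f x \<partial>M) - ereal (c * measure M (space M))"
proof -
  interpret finite_measure M by fact
  have swap: "a - ennreal c + ennreal c = a + (ennreal c - a)" for a
  proof (cases a)
    case (real r)
    then show ?thesis using c
      by (cases "c \<le> r") (auto simp: ennreal_minus ennreal_neg simp flip: ennreal_plus)
  qed simp
  define A where "A = (\<integral>\<^sup>+x. (f x - ennreal c) \<partial>M)"
  define B where "B = (\<integral>\<^sup>+x. (ennreal c - f x) \<partial>M)"
  define m where "m = c * measure M (space M)"
  have m: "m \<ge> 0" using c by (simp add: m_def)
  have cm: "(\<integral>\<^sup>+x. ennreal c \<partial>M) = ennreal m"
    using c by (simp add: m_def emeasure_eq_measure ennreal_mult)
  have p: "e2ennreal (enn2ereal a - ereal c) = a - ennreal c" for a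
    using c by (cases a) (auto simp: ennreal_minus e2ennreal_ereal top_ennreal.rep_eq)
  have q: "e2ennreal (- (enn2ereal a - ereal c)) = ennreal c - a" for a
  proof (cases a)
    case (real r)
    then have "e2ennreal (- (enn2ereal a - ereal c)) = e2ennreal (ereal (c - r))" by simp
    also have "\<dots> = ennreal c - a" using real c by (simp only: e2ennreal_ereal ennreal_minus)
    finally show ?thesis .
  next
    case top
    then have "- (enn2ereal a - ereal c) = - \<infinity>" by (simp add: top_ennreal.rep_eq)
    then have "e2ennreal (- (enn2ereal a - ereal c)) = 0"
      by (simp only:) (rule e2ennreal_neg, simp)
    moreover have "ennreal c - a = 0" unfolding top by (rule ennreal_minus_top)
    ultimately show ?thesis by (rule trans[OF _ sym])
  qed
  have "AE x in M. e2ennreal (h x) = f x - ennreal c"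
    using h by eventually_elim (simp only: p)
  then have eA: "(\<integral>\<^sup>+x. e2ennreal (h x) \<partial>M) = A"
    unfolding A_def by (rule nn_integral_cong_AE)
  have "AE x in M. e2ennreal (- h x) = ennreal c - f x"
    using h by eventually_elim (simp only: q)
  then have eB: "(\<integral>\<^sup>+x. e2ennreal (- h x) \<partial>M) = B"
    unfolding B_def by (rule nn_integral_cong_AE)
  have "B \<le> (\<integral>\<^sup>+x. ennreal c \<partial>M)" unfolding B_def by (intro nn_integral_mono) auto
  then have Bfin: "B \<le> ennreal m" unfolding cm .
  have "A + ennreal m = (\<integral>\<^sup>+x. (f x - ennreal c) + ennreal c \<partial>M)"
    unfolding A_def cm[symmetric] by (intro nn_integral_add[symmetric]) auto
  also have "\<dots> = (\<integral>\<^sup>+x. f x + (ennreal c - f x) \<partial>M)"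
    by (intro nn_integral_cong swap)
  also have "\<dots> = (\<integral>\<^sup>+x. f x \<partial>M) + B"
    unfolding B_def by (intro nn_integral_add) auto
  finally have eq: "A + ennreal m = (\<integral>\<^sup>+x. f x \<partial>M) + B" .
  obtain b where b: "B = ennreal b" "b \<ge> 0"
    using Bfin by (cases B) (auto simp: top_unique)
  have "enn2ereal A - enn2ereal B = enn2ereal (\<integral>\<^sup>+x. f x \<partial>M) - ereal m"
    using eq b m
    by (cases A; cases "\<integral>\<^sup>+x. f x \<partial>M")
       (auto simp: top_ennreal.rep_eq simp flip: ennreal_plus)
  then show ?thesis by (simp add: eintegral_def eA eB m_def)
qed

text \<open>The kernel \<open>log (R / |z|)\<close>. On pairs of points of a disc of diameter at most \<open>R\<close> it is
  nonnegative and differs from \<open>- log |z|\<close> by the constant \<open>log R\<close>. Beyond \<open>|z| > R\<close> the coercion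
  to \<^typ>\<open>ennreal\<close> truncates it to \<open>0\<close>.\<close>

definition log_kernel :: "real \<Rightarrow> complex \<Rightarrow> ennreal" where
  "log_kernel R z = (if z = 0 then \<infinity> else ennreal (ln (R / norm z)))"

text \<open>The mutual energy of two measures for the kernel \<open>log (R / |z - w|)\<close>.\<close>

definition mutual_energy :: "real \<Rightarrow> complex measure \<Rightarrow> complex measure \<Rightarrow> ennreal" where
  "mutual_energy R M N = (\<integral>\<^sup>+x. \<integral>\<^sup>+y. log_kernel R (x - y) \<partial>N \<partial>M)"

lemma log_kernel_measurable[measurable]: "log_kernel R \<in> borel_measurable borel"
  unfolding log_kernel_def by measurable

lemma log_kernel_minus: "log_kernel R (x - y) = log_kernel R (y - x)"
  by (auto simp: log_kernel_def norm_minus_commute)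

lemma neg_elog_eq:
  assumes "norm z \<le> R" "R > 0"
  shows "- elog (ennreal (norm z)) = enn2ereal (log_kernel R z) - ereal (ln R)"
  using assms
  by (auto simp: elog_def log_kernel_def top_ennreal.rep_eq ln_div enn2ereal_ennreal)

lemma log_potential_eq:
  assumes "finite_measure M" and [measurable_cong]: "sets M = sets borel"
    and "AE y in M. norm (z - y) \<le> R" and R: "R \<ge> 1"
  shows "log_potential M z =
    enn2ereal (\<integral>\<^sup>+y. log_kernel R (z - y) \<partial>M) - ereal (ln R * measure M UNIV)"
proof -
  have sp: "space M = UNIV" using sets_eq_imp_space_eq[OF assms(2)] by simp
  have "AE y in M. - elog (ennreal (norm (z - y))) = enn2ereal (log_kernel R (z - y)) - ereal (ln R)"
    using assms(3) by eventually_elim (use R in \<open>auto intro: neg_elog_eq\<close>)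
  from eintegral_shift[OF assms(1) _ _ this] R show ?thesis
    by (simp add: log_potential_def sp)
qed

lemma log_energy_eq:
  assumes "finite_measure M" and s[measurable_cong]: "sets M = sets borel"
    and M: "AE y in M. norm y \<le> \<rho>" and R: "R \<ge> 1" "2 * \<rho> \<le> R"
  shows "log_energy M = enn2ereal (mutual_energy R M M) - ereal (ln R * (measure M UNIV)\<^sup>2)"
proof -
  interpret finite_measure M by fact
  have sp: "space M = UNIV" using sets_eq_imp_space_eq[OF s] by simp
  have "log_potential M x = enn2ereal (\<integral>\<^sup>+y. log_kernel R (x - y) \<partial>M) - ereal (ln R * measure M UNIV)"
    if x: "norm x \<le> \<rho>" for x
  proof (rule log_potential_eq)
    show "AE y in M. norm (x - y) \<le> R" using M
    proof eventually_elim
      case (elim y) then show ?case using x R norm_triangle_ineq4[of x y] by linarith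
    qed
  qed (use assms in auto)
  then have *: "AE x in M. log_potential M x =
      enn2ereal (\<integral>\<^sup>+y. log_kernel R (x - y) \<partial>M) - ereal (ln R * measure M UNIV)"
    using M by auto
  have [measurable]: "(\<lambda>x. \<integral>\<^sup>+y. log_kernel R (x - y) \<partial>M) \<in> borel_measurable M"
    by measurable
  from eintegral_shift[OF assms(1) _ _ *] R show ?thesis
    by (simp add: log_energy_def mutual_energy_def sp power2_eq_square mult.assoc)
qed

section \<open>Lebesgue measure in the plane\<close>

lemma nn_integral_translate:
  fixes f :: "complex \<Rightarrow> ennreal"
  assumes [measurable]: "f \<in> borel_measurable borel"
  shows "(\<integral>\<^sup>+x. f (a + x) \<partial>lborel) = (\<integral>\<^sup>+x. f x \<partial>lborel)"
proof -
  have "(\<integral>\<^sup>+x. f x \<partial>lborel) = (\<integral>\<^sup>+x. f x \<partial>(distr lborel borel ((+) a)))"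
    by (simp add: lborel_distr_plus)
  also have "\<dots> = (\<integral>\<^sup>+x. f (a + x) \<partial>lborel)"
    by (subst nn_integral_distr) auto
  finally show ?thesis by simp
qed

text \<open>The argument is the uniqueness of Haar measure: for every Borel set \<open>A\<close>, with \<open>B\<close> the unit
  disc and \<open>\<lambda>\<close> Lebesgue measure, a shear and two translations show
  \<open>\<lambda> (c\<inverse> A) \<lambda> B = \<lambda> A \<lambda> B\<close>, because rotations map \<open>B\<close> to itself.\<close>

lemma lborel_distr_rotation:
  fixes c :: complex
  assumes c: "norm c = 1"
  shows "distr lborel borel ((*) c) = (lborel :: complex measure)"
proof (rule measure_eqI)
  fix A :: "complex set" assume "A \<in> sets (distr lborel borel ((*) c))"
  then have A[measurable]: "A \<in> sets borel" by simp
  have c0: "c \<noteq> 0" using c by auto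
  let ?B = "cball (0::complex) 1"
  define b where "b = emeasure lborel ?B"
  have b: "b \<noteq> 0" "b \<noteq> \<infinity>"
    by (auto simp: b_def emeasure_cball eval_unit_ball_vol)
  have "emeasure (distr lborel borel ((*) c)) A * b =
      (\<integral>\<^sup>+x. indicator A (c * x) \<partial>lborel) * b"
    by (subst nn_integral_indicator[symmetric], simp, subst nn_integral_distr) auto
  also have "\<dots> = (\<integral>\<^sup>+x. indicator A (c * x) * b \<partial>lborel)"
    by (rule nn_integral_multc[symmetric]) measurable
  also have "\<dots> = (\<integral>\<^sup>+x. \<integral>\<^sup>+y. indicator A (c * x) * indicator ?B (- (c * x) + y) \<partial>lborel \<partial>lborel)"
  proof (rule nn_integral_cong)
    fix x :: complex
    have "(\<integral>\<^sup>+y. indicator A (c * x) * indicator ?B (- (c * x) + y) \<partial>lborel)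
        = indicator A (c * x) * (\<integral>\<^sup>+y. (indicator ?B (- (c * x) + y) :: ennreal) \<partial>lborel)"
      by (rule nn_integral_cmult) (auto simp: indicator_def)
    also have "(\<integral>\<^sup>+y. (indicator ?B (- (c * x) + y) :: ennreal) \<partial>lborel) = (\<integral>\<^sup>+y. indicator ?B y \<partial>lborel)"
      by (rule nn_integral_translate) (rule borel_measurable_indicator, simp)
    finally show "indicator A (c * x) * b = (\<integral>\<^sup>+y. indicator A (c * x) * indicator ?B (- (c * x) + y) \<partial>lborel)"
      by (simp add: b_def)
  qed
  also have "\<dots> = (\<integral>\<^sup>+y. \<integral>\<^sup>+x. indicator A (c * x) * indicator ?B (- (c * x) + y) \<partial>lborel \<partial>lborel)"
    by (rule lborel_pair.Fubini'[symmetric]) (auto simp: indicator_def)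
  also have "\<dots> = (\<integral>\<^sup>+y. \<integral>\<^sup>+x. indicator A (c * x + y) * indicator ?B x \<partial>lborel \<partial>lborel)"
  proof (rule nn_integral_cong)
    fix y :: complex
    have "(\<integral>\<^sup>+x. indicator A (c * x) * indicator ?B (- (c * x) + y) \<partial>lborel) =
      (\<integral>\<^sup>+x. indicator A (c * (y / c + x)) * (indicator ?B (- (c * (y / c + x)) + y) :: ennreal) \<partial>lborel)"
      by (rule nn_integral_translate[symmetric]) (auto simp: indicator_def)
    also have "\<dots> = (\<integral>\<^sup>+x. indicator A (c * x + y) * indicator ?B x \<partial>lborel)"
    proof (rule nn_integral_cong)
      fix x :: complex
      have "c * (y / c + x) = c * x + y" using c0 by (simp add: field_simps)
      then show "indicator A (c * (y / c + x)) * (indicator ?B (- (c * (y / c + x)) + y) :: ennreal)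
          = indicator A (c * x + y) * indicator ?B x"
        using c by (simp only:) (simp add: indicator_def norm_mult)
    qed
    finally show "(\<integral>\<^sup>+x. indicator A (c * x) * indicator ?B (- (c * x) + y) \<partial>lborel) =
       (\<integral>\<^sup>+x. indicator A (c * x + y) * (indicator ?B x :: ennreal) \<partial>lborel)" .
  qed
  also have "\<dots> = (\<integral>\<^sup>+x. \<integral>\<^sup>+y. indicator A (c * x + y) * indicator ?B x \<partial>lborel \<partial>lborel)"
    by (rule lborel_pair.Fubini') (auto simp: indicator_def)
  also have "\<dots> = (\<integral>\<^sup>+x. emeasure lborel A * indicator ?B x \<partial>lborel)"
  proof (rule nn_integral_cong)
    fix x :: complex
    have "(\<integral>\<^sup>+y. indicator A (c * x + y) * indicator ?B x \<partial>lborel)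
        = (\<integral>\<^sup>+y. (indicator A (c * x + y) :: ennreal) \<partial>lborel) * indicator ?B x"
      by (rule nn_integral_multc) measurable
    also have "(\<integral>\<^sup>+y. (indicator A (c * x + y) :: ennreal) \<partial>lborel) = (\<integral>\<^sup>+y. indicator A y \<partial>lborel)"
      by (rule nn_integral_translate) auto
    finally show "(\<integral>\<^sup>+y. indicator A (c * x + y) * indicator ?B x \<partial>lborel) = emeasure lborel A * indicator ?B x"
      by simp
  qed
  also have "\<dots> = emeasure lborel A * b"
    by (subst nn_integral_cmult) (auto intro!: borel_measurable_indicator simp: b_def)
  finally show "emeasure (distr lborel borel ((*) c)) A = emeasure lborel A"
    using b ennreal_mult_cancel_left[of b "emeasure (distr lborel borel ((*) c)) A"] by (simp add: mult.commute)
qed simp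

lemma nn_integral_rotate:
  fixes f :: "complex \<Rightarrow> ennreal"
  assumes [measurable]: "f \<in> borel_measurable borel" and c: "norm c = 1"
  shows "(\<integral>\<^sup>+x. f (c * x) \<partial>lborel) = (\<integral>\<^sup>+x. f x \<partial>lborel)"
proof -
  have "(\<integral>\<^sup>+x. f x \<partial>lborel) = (\<integral>\<^sup>+x. f x \<partial>(distr lborel borel ((*) c)))"
    by (simp add: lborel_distr_rotation c)
  also have "\<dots> = (\<integral>\<^sup>+x. f (c * x) \<partial>lborel)"
    by (subst nn_integral_distr) auto
  finally show ?thesis by simp
qed

lemma distr_norm_lborel:
  "distr (lborel :: complex measure) borel norm = density lborel (\<lambda>r. ennreal (2 * pi * r))"
proof (rule measure_eqI_generator_eq[where \<Omega> = UNIV and E = "range atMost" and A = "\<lambda>n. {..real n}"])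
  show "Int_stable (range (atMost :: real \<Rightarrow> _))"
    by (auto simp: Int_stable_def)
  have gen: "sets borel = sigma_sets UNIV (range (atMost :: real \<Rightarrow> _))"
    by (simp add: borel_eq_atMost)
  then show "sets (distr (lborel :: complex measure) borel norm) = sigma_sets UNIV (range (atMost :: real \<Rightarrow> _))"
    "sets (density lborel (\<lambda>r. ennreal (2 * pi * r))) = sigma_sets UNIV (range (atMost :: real \<Rightarrow> _))"
    by simp_all
  have cb: "emeasure (distr (lborel :: complex measure) borel norm) {..a} = ennreal (pi * (max 0 a)\<^sup>2)" for a
  proof -
    have "emeasure (distr (lborel :: complex measure) borel norm) {..a} = emeasure lborel (cball (0::complex) a)"
      by (subst emeasure_distr) (auto intro!: arg_cong[where f="emeasure lborel"] simp: dist_norm)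
    also have "\<dots> = ennreal (pi * (max 0 a)\<^sup>2)"
      by (cases "a \<ge> 0") (auto simp: emeasure_cball eval_unit_ball_vol max_def)
    finally show ?thesis .
  qed
  have db: "emeasure (density lborel (\<lambda>r. ennreal (2 * pi * r))) {..a} = ennreal (pi * (max 0 a)\<^sup>2)" for a
  proof -
    have "emeasure (density lborel (\<lambda>r. ennreal (2 * pi * r))) {..a} =
        (\<integral>\<^sup>+r. ennreal (2 * pi * r) * indicator {..a} r \<partial>lborel)"
      by (subst emeasure_density) auto
    also have "\<dots> = (\<integral>\<^sup>+r. ennreal (2 * pi * r) * indicator {0..max 0 a} r \<partial>lborel)"
      by (intro nn_integral_cong)
        (auto simp: indicator_def max_def ennreal_neg mult_nonneg_nonpos split: if_splits)
    also have "\<dots> = ennreal (pi * (max 0 a)\<^sup>2 - pi * 0\<^sup>2)"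
      by (rule nn_integral_FTC_Icc)
        (auto intro!: derivative_eq_intros simp: power2_eq_square algebra_simps)
    finally show ?thesis by simp
  qed
  show "emeasure (distr (lborel :: complex measure) borel norm) X = emeasure (density lborel (\<lambda>r. ennreal (2 * pi * r))) X"
    if "X \<in> range atMost" for X :: "real set" using that cb db by auto
  show "emeasure (distr (lborel :: complex measure) borel norm) {..real i} \<noteq> \<infinity>" for i
    by (simp add: cb)
  show "(\<Union>i. {..real i}) = UNIV" by (auto intro: real_arch_simple)
qed auto

lemma nn_integral_radial:
  fixes h :: "real \<Rightarrow> ennreal"
  assumes [measurable]: "h \<in> borel_measurable borel"
  shows "(\<integral>\<^sup>+z. h (norm (z::complex)) \<partial>lborel) = (\<integral>\<^sup>+r. ennreal (2 * pi * r) * h r \<partial>lborel)"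
proof -
  have "(\<integral>\<^sup>+z. h (norm (z::complex)) \<partial>lborel) = (\<integral>\<^sup>+r. h r \<partial>distr (lborel :: complex measure) borel norm)"
    by (subst nn_integral_distr) auto
  also have "\<dots> = (\<integral>\<^sup>+r. ennreal (2 * pi * r) * h r \<partial>lborel)"
    unfolding distr_norm_lborel by (subst nn_integral_density) auto
  finally show ?thesis .
qed

lemma gauss_integral_finite:
  assumes t: "t > 0"
  shows "(\<integral>\<^sup>+z. ennreal (exp (- t * (norm (z::complex))\<^sup>2)) \<partial>lborel) < \<infinity>"
    and "(\<integral>\<^sup>+z. ennreal (exp (- t * (norm (z::complex))\<^sup>2)) \<partial>lborel) \<noteq> 0"
proof -
  have "(\<integral>\<^sup>+z. ennreal (exp (- t * (norm (z::complex))\<^sup>2)) \<partial>lborel) =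
     (\<integral>\<^sup>+r. ennreal (2 * pi * r) * ennreal (exp (- t * r\<^sup>2)) \<partial>lborel)"
    by (rule nn_integral_radial[of "\<lambda>r. ennreal (exp (- t * r\<^sup>2))"]) auto
  also have "\<dots> = (\<integral>\<^sup>+r. ennreal (2 * pi * r * exp (- t * r\<^sup>2)) * indicator {0..} r \<partial>lborel)"
    by (intro nn_integral_cong) (auto simp: indicator_def ennreal_mult' ennreal_neg mult_nonneg_nonpos)
  also have "\<dots> = ennreal (0 - (- pi / t * exp (- t * 0\<^sup>2)))"
  proof (rule nn_integral_FTC_atLeast)
    show "((\<lambda>r. - pi / t * exp (- t * r\<^sup>2)) \<longlongrightarrow> 0) at_top"
      using t by real_asymp
  qed (use t in \<open>auto intro!: derivative_eq_intros simp: field_simps power2_eq_square\<close>)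
  finally show "(\<integral>\<^sup>+z. ennreal (exp (- t * (norm (z::complex))\<^sup>2)) \<partial>lborel) < \<infinity>"
    and "(\<integral>\<^sup>+z. ennreal (exp (- t * (norm (z::complex))\<^sup>2)) \<partial>lborel) \<noteq> 0"
    using t by auto
qed

section \<open>Positive definiteness of the logarithmic kernel\<close>

text \<open>A Gaussian kernel is, up to a constant, the convolution of a narrower Gaussian with itself;
  this is what makes it positive definite.\<close>

lemma gauss_convolution:
  fixes x y :: complex
  shows "(\<integral>\<^sup>+u. ennreal (exp (- (2 * t) * (norm (x - u))\<^sup>2)) * ennreal (exp (- (2 * t) * (norm (y - u))\<^sup>2)) \<partial>lborel)
    = (\<integral>\<^sup>+u. ennreal (exp (- (4 * t) * (norm (u::complex))\<^sup>2)) \<partial>lborel) * ennreal (exp (- t * (norm (x - y))\<^sup>2))"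
proof -
  define c where "c = (x + y) / 2"
  have id: "(norm (x - u))\<^sup>2 + (norm (y - u))\<^sup>2 = 2 * (norm (- c + u))\<^sup>2 + (norm (x - y))\<^sup>2 / 2" for u
    unfolding c_def cmod_power2 by (simp add: field_simps power2_eq_square)
  have "exp (- (2 * t) * (norm (x - u))\<^sup>2) * exp (- (2 * t) * (norm (y - u))\<^sup>2)
      = exp (- (4 * t) * (norm (- c + u))\<^sup>2) * exp (- t * (norm (x - y))\<^sup>2)" for u
  proof -
    have "- (2 * t) * (norm (x - u))\<^sup>2 + - (2 * t) * (norm (y - u))\<^sup>2
      = - (2 * t) * ((norm (x - u))\<^sup>2 + (norm (y - u))\<^sup>2)" by (simp add: algebra_simps)
    also have "\<dots> = - (4 * t) * (norm (- c + u))\<^sup>2 + - t * (norm (x - y))\<^sup>2"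
      unfolding id by (simp add: algebra_simps)
    finally show ?thesis by (simp only: exp_add[symmetric])
  qed
  then have "(\<integral>\<^sup>+u. ennreal (exp (- (2 * t) * (norm (x - u))\<^sup>2)) * ennreal (exp (- (2 * t) * (norm (y - u))\<^sup>2)) \<partial>lborel)
    = (\<integral>\<^sup>+u. ennreal (exp (- (4 * t) * (norm (- c + u))\<^sup>2)) * ennreal (exp (- t * (norm (x - y))\<^sup>2)) \<partial>lborel)"
    by (simp only: ennreal_mult[symmetric] exp_ge_zero)
  also have "\<dots> = (\<integral>\<^sup>+u. ennreal (exp (- (4 * t) * (norm (- c + u))\<^sup>2)) \<partial>lborel) * ennreal (exp (- t * (norm (x - y))\<^sup>2))"
    by (rule nn_integral_multc) measurable
  also have "(\<integral>\<^sup>+u. ennreal (exp (- (4 * t) * (norm (- c + u))\<^sup>2)) \<partial>lborel) =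
      (\<integral>\<^sup>+u. ennreal (exp (- (4 * t) * (norm (u::complex))\<^sup>2)) \<partial>lborel)"
    by (rule nn_integral_translate[of "\<lambda>u. ennreal (exp (- (4 * t) * (norm u)\<^sup>2))"]) measurable
  finally show ?thesis .
qed

lemma ennreal_two_mult_le: "2 * (a * b) \<le> a * a + b * (b::ennreal)"
proof (cases a; cases b)
  fix r s assume *: "0 \<le> r" "a = ennreal r" "0 \<le> s" "b = ennreal s"
  have "2 * (r * s) \<le> r * r + s * s"
    using sum_squares_bound[of r s] by (simp add: power2_eq_square)
  then have "ennreal (2 * (r * s)) \<le> ennreal (r * r + s * s)" by (rule ennreal_leI)
  then show ?thesis using * by (simp add: ennreal_mult ennreal_plus)
qed (auto simp: top_add add_top ennreal_mult_top ennreal_top_mult)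

lemma gauss_positive_definite:
  fixes M N :: "complex measure"
  assumes "finite_measure M" "finite_measure N" and t: "t > 0"
    and sM[measurable_cong]: "sets M = sets borel" and sN[measurable_cong]: "sets N = sets borel"
  defines "q \<equiv> \<lambda>M N. \<integral>\<^sup>+x. \<integral>\<^sup>+y. ennreal (exp (- t * (norm (x - y))\<^sup>2)) \<partial>N \<partial>M"
  shows "2 * q M N \<le> q M M + q N N"
proof -
  interpret M: finite_measure M by fact
  interpret N: finite_measure N by fact
  define G where "G = (\<integral>\<^sup>+u. ennreal (exp (- (4 * t) * (norm (u::complex))\<^sup>2)) \<partial>lborel)"
  have G: "G \<noteq> 0" "G \<noteq> \<infinity>"
    using gauss_integral_finite[of "4 * t"] t by (auto simp: G_def)
  define f where "f x u = ennreal (exp (- (2 * t) * (norm (x - u))\<^sup>2))" for x u :: complex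
  have [measurable]: "case_prod f \<in> borel_measurable (borel \<Otimes>\<^sub>M borel)"
    unfolding f_def by measurable
  have fac: "G * q M N = (\<integral>\<^sup>+u. (\<integral>\<^sup>+x. f x u \<partial>M) * (\<integral>\<^sup>+x. f x u \<partial>N) \<partial>lborel)"
    if "finite_measure M" "finite_measure N" and [measurable_cong]: "sets M = sets borel" "sets N = sets borel"
    for M N
  proof -
    interpret M: finite_measure M by (rule that)
    interpret N: finite_measure N by (rule that)
    interpret pM: pair_sigma_finite M "lborel :: complex measure" ..
    interpret pN: pair_sigma_finite N "lborel :: complex measure" ..
    have "G * q M N = (\<integral>\<^sup>+x. \<integral>\<^sup>+y. G * ennreal (exp (- t * (norm (x - y))\<^sup>2)) \<partial>N \<partial>M)"
      unfolding q_def by (simp add: nn_integral_cmult)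
    also have "\<dots> = (\<integral>\<^sup>+x. \<integral>\<^sup>+y. \<integral>\<^sup>+u. f x u * f y u \<partial>lborel \<partial>N \<partial>M)"
      unfolding G_def gauss_convolution[symmetric] f_def ..
    also have "\<dots> = (\<integral>\<^sup>+x. \<integral>\<^sup>+u. \<integral>\<^sup>+y. f x u * f y u \<partial>N \<partial>lborel \<partial>M)"
      by (intro nn_integral_cong pN.Fubini'[symmetric]) measurable
    also have "\<dots> = (\<integral>\<^sup>+u. \<integral>\<^sup>+x. \<integral>\<^sup>+y. f x u * f y u \<partial>N \<partial>M \<partial>lborel)"
      by (intro pM.Fubini'[symmetric]) measurable
    also have "\<dots> = (\<integral>\<^sup>+u. (\<integral>\<^sup>+x. f x u \<partial>M) * (\<integral>\<^sup>+x. f x u \<partial>N) \<partial>lborel)"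
      by (simp add: nn_integral_cmult nn_integral_multc)
    finally show ?thesis .
  qed
  have "G * (2 * q M N) = 2 * (G * q M N)" by (simp add: ac_simps)
  also have "\<dots> = (\<integral>\<^sup>+u. 2 * ((\<integral>\<^sup>+x. f x u \<partial>M) * (\<integral>\<^sup>+x. f x u \<partial>N)) \<partial>lborel)"
    by (simp add: fac[OF assms(1,2) sM sN] nn_integral_cmult)
  also have "\<dots> \<le> (\<integral>\<^sup>+u. (\<integral>\<^sup>+x. f x u \<partial>M) * (\<integral>\<^sup>+x. f x u \<partial>M) + (\<integral>\<^sup>+x. f x u \<partial>N) * (\<integral>\<^sup>+x. f x u \<partial>N) \<partial>lborel)"
    by (intro nn_integral_mono ennreal_two_mult_le)
  also have "\<dots> = G * q M M + G * q N N"
    by (simp add: fac[OF assms(1) assms(1) sM sM] fac[OF assms(2) assms(2) sN sN] nn_integral_add)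
  finally have "G * (2 * q M N) \<le> G * (q M M + q N N)" by (simp add: distrib_left)
  then show ?thesis using G by (simp add: ennreal_mult_le_mult_iff)
qed

lemma ennreal_eq_topI:
  assumes "\<And>K. K \<ge> 0 \<Longrightarrow> ennreal K \<le> X"
  shows "X = \<infinity>"
proof (cases X)
  case (real r)
  then show ?thesis using assms[of "r + 1"] by simp
qed simp

text \<open>Frullani's formula for \<open>log (R\<^sup>2 / |z|\<^sup>2) / 2\<close>: the logarithmic kernel is a positive
  superposition of Gaussian kernels, each lowered by a constant. The value at \<open>z = 0\<close> is \<open>\<infinity>\<close> on
  both sides.\<close>

lemma log_kernel_eq_integral:
  assumes "R > 0" "norm z \<le> R"
  shows "log_kernel R z = (\<integral>\<^sup>+t. ennreal (exp (- t * (norm z)\<^sup>2) - exp (- t * R\<^sup>2)) * (ennreal (1 / (2 * t)) * indicator {0<..} t) \<partial>lborel)"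
proof -
  define x Y where "x = (norm z)\<^sup>2" and "Y = R\<^sup>2"
  have xY: "0 \<le> x" "x \<le> Y" "0 < Y" using assms by (auto simp: x_def Y_def power_mono)
  have 1: "ennreal (exp (- t * x) - exp (- t * Y)) * (ennreal (1 / (2 * t)) * indicator {0<..} t)
      = (\<integral>\<^sup>+u. ennreal (exp (- (t * u)) / 2) * indicator {x..Y} u * indicator {0<..} t \<partial>lborel)" for t
  proof (cases "t > 0")
    case True
    have "(\<integral>\<^sup>+u. ennreal (exp (- (t * u)) / 2) * indicator {x..Y} u \<partial>lborel) =
        ennreal ((- exp (- (t * Y)) / (2 * t)) - (- exp (- (t * x)) / (2 * t)))"
      by (rule nn_integral_FTC_Icc) (use True xY in \<open>auto intro!: derivative_eq_intros\<close>)
    also have "(- exp (- (t * Y)) / (2 * t)) - (- exp (- (t * x)) / (2 * t)) =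
       (exp (- t * x) - exp (- t * Y)) * (1 / (2 * t))"
      by (simp add: field_simps diff_divide_distrib)
    also have "ennreal \<dots> = ennreal (exp (- t * x) - exp (- t * Y)) * ennreal (1 / (2 * t))"
      by (rule ennreal_mult) (use True xY in auto)
    finally show ?thesis using True by simp
  qed simp
  have 2: "(\<integral>\<^sup>+t. ennreal (exp (- (t * u)) / 2) * indicator {0<..} t \<partial>lborel) = ennreal (1 / (2 * u))" if "u > 0" for u
  proof -
    have "(\<integral>\<^sup>+t. ennreal (exp (- (t * u)) / 2) * indicator {0<..} t \<partial>lborel) =
        (\<integral>\<^sup>+t. ennreal (exp (- (t * u)) / 2) * indicator {0..} t \<partial>lborel)"
      by (rule nn_integral_cong_AE, rule AE_mp[OF AE_lborel_singleton[of 0]], rule AE_I2) (auto simp: indicator_def)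
    also have "\<dots> = ennreal (0 - (- exp (- (0 * u)) / (2 * u)))"
    proof (rule nn_integral_FTC_atLeast)
      show "((\<lambda>t. - exp (- (t * u)) / (2 * u)) \<longlongrightarrow> 0) at_top"
        using that by real_asymp
    qed (use that in \<open>auto intro!: derivative_eq_intros\<close>)
    finally show ?thesis by simp
  qed
  have "(\<integral>\<^sup>+t. ennreal (exp (- t * x) - exp (- t * Y)) * (ennreal (1 / (2 * t)) * indicator {0<..} t) \<partial>lborel)
     = (\<integral>\<^sup>+u. \<integral>\<^sup>+t. ennreal (exp (- (t * u)) / 2) * indicator {x..Y} u * indicator {0<..} t \<partial>lborel \<partial>lborel)"
    unfolding 1 by (rule lborel_pair.Fubini') measurable
  also have "\<dots> = (\<integral>\<^sup>+u. indicator {x..Y} u * (\<integral>\<^sup>+t. ennreal (exp (- (t * u)) / 2) * indicator {0<..} t \<partial>lborel) \<partial>lborel)"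
    by (intro nn_integral_cong, subst nn_integral_cmult[symmetric]) (auto intro!: nn_integral_cong simp: ac_simps)
  also have "\<dots> = (\<integral>\<^sup>+u. ennreal (1 / (2 * u)) * indicator {x..Y} u \<partial>lborel)"
  proof (rule nn_integral_cong_AE)
    show "AE u in lborel. indicator {x..Y} u * (\<integral>\<^sup>+t. ennreal (exp (- (t * u)) / 2) * indicator {0<..} t \<partial>lborel) =
         ennreal (1 / (2 * u)) * indicator {x..Y} u"
      using AE_lborel_singleton[of 0]
    proof eventually_elim
      case (elim u)
      show ?case
      proof (cases "u \<in> {x..Y}")
        case True
        then have "u > 0" using xY elim by auto
        from 2[OF this] True show ?thesis by simp
      qed simp
    qed
  qed
  also have "\<dots> = log_kernel R z"
  proof -
    have 3: "(\<integral>\<^sup>+u. ennreal (1 / (2 * u)) * indicator {e..Y} u \<partial>lborel) = ennreal (ln Y / 2 - ln e / 2)"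
      if "e > 0" "e \<le> Y" for e
      by (rule nn_integral_FTC_Icc) (use that in \<open>auto intro!: derivative_eq_intros\<close>)
    show ?thesis
    proof (cases "z = 0")
      case False
      then have "x > 0" by (simp add: x_def)
      have "ln Y / 2 - ln x / 2 = ln (R / norm z)"
        using False assms by (simp add: x_def Y_def ln_realpow ln_div)
      then show ?thesis using 3[OF \<open>x > 0\<close>] xY False by (simp add: log_kernel_def)
    next
      case True
      then have "x = 0" by (simp add: x_def)
      have "ennreal K \<le> (\<integral>\<^sup>+u. ennreal (1 / (2 * u)) * indicator {x..Y} u \<partial>lborel)" if K: "K \<ge> 0" for K
      proof -
        \<comment> \<open>chosen so that \<open>log (Y / e) / 2 = K\<close>\<close>
        define e where "e = Y * exp (- (2 * K))"
        have e: "e > 0" "e \<le> Y" using xY K by (auto simp: e_def mult_le_cancel_left2)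
        have "ennreal K = (\<integral>\<^sup>+u. ennreal (1 / (2 * u)) * indicator {e..Y} u \<partial>lborel)"
          unfolding 3[OF e] using xY by (simp add: e_def ln_mult diff_divide_distrib)
        also have "\<dots> \<le> (\<integral>\<^sup>+u. ennreal (1 / (2 * u)) * indicator {x..Y} u \<partial>lborel)"
          using e \<open>x = 0\<close> by (intro nn_integral_mono) (auto simp: indicator_def)
        finally show ?thesis .
      qed
      then have "(\<integral>\<^sup>+u. ennreal (1 / (2 * u)) * indicator {x..Y} u \<partial>lborel) = \<infinity>"
        by (rule ennreal_eq_topI)
      then show ?thesis using True by (simp add: log_kernel_def)
    qed
  qed
  finally show ?thesis by (simp add: x_def Y_def)
qed

text \<open>Positive definiteness of the logarithmic kernel on differences of probability measures. The
  constants \<open>exp (- t R\<^sup>2)\<close> in Frullani's formula cancel because both total masses are \<open>1\<close>, and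
  nothing is subtracted, so that the inequality also holds for infinite energies.\<close>

lemma mutual_energy_le:
  fixes M N :: "complex measure"
  assumes "prob_space M" "prob_space N" and sM[measurable_cong]: "sets M = sets borel"
    and sN[measurable_cong]: "sets N = sets borel"
    and M: "AE x in M. norm x \<le> \<rho>" and N: "AE x in N. norm x \<le> \<rho>" and R: "R > 0" "2 * \<rho> \<le> R"
  shows "2 * mutual_energy R M N \<le> mutual_energy R M M + mutual_energy R N N"
proof -
  define w where "w t = ennreal (1 / (2 * t)) * indicator {0<..} t" for t :: real
  have [measurable]: "w \<in> borel_measurable borel" unfolding w_def by measurable
  define a where "a M N t = (\<integral>\<^sup>+x. \<integral>\<^sup>+y. ennreal (exp (- t * (norm (x - y))\<^sup>2) - exp (- t * R\<^sup>2)) \<partial>N \<partial>M)"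
    for M N :: "complex measure" and t
  define q where "q t M N = (\<integral>\<^sup>+x. \<integral>\<^sup>+y. ennreal (exp (- t * (norm (x - y))\<^sup>2)) \<partial>N \<partial>M)"
    for M N :: "complex measure" and t
  have bound: "norm (x - y) \<le> R" if "norm x \<le> \<rho>" "norm y \<le> \<rho>" for x y :: complex
    using norm_triangle_ineq4[of x y] R that by linarith
  have rep: "mutual_energy R M N = (\<integral>\<^sup>+t. a M N t * w t \<partial>lborel)"
    and aq: "t > 0 \<Longrightarrow> a M N t + ennreal (exp (- t * R\<^sup>2)) = q t M N"
    and am: "a M N \<in> borel_measurable borel"
    if "prob_space M" "prob_space N" and [measurable_cong]: "sets M = sets borel" "sets N = sets borel"
      and M: "AE x in M. norm x \<le> \<rho>" and N: "AE x in N. norm x \<le> \<rho>" for M N t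
  proof -
    interpret M: prob_space M by fact
    interpret N: prob_space N by fact
    interpret pM: pair_sigma_finite "lborel :: real measure" M ..
    interpret pN: pair_sigma_finite "lborel :: real measure" N ..
    have "mutual_energy R M N = (\<integral>\<^sup>+x. \<integral>\<^sup>+y. \<integral>\<^sup>+t. ennreal (exp (- t * (norm (x - y))\<^sup>2) - exp (- t * R\<^sup>2)) * w t \<partial>lborel \<partial>N \<partial>M)"
      unfolding mutual_energy_def
    proof (rule nn_integral_cong_AE)
      show "AE x in M. (\<integral>\<^sup>+y. log_kernel R (x - y) \<partial>N) =
        (\<integral>\<^sup>+y. \<integral>\<^sup>+t. ennreal (exp (- t * (norm (x - y))\<^sup>2) - exp (- t * R\<^sup>2)) * w t \<partial>lborel \<partial>N)"
        using M
      proof eventually_elim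
        case (elim x)
        show ?case
        proof (rule nn_integral_cong_AE)
          show "AE y in N. log_kernel R (x - y) =
            (\<integral>\<^sup>+t. ennreal (exp (- t * (norm (x - y))\<^sup>2) - exp (- t * R\<^sup>2)) * w t \<partial>lborel)"
            using N
          proof eventually_elim
            case (elim y)
            show ?case unfolding w_def
              by (rule log_kernel_eq_integral[OF R(1) bound]) fact+
          qed
        qed
      qed
    qed
    also have "\<dots> = (\<integral>\<^sup>+x. \<integral>\<^sup>+t. \<integral>\<^sup>+y. ennreal (exp (- t * (norm (x - y))\<^sup>2) - exp (- t * R\<^sup>2)) * w t \<partial>N \<partial>lborel \<partial>M)"
      by (intro nn_integral_cong pN.Fubini') measurable
    also have "\<dots> = (\<integral>\<^sup>+t. \<integral>\<^sup>+x. \<integral>\<^sup>+y. ennreal (exp (- t * (norm (x - y))\<^sup>2) - exp (- t * R\<^sup>2)) * w t \<partial>N \<partial>M \<partial>lborel)"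
      by (intro pM.Fubini') measurable
    also have "\<dots> = (\<integral>\<^sup>+t. a M N t * w t \<partial>lborel)"
      unfolding a_def by (simp add: nn_integral_multc)
    finally show "mutual_energy R M N = (\<integral>\<^sup>+t. a M N t * w t \<partial>lborel)" .
    show "a M N \<in> borel_measurable borel" unfolding a_def by measurable
    assume t: "t > 0"
    have sp: "emeasure M (space M) = 1" "emeasure N (space N) = 1"
      by (simp_all add: M.emeasure_space_1 N.emeasure_space_1)
    have "a M N t + ennreal (exp (- t * R\<^sup>2)) =
       (\<integral>\<^sup>+x. \<integral>\<^sup>+y. ennreal (exp (- t * (norm (x - y))\<^sup>2) - exp (- t * R\<^sup>2)) + ennreal (exp (- t * R\<^sup>2)) \<partial>N \<partial>M)"
      unfolding a_def by (simp add: nn_integral_add sp)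
    also have "\<dots> = q t M N" unfolding q_def
    proof (rule nn_integral_cong_AE)
      show "AE x in M. (\<integral>\<^sup>+y. ennreal (exp (- t * (norm (x - y))\<^sup>2) - exp (- t * R\<^sup>2)) + ennreal (exp (- t * R\<^sup>2)) \<partial>N)
         = (\<integral>\<^sup>+y. ennreal (exp (- t * (norm (x - y))\<^sup>2)) \<partial>N)"
        using M
      proof eventually_elim
        case (elim x)
        show ?case
        proof (rule nn_integral_cong_AE)
          show "AE y in N. ennreal (exp (- t * (norm (x - y))\<^sup>2) - exp (- t * R\<^sup>2)) + ennreal (exp (- t * R\<^sup>2))
             = ennreal (exp (- t * (norm (x - y))\<^sup>2))"
            using N
          proof eventually_elim
            case (elim y)
            have "(norm (x - y))\<^sup>2 \<le> R\<^sup>2"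
              using bound[OF \<open>norm x \<le> \<rho>\<close> elim] by (intro power_mono) auto
            then have "exp (- t * R\<^sup>2) \<le> exp (- t * (norm (x - y))\<^sup>2)" using t by simp
            then show ?case by (subst ennreal_plus[symmetric]) auto
          qed
        qed
      qed
    qed
    finally show "a M N t + ennreal (exp (- t * R\<^sup>2)) = q t M N" .
  qed
  have fin: "finite_measure M" "finite_measure N"
    using assms(1,2) by (simp_all add: prob_space.finite_measure)
  note MN = assms(1) assms(2) sM sN M N
    and MM = assms(1) assms(1) sM sM M M
    and NN = assms(2) assms(2) sN sN N N
  have key: "2 * a M N t \<le> a M M t + a N N t" if t: "t > 0" for t
  proof -
    let ?c = "ennreal (exp (- t * R\<^sup>2))"
    have "2 * (a M N t + ?c) \<le> (a M M t + ?c) + (a N N t + ?c)"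
      unfolding aq[OF MN t] aq[OF MM t] aq[OF NN t] unfolding q_def
      by (rule gauss_positive_definite) (use fin sM sN t in auto)
    then have "2 * ?c + 2 * a M N t \<le> 2 * ?c + (a M M t + a N N t)"
      by (simp add: distrib_left mult_2 ac_simps)
    then show ?thesis
      by (subst (asm) ennreal_add_left_cancel_le) (auto simp: ennreal_mult_eq_top_iff)
  qed
  note [measurable] = am[OF MN] am[OF MM] am[OF NN]
  have "2 * mutual_energy R M N = (\<integral>\<^sup>+t. 2 * a M N t * w t \<partial>lborel)"
    unfolding rep[OF MN] by (simp add: nn_integral_cmult mult.assoc)
  also have "\<dots> \<le> (\<integral>\<^sup>+t. a M M t * w t + a N N t * w t \<partial>lborel)"
  proof (rule nn_integral_mono)
    fix t :: real
    show "2 * a M N t * w t \<le> a M M t * w t + a N N t * w t"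
      using key[of t] mult_right_mono[of "2 * a M N t" "a M M t + a N N t" "w t"]
      by (cases "t > 0") (auto simp: w_def distrib_right)
  qed
  also have "\<dots> = mutual_energy R M M + mutual_energy R N N"
    unfolding rep[OF MM] rep[OF NN] by (rule nn_integral_add) measurable
  finally show ?thesis .
qed

section \<open>Circular means of the logarithm\<close>

lemma AE_norm_neq: "AE w in (lborel :: complex measure). norm w \<noteq> s"
proof -
  have "AE r in density lborel (\<lambda>r. ennreal (2 * pi * r)). r \<noteq> s"
    by (subst AE_density) (use AE_lborel_singleton[of s] in auto)
  then have "AE r in distr (lborel :: complex measure) borel norm. r \<noteq> s"
    unfolding distr_norm_lborel .
  then show ?thesis by (rule AE_distrD[rotated]) simp
qed

text \<open>Mean value property of the harmonic function \<open>log |1 - b u|\<close>, obtained from Cauchy's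
  integral formula for \<open>Ln (1 - b u)\<close> on the unit circle.\<close>

lemma circle_mean_log:
  assumes b: "norm (b::complex) < 1"
  shows "((\<lambda>x. ln (norm (1 - cis (2 * pi * x) * b))) has_integral 0) {0..1}"
proof -
  define f where "f u = Ln (1 - b * u)" for u
  have pos: "1 - b * u \<notin> \<real>\<^sub>\<le>\<^sub>0" "1 - b * u \<noteq> 0" if "norm u \<le> 1" for u
  proof -
    have "norm (b * u) \<le> norm b * 1"
      unfolding norm_mult using that by (intro mult_left_mono) auto
    then have "norm (b * u) < 1" using b by simp
    then have "Re (b * u) < 1" using complex_Re_le_cmod[of "b * u"] by linarith
    then show "1 - b * u \<notin> \<real>\<^sub>\<le>\<^sub>0" by (auto simp: complex_nonpos_Reals_iff)
    then show "1 - b * u \<noteq> 0" by auto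
  qed
  have "f holomorphic_on cball 0 1"
    unfolding f_def by (intro holomorphic_intros) (use pos in auto)
  then have "((\<lambda>u. f u / (u - 0)) has_contour_integral (2 * of_real pi * \<i> * f 0)) (circlepath 0 1)"
    by (rule Cauchy_integral_circlepath_simple) simp
  then have I: "((\<lambda>x. f (circlepath 0 1 x) / circlepath 0 1 x * vector_derivative (circlepath 0 1) (at x within {0..1}))
     has_integral 0) {0..1}"
    by (simp add: has_contour_integral_def f_def)
  have c: "circlepath 0 1 x = cis (2 * pi * x)" for x
    by (simp add: circlepath cis_conv_exp algebra_simps)
  have "((\<lambda>x. 2 * of_real pi * \<i> * f (cis (2 * pi * x))) has_integral 0) {0..1}"
  proof (rule has_integral_eq[OF _ I])
    fix x :: real assume x: "x \<in> {0..1}"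
    have "vector_derivative (circlepath 0 1) (at x within {0..1}) = 2 * pi * \<i> * cis (2 * pi * x)"
      using x by (simp add: vector_derivative_circlepath01 cis_conv_exp algebra_simps)
    then show "f (circlepath 0 1 x) / circlepath 0 1 x * vector_derivative (circlepath 0 1) (at x within {0..1}) =
        2 * of_real pi * \<i> * f (cis (2 * pi * x))"
      by (simp add: c)
  qed
  then have "((\<lambda>x. (1 / (2 * of_real pi * \<i>)) * (2 * of_real pi * \<i> * f (cis (2 * pi * x)))) has_integral
      (1 / (2 * of_real pi * \<i>)) * 0) {0..1}"
    by (rule has_integral_mult_right)
  then have "((\<lambda>x. f (cis (2 * pi * x))) has_integral 0) {0..1}"
    by simp
  then have "((\<lambda>x. Re (f (cis (2 * pi * x)))) has_integral 0) {0..1}"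
    by (drule_tac has_integral_linear[OF _ bounded_linear_Re]) (simp add: o_def)
  then show ?thesis
  proof (rule has_integral_eq[rotated])
    fix x :: real
    show "Re (f (cis (2 * pi * x))) = ln (norm (1 - cis (2 * pi * x) * b))"
      unfolding f_def using pos[of "cis (2 * pi * x)"] by (simp add: mult.commute)
  qed
qed

text \<open>The case \<open>|z| = |w|\<close> is excluded here; in the plane integrals it concerns a null set.\<close>

lemma circle_mean_log_kernel:
  assumes ne: "norm z \<noteq> norm w" and R: "norm z + norm w \<le> R"
  shows "(\<integral>\<^sup>+x. log_kernel R (z - cis (2 * pi * x) * w) * indicator {0..1} x \<partial>lborel)
    = ennreal (ln (R / max (norm z) (norm w)))"
proof -
  define m where "m = max (norm z) (norm w)"
  have m: "m > 0" "R > 0" using ne R norm_ge_zero[of z] norm_ge_zero[of w]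
    by (auto simp: m_def max_def simp del: norm_ge_zero intro: le_neq_trans)
  have "\<exists>b. norm b < 1 \<and> (\<forall>x. norm (z - cis (2 * pi * x) * w) = m * norm (1 - cis (2 * pi * x) * b))"
  proof (cases "norm w < norm z")
    case True
    have "norm (z - cis (2 * pi * x) * w) = m * norm (1 - cis (2 * pi * x) * (w / z))" for x
    proof -
      have "z - cis (2 * pi * x) * w = z * (1 - cis (2 * pi * x) * (w / z))"
        using True by (auto simp: algebra_simps)
      then show ?thesis using True by (simp add: norm_mult m_def)
    qed
    moreover have "norm (w / z) < 1" using True by (auto simp: norm_divide divide_simps)
    ultimately show ?thesis by blast
  next
    case False
    then have lt: "norm z < norm w" using ne by simp
    \<comment> \<open>conjugation moves the rotation from \<open>w\<close> to \<open>z\<close>, so that the first case applies to \<open>cnj (z / w)\<close>\<close>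
    have "norm (z - cis (2 * pi * x) * w) = m * norm (1 - cis (2 * pi * x) * cnj (z / w))" for x
    proof -
      have e: "z - cis (2 * pi * x) * w = - (cis (2 * pi * x) * w * cnj (1 - cis (2 * pi * x) * cnj (z / w)))"
      proof -
        have w: "w \<noteq> 0" using lt by auto
        have "cis (2 * pi * x) * cnj (cis (2 * pi * x)) = 1"
          by (simp add: cis_cnj cis_mult)
        then have "cis (2 * pi * x) * w * (1 - cnj (cis (2 * pi * x)) * (z / w)) = cis (2 * pi * x) * w - 1 * z"
          using w by (simp add: right_diff_distrib mult.assoc[symmetric] mult.commute[of _ w] flip: mult.assoc)
        then show ?thesis by simp
      qed
      have "norm (z - cis (2 * pi * x) * w) = norm w * norm (cnj (1 - cis (2 * pi * x) * cnj (z / w)))"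
        unfolding e norm_minus_cancel norm_mult by simp
      then show ?thesis using lt by (simp only: complex_mod_cnj m_def)
    qed
    moreover have "norm (cnj (z / w)) < 1" using lt by (auto simp: norm_divide divide_simps)
    ultimately show ?thesis by blast
  qed
  then obtain b where b: "norm b < 1"
    and eq: "\<And>x. norm (z - cis (2 * pi * x) * w) = m * norm (1 - cis (2 * pi * x) * b)" by blast
  have pos: "norm (1 - cis (2 * pi * x) * b) > 0" for x
  proof -
    have "norm (cis (2 * pi * x) * b) \<noteq> norm (1::complex)" using b by (simp add: norm_mult)
    then have "1 - cis (2 * pi * x) * b \<noteq> 0" by (metis eq_iff_diff_eq_0)
    then show ?thesis by simp
  qed
  define h where "h x = ln (R / m) - ln (norm (1 - cis (2 * pi * x) * b))" for x
  have hk: "log_kernel R (z - cis (2 * pi * x) * w) = ennreal (h x)" and h0: "h x \<ge> 0" for x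
  proof -
    have n: "norm (z - cis (2 * pi * x) * w) > 0" unfolding eq using m pos by simp
    have hx: "h x = ln (R / norm (z - cis (2 * pi * x) * w))"
      unfolding eq h_def using m pos[of x] by (simp add: ln_div ln_mult)
    then show "log_kernel R (z - cis (2 * pi * x) * w) = ennreal (h x)"
      using n by (simp add: log_kernel_def)
    have "norm (z - cis (2 * pi * x) * w) \<le> R"
      using norm_triangle_ineq4[of z "cis (2 * pi * x) * w"] R by (simp add: norm_mult)
    then show "h x \<ge> 0" unfolding hx using n by (intro ln_ge_zero) simp
  qed
  have "(h has_integral (ln (R / m) * (1 - 0) - 0)) {0..1}"
    unfolding h_def
    by (intro has_integral_diff circle_mean_log b)
       (use has_integral_const_real[of "ln (R / m)" 0 1] in simp)
  then have "(h has_integral ln (R / m)) {0..1}" by simp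
  then have "((\<lambda>x. if x \<in> {0..1} then h x else 0) has_integral ln (R / m)) UNIV"
    by (simp only: has_integral_restrict_UNIV)
  also have "(\<lambda>x. if x \<in> {0..1} then h x else 0) = (\<lambda>x. h x * indicator {0..1} x)"
    by (auto simp: indicator_def)
  finally have "((\<lambda>x. h x * indicator {0..1} x) has_integral ln (R / m)) UNIV" .
  moreover have "(\<lambda>x. h x * indicator {0..1} x) \<in> borel_measurable borel"
  proof -
    have "h \<in> borel_measurable borel"
      unfolding h_def by (intro borel_measurable_diff borel_measurable_ln borel_measurable_continuous_onI)
        (auto intro!: continuous_intros)
    then show ?thesis by measurable
  qed
  ultimately have "(\<integral>\<^sup>+x. ennreal (h x * indicator {0..1} x) \<partial>lborel) = ennreal (ln (R / m))"
    by (intro nn_integral_has_integral_lborel) (auto simp: h0)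
  also have "(\<integral>\<^sup>+x. ennreal (h x * indicator {0..1} x) \<partial>lborel) =
     (\<integral>\<^sup>+x. log_kernel R (z - cis (2 * pi * x) * w) * indicator {0..1} x \<partial>lborel)"
    by (intro nn_integral_cong) (auto simp: hk indicator_def)
  finally show ?thesis by (simp add: m_def)
qed

text \<open>The potential of a rotation invariant density depends on \<open>z\<close> only through \<open>|z|\<close>: each circle
  of radius \<open>s\<close> contributes \<open>log (R / max |z| s)\<close>.\<close>

lemma nn_integral_log_kernel_radial:
  fixes h :: "real \<Rightarrow> ennreal"
  assumes [measurable]: "h \<in> borel_measurable borel"
    and h: "\<And>r. r > \<rho> \<Longrightarrow> h r = 0" and R: "norm z + \<rho> \<le> R"
  shows "(\<integral>\<^sup>+w. log_kernel R (z - w) * h (norm w) \<partial>lborel)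
    = (\<integral>\<^sup>+w. ennreal (ln (R / max (norm z) (norm (w::complex)))) * h (norm w) \<partial>lborel)"
proof -
  have [measurable]: "(\<lambda>x::real. cis (2 * pi * x)) \<in> borel_measurable borel"
    by (intro borel_measurable_continuous_onI) (auto intro!: continuous_intros)
  have rot: "(\<integral>\<^sup>+w. log_kernel R (z - cis x * w) * h (norm w) \<partial>lborel) = (\<integral>\<^sup>+w. log_kernel R (z - w) * h (norm w) \<partial>lborel)"
    for x
  proof -
    have "(\<integral>\<^sup>+w. log_kernel R (z - cis x * w) * h (norm w) \<partial>lborel) =
        (\<integral>\<^sup>+w. log_kernel R (z - cis x * w) * h (norm (cis x * w)) \<partial>lborel)"
      by (simp add: norm_mult)
    also have "\<dots> = (\<integral>\<^sup>+w. log_kernel R (z - w) * h (norm w) \<partial>lborel)"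
      by (rule nn_integral_rotate[of "\<lambda>w. log_kernel R (z - w) * h (norm w)"]) auto
    finally show ?thesis .
  qed
  \<comment> \<open>average over all rotations of the variable \<open>w\<close>\<close>
  have "(\<integral>\<^sup>+w. log_kernel R (z - w) * h (norm w) \<partial>lborel)
      = (\<integral>\<^sup>+x. (\<integral>\<^sup>+w. log_kernel R (z - w) * h (norm w) \<partial>lborel) * indicator {0..1::real} x \<partial>lborel)"
    by (simp add: nn_integral_cmult)
  also have "\<dots> = (\<integral>\<^sup>+x. \<integral>\<^sup>+w. (log_kernel R (z - cis (2 * pi * x) * w) * h (norm w)) * indicator {0..1::real} x \<partial>lborel \<partial>lborel)"
  proof (rule nn_integral_cong)
    fix x :: real
    show "(\<integral>\<^sup>+w. log_kernel R (z - w) * h (norm w) \<partial>lborel) * indicator {0..1::real} x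
      = (\<integral>\<^sup>+w. (log_kernel R (z - cis (2 * pi * x) * w) * h (norm w)) * indicator {0..1::real} x \<partial>lborel)"
      unfolding rot[of "2 * pi * x", symmetric] by (rule nn_integral_multc[symmetric]) measurable
  qed
  also have "\<dots> = (\<integral>\<^sup>+w. \<integral>\<^sup>+x. (log_kernel R (z - cis (2 * pi * x) * w) * h (norm w)) * indicator {0..1::real} x \<partial>lborel \<partial>lborel)"
    by (rule lborel_pair.Fubini'[symmetric]) measurable
  also have "\<dots> = (\<integral>\<^sup>+w. (\<integral>\<^sup>+x. log_kernel R (z - cis (2 * pi * x) * w) * indicator {0..1::real} x \<partial>lborel) * h (norm w) \<partial>lborel)"
  proof (rule nn_integral_cong)
    fix w :: complex
    have "(\<integral>\<^sup>+x. (log_kernel R (z - cis (2 * pi * x) * w) * h (norm w)) * indicator {0..1::real} x \<partial>lborel)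
      = (\<integral>\<^sup>+x. (log_kernel R (z - cis (2 * pi * x) * w) * indicator {0..1::real} x) * h (norm w) \<partial>lborel)"
      by (simp only: ac_simps)
    also have "\<dots> = (\<integral>\<^sup>+x. log_kernel R (z - cis (2 * pi * x) * w) * indicator {0..1::real} x \<partial>lborel) * h (norm w)"
      by (rule nn_integral_multc) measurable
    finally show "(\<integral>\<^sup>+x. (log_kernel R (z - cis (2 * pi * x) * w) * h (norm w)) * indicator {0..1::real} x \<partial>lborel)
      = (\<integral>\<^sup>+x. log_kernel R (z - cis (2 * pi * x) * w) * indicator {0..1::real} x \<partial>lborel) * h (norm w)" .
  qed
  also have "\<dots> = (\<integral>\<^sup>+w. ennreal (ln (R / max (norm z) (norm (w::complex)))) * h (norm w) \<partial>lborel)"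
  proof (rule nn_integral_cong_AE)
    show "AE w in lborel. (\<integral>\<^sup>+x. log_kernel R (z - cis (2 * pi * x) * w) * indicator {0..1::real} x \<partial>lborel) * h (norm w)
        = ennreal (ln (R / max (norm z) (norm w))) * h (norm w)"
      using AE_norm_neq[of "norm z"]
    proof eventually_elim
      case (elim w)
      show ?case
      proof (cases "norm w \<le> \<rho>")
        case True
        then show ?thesis using elim R by (subst circle_mean_log_kernel) auto
      qed (simp add: h)
    qed
  qed
  finally show ?thesis .
qed

section \<open>The equilibrium measure of a radial field\<close>

text \<open>Fundamental theorem of calculus on a half-open interval, where the antiderivative has only a
  one-sided limit at the left end.\<close>

lemma nn_integral_FTC_Ioc:
  fixes f F :: "real \<Rightarrow> real"
  assumes [measurable]: "f \<in> borel_measurable borel"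
    and F: "\<And>x. 0 < x \<Longrightarrow> x \<le> c \<Longrightarrow> (F has_real_derivative f x) (at x)"
    and nn: "\<And>x. 0 < x \<Longrightarrow> x \<le> c \<Longrightarrow> 0 \<le> f x"
    and lim: "(F \<longlongrightarrow> L) (at_right 0)" and c: "c > 0"
  shows "(\<integral>\<^sup>+x. ennreal (f x) * indicator {0<..c} x \<partial>lborel) = ennreal (F c - L)"
proof -
  define e where "e n = c * inverse (real (Suc n))" for n
  have e: "0 < e n" "e n \<le> c" for n using c by (auto simp: e_def field_simps)
  have "decseq e" unfolding e_def decseq_def using c
    by (auto intro!: mult_left_mono simp: field_simps)
  then have dec: "e n \<le> e m" if "m \<le> n" for m n using that by (simp add: decseq_def)
  have "(\<lambda>n. c * inverse (real (Suc n))) \<longlonglongrightarrow> c * 0"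
    by (intro tendsto_mult tendsto_const LIMSEQ_inverse_real_of_nat)
  then have e0: "e \<longlonglongrightarrow> 0" by (simp add: e_def[abs_def])
  have inc: "incseq (\<lambda>n x. ennreal (f x) * indicator {e n..c} x)"
    using dec by (auto simp: incseq_def le_fun_def indicator_def intro: order_trans)
  have sup: "(SUP n. ennreal (f x) * indicator {e n..c} x) = ennreal (f x) * indicator {0<..c} x" for x
  proof (cases "0 < x \<and> x \<le> c")
    case True
    have "\<forall>\<^sub>F n in sequentially. e n < x" using order_tendstoD(2)[OF e0, of x] True by simp
    then have "(\<lambda>n. ennreal (f x) * indicator {e n..c} x) \<longlonglongrightarrow> ennreal (f x) * indicator {0<..c} x"
      by (intro tendsto_eventually) (elim eventually_mono, use True in \<open>auto simp: indicator_def\<close>)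
    moreover have "(\<lambda>n. ennreal (f x) * indicator {e n..c} x) \<longlonglongrightarrow> (SUP n. ennreal (f x) * indicator {e n..c} x)"
      using inc by (intro LIMSEQ_SUP) (auto simp: incseq_def le_fun_def)
    ultimately show ?thesis by (rule LIMSEQ_unique[rotated])
  next
    case False
    then have "indicator {e n..c} x = (0::ennreal)" for n
      using e(1)[of n] by (auto simp: indicator_def)
    then have "(SUP n. ennreal (f x) * indicator {e n..c} x) = (SUP n::nat. 0)"
      by (simp only: mult_zero_right)
    then show ?thesis using False by (simp add: indicator_def)
  qed
  have fin: "(\<integral>\<^sup>+x. ennreal (f x) * indicator {e n..c} x \<partial>lborel) = ennreal (F c - F (e n))" for n
    using e[of n] by (intro nn_integral_FTC_Icc) (auto intro!: F nn)
  have "(\<integral>\<^sup>+x. ennreal (f x) * indicator {0<..c} x \<partial>lborel) = (SUP n. ennreal (F c - F (e n)))"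
    unfolding sup[symmetric] fin[symmetric]
    by (rule nn_integral_monotone_convergence_SUP[OF inc]) measurable
  moreover have "(\<lambda>n. ennreal (F c - F (e n))) \<longlonglongrightarrow> (SUP n. ennreal (F c - F (e n)))"
    unfolding fin[symmetric]
    by (intro LIMSEQ_SUP incseq_nn_integral inc)
  moreover have "(\<lambda>n. ennreal (F c - F (e n))) \<longlonglongrightarrow> ennreal (F c - L)"
  proof -
    have "e n \<noteq> 0" for n using e(1)[of n] by simp
    then have "filterlim e (at_right 0) sequentially"
      using e0 e(1) by (auto simp: filterlim_at intro!: always_eventually)
    then have "(\<lambda>n. F (e n)) \<longlonglongrightarrow> L" by (rule filterlim_compose[OF lim])
    then show ?thesis by (intro tendsto_ennrealI tendsto_diff tendsto_const)
  qed
  ultimately show ?thesis using LIMSEQ_unique by metis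
qed

text \<open>A radial external field \<open>g\<close> and the radius \<open>T\<close> of its equilibrium disc.\<close>

locale radial_field =
  fixes g :: "real \<Rightarrow> real" and T :: real
  assumes g_nonneg: "\<And>r. r \<ge> 0 \<Longrightarrow> g r \<ge> 0"
    and g_mono: "mono_on {0..} g"
    and g_diff: "\<And>r. r > 0 \<Longrightarrow> g differentiable (at r)"
    and g_diff2: "\<And>r. r > 0 \<Longrightarrow> deriv g differentiable (at r)"
    and rg'_lim: "((\<lambda>r. r * deriv g r) \<longlongrightarrow> 0) (at_right 0)"
    and rg'_mono: "mono_on {0<..} (\<lambda>r. r * deriv g r)"
    and T_pos: "T > 0" and T_eq: "T * deriv g T = 2"
begin

text \<open>The derivative of \<open>r g'(r)\<close>, set to \<open>0\<close> off the positive half-line.\<close>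

definition G' :: "real \<Rightarrow> real" where
  "G' r = (if 0 < r then deriv g r + r * deriv (deriv g) r else 0)"

lemma DERIV_g: "r > 0 \<Longrightarrow> (g has_real_derivative deriv g r) (at r)"
  using g_diff by (simp add: DERIV_deriv_iff_real_differentiable)

lemma DERIV_g': "r > 0 \<Longrightarrow> (deriv g has_real_derivative deriv (deriv g) r) (at r)"
  using g_diff2 by (simp add: DERIV_deriv_iff_real_differentiable)

lemma DERIV_G: "r > 0 \<Longrightarrow> ((\<lambda>r. r * deriv g r) has_real_derivative G' r) (at r)"
  by (auto intro!: derivative_eq_intros DERIV_g' simp: G'_def)

lemma G'_nonneg: "G' r \<ge> 0"
proof (cases "r > 0")
  case True
  then show ?thesis
    by (intro mono_on_imp_deriv_nonneg[OF rg'_mono DERIV_G]) (auto simp: interior_open)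
qed (simp add: G'_def)

lemma measurable_deriv_g: "(\<lambda>r. if 0 < r then deriv g r else 0) \<in> borel_measurable borel"
proof -
  have "continuous_on {0<..} (deriv g)"
    by (rule continuous_at_imp_continuous_on) (auto intro!: DERIV_isCont[OF DERIV_g'])
  then have "(\<lambda>r. if r \<in> {0<..} then deriv g r else 0) \<in> borel_measurable borel"
    by (intro borel_measurable_continuous_on_if) auto
  then show ?thesis by simp
qed

lemma G'_measurable[measurable]: "G' \<in> borel_measurable borel"
proof -
  note [measurable] = measurable_deriv_g
  have [measurable]: "(\<lambda>r. if 0 < r then deriv (deriv g) r else 0) \<in> borel_measurable borel"
  proof (rule borel_measurable_LIMSEQ_real)
    define d where "d i r = (if 0 < r then ((if 0 < r + inverse (real (Suc i)) then deriv g (r + inverse (real (Suc i))) else 0)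
       - (if 0 < r then deriv g r else 0)) / inverse (real (Suc i)) else 0)" for i r
    show "d i \<in> borel_measurable borel" for i
    proof -
      have [measurable]: "(\<lambda>r. if 0 < r + inverse (real (Suc i)) then deriv g (r + inverse (real (Suc i))) else 0) \<in> borel_measurable borel"
        by (rule measurable_compose[OF _ measurable_deriv_g, of "\<lambda>r. r + inverse (real (Suc i))"]) measurable
      show ?thesis unfolding d_def by measurable
    qed
    fix r :: real
    show "(\<lambda>i. d i r) \<longlonglongrightarrow> (if 0 < r then deriv (deriv g) r else 0)"
    proof (cases "r > 0")
      case True
      have "filterlim (\<lambda>i. inverse (real (Suc i))) (at 0) sequentially"
        using LIMSEQ_inverse_real_of_nat by (auto simp: filterlim_at intro!: always_eventually)
      from filterlim_compose[OF DERIV_D[OF DERIV_g'[OF True]] this]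
      have "(\<lambda>i. (deriv g (r + inverse (real (Suc i))) - deriv g r) / inverse (real (Suc i))) \<longlonglongrightarrow> deriv (deriv g) r" .
      moreover have "r + inverse (real (Suc i)) > 0" for i using True by (simp add: add_pos_pos)
      ultimately show ?thesis using True by (simp add: d_def)
    qed (simp add: d_def)
  qed
  have "G' = (\<lambda>r. (if 0 < r then deriv g r else 0) + r * (if 0 < r then deriv (deriv g) r else 0))"
    by (auto simp: G'_def)
  then show ?thesis by simp
qed

text \<open>The density of \<open>\<mu>\<close> as a function of the modulus. On the positive half-line
  \<open>g'' + g' / r = G' / r\<close>, which is nonnegative.\<close>

definition H :: "real \<Rightarrow> ennreal" where
  "H r = ennreal (1 / (4 * pi * r) * G' r) * indicator {0<..<T} r"

lemma H_measurable[measurable]: "H \<in> borel_measurable borel"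
  unfolding H_def by measurable

lemma H_eq: "ennreal (2 * pi * r) * (f * H r) = f * ennreal (G' r / 2) * indicator {0<..<T} r"
proof (cases "0 < r \<and> r < T")
  case True
  then have "ennreal (2 * pi * r) * (f * H r) = f * (ennreal (2 * pi * r) * ennreal (1 / (4 * pi * r) * G' r))"
    by (simp add: H_def ac_simps)
  also have "ennreal (2 * pi * r) * ennreal (1 / (4 * pi * r) * G' r) = ennreal (2 * pi * r * (1 / (4 * pi * r) * G' r))"
    using True G'_nonneg[of r] by (intro ennreal_mult[symmetric]) auto
  also have "2 * pi * r * (1 / (4 * pi * r) * G' r) = G' r / 2"
    using True by (simp add: field_simps)
  finally show ?thesis using True by simp
qed (auto simp: H_def)

text \<open>The two densities may differ at \<open>0\<close>, where the derivatives of \<open>g\<close> have no meaning.\<close>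

lemma radial_measure_eq: "radial_measure g T = density lborel (\<lambda>z. H (norm z))"
proof -
  define f0 where "f0 z = ennreal (1 / (4 * pi) * (deriv (deriv g) (norm z) + 1 / norm z * deriv g (norm z)))
       * indicator (ball 0 T) z" for z :: complex
  have eq: "f0 z = H (norm z)" if "z \<noteq> 0" for z
    using that by (auto simp: f0_def H_def G'_def indicator_def field_simps)
  then have "f0 = (\<lambda>z. if z = 0 then f0 0 else H (norm z))" by auto
  also have "\<dots> \<in> borel_measurable borel" by measurable
  finally have [measurable]: "f0 \<in> borel_measurable borel" .
  have "density lborel f0 = density lborel (\<lambda>z. H (norm z))"
    by (rule density_cong) (use AE_lborel_singleton[of 0] eq in auto)
  then show ?thesis by (simp add: radial_measure_def f0_def[abs_def])
qed

text \<open>The equilibrium measure of the field.\<close>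

definition \<mu> :: "complex measure" where "\<mu> = radial_measure g T"

lemma sets_mu[simp, measurable_cong]: "sets \<mu> = sets borel"
  by (simp add: \<mu>_def radial_measure_eq)

lemma space_mu[simp]: "space \<mu> = UNIV"
  by (simp add: \<mu>_def radial_measure_eq)

lemma nn_integral_mu:
  assumes [measurable]: "f \<in> borel_measurable borel"
  shows "(\<integral>\<^sup>+z. f z \<partial>\<mu>) = (\<integral>\<^sup>+z. f z * H (norm z) \<partial>lborel)"
  unfolding \<mu>_def radial_measure_eq by (subst nn_integral_density) (auto simp: mult.commute)

lemma nn_integral_mu_radial:
  assumes [measurable]: "f \<in> borel_measurable borel"
  shows "(\<integral>\<^sup>+z. f (norm z) \<partial>\<mu>) = (\<integral>\<^sup>+r. f r * ennreal (G' r / 2) * indicator {0<..<T} r \<partial>lborel)"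
  by (subst nn_integral_mu, simp, subst nn_integral_radial[of "\<lambda>r. f r * H r"]) (auto simp: H_eq)

lemma nn_integral_G':
  assumes c: "c > 0"
  shows "(\<integral>\<^sup>+r. ennreal (G' r / 2) * indicator {0<..c} r \<partial>lborel) = ennreal (c * deriv g c / 2)"
proof -
  have "(\<integral>\<^sup>+r. ennreal (G' r / 2) * indicator {0<..c} r \<partial>lborel) = ennreal (c * deriv g c / 2 - 0)"
  proof (rule nn_integral_FTC_Ioc[OF _ _ _ _ c])
    show "((\<lambda>r. r * deriv g r / 2) \<longlongrightarrow> 0) (at_right 0)"
      using tendsto_divide[OF rg'_lim tendsto_const[of 2]] by simp
    show "((\<lambda>r. r * deriv g r / 2) has_real_derivative G' r / 2) (at r)" if "0 < r" for r
      using DERIV_cdivide[OF DERIV_G[OF that]] .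
  qed (auto simp: G'_nonneg)
  then show ?thesis by simp
qed

lemma AE_mu: "AE z in \<mu>. z \<noteq> 0 \<and> norm z < T"
  unfolding \<mu>_def radial_measure_eq by (subst AE_density) (auto simp: H_def indicator_def)

lemma prob_space_mu: "prob_space \<mu>"
proof (rule prob_spaceI)
  have "emeasure \<mu> (space \<mu>) = (\<integral>\<^sup>+z. 1 \<partial>\<mu>)" by simp
  also have "\<dots> = (\<integral>\<^sup>+r. 1 * ennreal (G' r / 2) * indicator {0<..<T} r \<partial>lborel)"
    by (rule nn_integral_mu_radial) simp
  also have "\<dots> = (\<integral>\<^sup>+r. ennreal (G' r / 2) * indicator {0<..T} r \<partial>lborel)"
    by (rule nn_integral_cong_AE, rule AE_mp[OF AE_lborel_singleton[of T]], rule AE_I2) (auto simp: indicator_def)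
  also have "\<dots> = 1" using nn_integral_G'[OF T_pos] by (simp add: T_eq)
  finally show "emeasure \<mu> (space \<mu>) = 1" .
qed

lemma potential_mu_radial:
  assumes R: "norm z + T \<le> R"
  shows "(\<integral>\<^sup>+w. log_kernel R (z - w) \<partial>\<mu>) =
    (\<integral>\<^sup>+r. ennreal (ln (R / max (norm z) r)) * ennreal (G' r / 2) * indicator {0<..<T} r \<partial>lborel)"
proof -
  have "(\<integral>\<^sup>+w. log_kernel R (z - w) \<partial>\<mu>) = (\<integral>\<^sup>+w. log_kernel R (z - w) * H (norm w) \<partial>lborel)"
    by (rule nn_integral_mu) measurable
  also have "\<dots> = (\<integral>\<^sup>+w. ennreal (ln (R / max (norm z) (norm (w::complex)))) * H (norm w) \<partial>lborel)"
    by (rule nn_integral_log_kernel_radial[OF _ _ R]) (auto simp: H_def)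
  also have "\<dots> = (\<integral>\<^sup>+w. ennreal (ln (R / max (norm z) (norm w))) \<partial>\<mu>)"
    by (rule nn_integral_mu[symmetric]) measurable
  also have "\<dots> = (\<integral>\<^sup>+r. ennreal (ln (R / max (norm z) r)) * ennreal (G' r / 2) * indicator {0<..<T} r \<partial>lborel)"
    by (rule nn_integral_mu_radial) measurable
  finally show ?thesis .
qed

lemma potential_mu_outside:
  assumes R: "norm z + T \<le> R" and z: "T \<le> norm z"
  shows "(\<integral>\<^sup>+w. log_kernel R (z - w) \<partial>\<mu>) = ennreal (ln (R / norm z))"
proof -
  have "(\<integral>\<^sup>+w. log_kernel R (z - w) \<partial>\<mu>) =
    (\<integral>\<^sup>+r. ennreal (ln (R / norm z)) * (ennreal (G' r / 2) * indicator {0<..T} r) \<partial>lborel)"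
    unfolding potential_mu_radial[OF R]
    by (rule nn_integral_cong_AE, rule AE_mp[OF AE_lborel_singleton[of T]], rule AE_I2)
      (use z in \<open>auto simp: indicator_def max_def\<close>)
  also have "\<dots> = ennreal (ln (R / norm z)) * ennreal (T * deriv g T / 2)"
    by (subst nn_integral_cmult) (auto simp: nn_integral_G'[OF T_pos])
  finally show ?thesis by (simp add: T_eq)
qed

lemma potential_mu_inside:
  assumes R: "norm z + T \<le> R" and z: "z \<noteq> 0" "norm z \<le> T"
  shows "(\<integral>\<^sup>+w. log_kernel R (z - w) \<partial>\<mu>) = ennreal (ln R - ln T + (g T - g (norm z)) / 2)"
proof -
  define s where "s = norm z"
  have s: "0 < s" "s \<le> T" "s \<le> R" "0 < R" "T \<le> R" using z R T_pos norm_ge_zero[of z] by (auto simp: s_def simp del: norm_ge_zero)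
  have sg: "s * deriv g s \<ge> 0"
    by (rule tendsto_upperbound[OF rg'_lim])
      (use s(1) in \<open>auto simp: eventually_at_right_field intro!: exI[of _ s] mono_onD[OF rg'_mono]\<close>)
  have "(\<integral>\<^sup>+w. log_kernel R (z - w) \<partial>\<mu>) =
    (\<integral>\<^sup>+r. ennreal (ln (R / s)) * (ennreal (G' r / 2) * indicator {0<..s} r)
        + ennreal ((ln R - ln r) * (G' r / 2)) * indicator {s..T} r \<partial>lborel)"
    unfolding potential_mu_radial[OF R] s_def[symmetric]
  proof (rule nn_integral_cong_AE)
    show "AE r in lborel. ennreal (ln (R / max s r)) * ennreal (G' r / 2) * indicator {0<..<T} r =
      ennreal (ln (R / s)) * (ennreal (G' r / 2) * indicator {0<..s} r)
        + ennreal ((ln R - ln r) * (G' r / 2)) * indicator {s..T} r"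
      using AE_lborel_singleton[of T] AE_lborel_singleton[of s]
    proof eventually_elim
      case (elim r)
      consider "r \<le> 0" | "0 < r" "r < s" | "s < r" "r < T" | "T < r" using elim by linarith
      then show ?case
      proof cases
        case 3
        then have "ln (R / max s r) = ln R - ln r" "ln R - ln r \<ge> 0"
          using s by (auto simp: ln_div)
        then show ?thesis using 3 s G'_nonneg[of r] by (simp add: ennreal_mult[symmetric])
      qed (use s in auto)
    qed
  qed
  also have "\<dots> = ennreal (ln (R / s)) * ennreal (s * deriv g s / 2) +
      (\<integral>\<^sup>+r. ennreal ((ln R - ln r) * (G' r / 2)) * indicator {s..T} r \<partial>lborel)"
    by (subst nn_integral_add) (auto simp: nn_integral_cmult nn_integral_G'[OF s(1)])
  \<comment> \<open>an antiderivative of \<open>G' (log R - log r)\<close> is \<open>G log R - G log r + g\<close>, where \<open>G = r g'\<close>\<close>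
  also have "(\<integral>\<^sup>+r. ennreal ((ln R - ln r) * (G' r / 2)) * indicator {s..T} r \<partial>lborel) =
      ennreal ((ln R * (T * deriv g T) - T * deriv g T * ln T + g T) / 2
        - (ln R * (s * deriv g s) - s * deriv g s * ln s + g s) / 2)"
  proof (rule nn_integral_FTC_Icc)
    fix r assume r: "r \<in> {s..T}"
    then have "r > 0" using s by auto
    show "((\<lambda>r. (ln R * (r * deriv g r) - r * deriv g r * ln r + g r) / 2) has_real_derivative (ln R - ln r) * (G' r / 2)) (at r)"
      by (rule derivative_eq_intros DERIV_G DERIV_g DERIV_g' \<open>r > 0\<close> refl)+
        (use \<open>r > 0\<close> in \<open>auto simp: field_simps G'_def\<close>)
    show "0 \<le> (ln R - ln r) * (G' r / 2)" using r s G'_nonneg[of r] by auto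
  qed (use s in auto)
  also have "ennreal (ln (R / s)) * ennreal (s * deriv g s / 2) = ennreal ((ln R - ln s) * (s * deriv g s / 2))"
  proof -
    show ?thesis using s sg by (subst ennreal_mult[symmetric]) (auto simp: ln_div)
  qed
  also have "ennreal ((ln R - ln s) * (s * deriv g s / 2)) + ennreal ((ln R * (T * deriv g T) - T * deriv g T * ln T + g T) / 2
        - (ln R * (s * deriv g s) - s * deriv g s * ln s + g s) / 2) =
     ennreal ((ln R - ln s) * (s * deriv g s / 2) + ((ln R * (T * deriv g T) - T * deriv g T * ln T + g T) / 2
        - (ln R * (s * deriv g s) - s * deriv g s * ln s + g s) / 2))"
  proof (rule ennreal_plus[symmetric])
    show "0 \<le> (ln R - ln s) * (s * deriv g s / 2)" using s sg by auto
    have "s * deriv g s \<le> 2" using mono_onD[OF rg'_mono, of s T] s T_pos T_eq by auto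
    then have 1: "(ln R - ln T) * (2 - s * deriv g s) \<ge> 0" using s T_pos by auto
    have 2: "s * deriv g s * (ln T - ln s) \<le> g T - g s"
    proof -
      define \<phi> where "\<phi> r = g r - s * deriv g s * ln r" for r
      have "\<phi> s \<le> \<phi> T"
      proof (rule DERIV_nonneg_imp_nondecreasing[OF s(2)])
        fix r assume r: "s \<le> r" "r \<le> T"
        have "(\<phi> has_real_derivative (deriv g r - s * deriv g s / r)) (at r)"
          unfolding \<phi>_def using r s by (auto intro!: derivative_eq_intros DERIV_g)
        moreover have "deriv g r - s * deriv g s / r \<ge> 0"
          using mono_onD[OF rg'_mono, of s r] r s by (auto simp: field_simps)
        ultimately show "\<exists>y. (\<phi> has_real_derivative y) (at r) \<and> 0 \<le> y" by blast
      qed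
      then show ?thesis by (simp add: \<phi>_def algebra_simps)
    qed
    show "0 \<le> (ln R * (T * deriv g T) - T * deriv g T * ln T + g T) / 2
        - (ln R * (s * deriv g s) - s * deriv g s * ln s + g s) / 2"
    proof -
      have "(ln R * 2 - 2 * ln T + g T) / 2 - (ln R * (s * deriv g s) - s * deriv g s * ln s + g s) / 2
          = ((ln R - ln T) * (2 - s * deriv g s) + ((g T - g s) - s * deriv g s * (ln T - ln s))) / 2"
        by (simp add: field_simps)
      then show ?thesis
        unfolding T_eq mult.commute[of "ln R" 2] using 1 2 by (simp only:) simp
    qed
  qed
  also have "(ln R - ln s) * (s * deriv g s / 2) + ((ln R * (T * deriv g T) - T * deriv g T * ln T + g T) / 2
        - (ln R * (s * deriv g s) - s * deriv g s * ln s + g s) / 2) = ln R - ln T + (g T - g s) / 2"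
    unfolding T_eq by (simp add: field_simps)
  finally show ?thesis by (simp add: s_def)
qed

text \<open>With \<open>potential_mu_inside\<close>, the Euler-Lagrange conditions for \<open>\<mu>\<close>: its potential plus \<open>g / 2\<close>
  is constant on the disc, except perhaps at its centre, and not smaller outside. Outside this is because \<open>g(r) - 2 log r\<close>
  increases for \<open>r \<ge> T\<close>.\<close>

lemma potential_mu_ge:
  assumes R: "norm z + T \<le> R" and z: "z \<noteq> 0"
  shows "ennreal (ln R - ln T + g T / 2) \<le> (\<integral>\<^sup>+w. log_kernel R (z - w) \<partial>\<mu>) + ennreal (g (norm z) / 2)"
proof (cases "norm z \<le> T")
  case True
  have "g (norm z) \<le> g T" "ln T \<le> ln R" "0 \<le> g (norm z)"
    using mono_onD[OF g_mono, of "norm z" T] True T_pos R g_nonneg[of "norm z"] z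
    by (auto intro!: ln_mono simp del: ln_le_cancel_iff) (smt (verit) norm_ge_zero)
  then have "ennreal (ln R - ln T + (g T - g (norm z)) / 2) + ennreal (g (norm z) / 2)
      = ennreal (ln R - ln T + (g T - g (norm z)) / 2 + g (norm z) / 2)"
    by (intro ennreal_plus[symmetric]) auto
  also have "ln R - ln T + (g T - g (norm z)) / 2 + g (norm z) / 2 = ln R - ln T + g T / 2"
    by (simp add: field_simps)
  finally show ?thesis unfolding potential_mu_inside[OF R z True] by simp
next
  case False
  have le: "g T - 2 * ln T \<le> g (norm z) - 2 * ln (norm z)"
  proof (rule DERIV_nonneg_imp_nondecreasing[where f="\<lambda>r. g r - 2 * ln r"])
    fix r assume r: "T \<le> r" "r \<le> norm z"
    have "((\<lambda>r. g r - 2 * ln r) has_real_derivative (deriv g r - 2 / r)) (at r)"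
      using r T_pos by (auto intro!: derivative_eq_intros DERIV_g)
    moreover have "deriv g r - 2 / r \<ge> 0"
      using mono_onD[OF rg'_mono, of T r] r T_pos T_eq by (auto simp: field_simps)
    ultimately show "\<exists>y. ((\<lambda>r. g r - 2 * ln r) has_real_derivative y) (at r) \<and> 0 \<le> y" by blast
  qed (use False in auto)
  have "norm z > 0" "R > 0" "norm z \<le> R" using z R T_pos zero_less_norm_iff[of z] by linarith+
  moreover have "0 \<le> g (norm z)" by (simp add: g_nonneg)
  ultimately show ?thesis
    unfolding potential_mu_outside[OF R less_imp_le[OF False[unfolded not_le]]]
    using le by (subst ennreal_plus[symmetric]) (auto simp: ln_div field_simps intro!: ennreal_leI)
qed

end

section \<open>Polar sets and measures of finite energy\<close>

lemma emeasure_compl_measure_support: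
  fixes M :: "'a :: second_countable_topology measure"
  assumes "sets M = sets borel"
  shows "emeasure M (- measure_support M) = 0"
proof -
  define \<F> where "\<F> = {V. open V \<and> emeasure M V = 0}"
  obtain \<F>' where F: "\<F>' \<subseteq> \<F>" "countable \<F>'" "\<Union>\<F>' = \<Union>\<F>"
    using Lindelof[of \<F>] by (auto simp: \<F>_def)
  have "- measure_support M = \<Union>\<F>"
    by (auto simp: measure_support_def \<F>_def not_less)
  moreover have "(\<Union>V\<in>\<F>'. V) \<in> null_sets M"
    using F assms by (intro null_sets_UN') (auto simp: \<F>_def null_sets_def)
  ultimately show ?thesis using F(3) by auto
qed

lemma closed_measure_support: "closed (measure_support M)"
proof -
  have "- measure_support M = \<Union>{V. open V \<and> emeasure M V = 0}"
    by (auto simp: measure_support_def not_less)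
  then have "open (- measure_support M)" by auto
  then show ?thesis by (simp add: closed_def)
qed

lemma compact_probs_iff:
  "M \<in> compact_probs E \<longleftrightarrow> prob_space M \<and> sets M = sets borel \<and>
     bounded (measure_support M) \<and> measure_support M \<subseteq> E"
  by (auto simp: compact_probs_def compact_eq_bounded_closed closed_measure_support)

lemma AE_measure_support:
  fixes M :: "'a :: second_countable_topology measure"
  assumes "sets M = sets borel"
  shows "AE x in M. x \<in> measure_support M"
  using emeasure_compl_measure_support[OF assms] closed_measure_support[of M] assms
  by (intro AE_I'[of "- measure_support M"]) (auto simp: null_sets_def)

text \<open>A measure of finite energy does not charge polar sets: otherwise, by inner regularity, its
  normalised restriction to some compact subset would be a probability measure of finite energy
  supported in the polar set.\<close>

lemma emeasure_polar_eq_0: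
  assumes "finite_measure M" and s[measurable_cong]: "sets M = sets borel"
    and M: "AE y in M. norm y \<le> \<rho>" and R: "R \<ge> 1" "2 * \<rho> \<le> R"
    and fin: "mutual_energy R M M < \<infinity>"
    and B: "polar B" "B \<in> sets borel"
  shows "emeasure M B = 0"
proof (rule ccontr)
  assume "emeasure M B \<noteq> 0"
  interpret finite_measure M by fact
  have "emeasure M B = (SUP K\<in>{K. K \<subseteq> B \<and> compact K}. emeasure M K)"
    by (rule inner_regular[OF s]) (use B in auto)
  with \<open>emeasure M B \<noteq> 0\<close> obtain K where K: "K \<subseteq> B" "compact K" "emeasure M K \<noteq> 0"
    by (auto simp: SUP_eq_iff) (metis (no_types, lifting) SUP_bot_conv(2) bot_ennreal mem_Collect_eq)
  have [measurable]: "K \<in> sets borel" using K by (simp add: borel_compact)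
  define m where "m = measure M K"
  have m: "m > 0" using K(3) by (simp add: m_def emeasure_eq_measure less_le)
  define d where "d x = ennreal (1 / m) * indicator K x" for x :: complex
  have [measurable]: "d \<in> borel_measurable borel" unfolding d_def by measurable
  define \<sigma> where "\<sigma> = density M d"
  have s\<sigma>[measurable_cong]: "sets \<sigma> = sets borel" by (simp add: \<sigma>_def s)
  have nn: "(\<integral>\<^sup>+x. f x \<partial>\<sigma>) = (\<integral>\<^sup>+x. d x * f x \<partial>M)" if "f \<in> borel_measurable borel" for f
    unfolding \<sigma>_def by (rule nn_integral_density) (use that in measurable)
  have prob: "prob_space \<sigma>"
  proof (rule prob_spaceI)
    have "emeasure \<sigma> (space \<sigma>) = (\<integral>\<^sup>+x. d x \<partial>M)"
      using nn[of "\<lambda>_. 1"] by simp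
    also have "\<dots> = ennreal (1 / m) * emeasure M K"
      unfolding d_def by (subst nn_integral_cmult_indicator) auto
    also have "\<dots> = 1" using m by (simp add: emeasure_eq_measure m_def[symmetric] flip: ennreal_mult)
    finally show "emeasure \<sigma> (space \<sigma>) = 1" .
  qed
  have sup: "measure_support \<sigma> \<subseteq> K"
  proof
    fix x assume x: "x \<in> measure_support \<sigma>"
    show "x \<in> K"
    proof (rule ccontr)
      assume "x \<notin> K"
      moreover have "open (- K)" using K(2) by (simp add: compact_imp_closed open_Compl)
      ultimately have "emeasure \<sigma> (- K) > 0" using x by (auto simp: measure_support_def)
      moreover have "emeasure \<sigma> (- K) = (\<integral>\<^sup>+x. d x * indicator (- K) x \<partial>M)"
        unfolding \<sigma>_def by (rule emeasure_density) auto
      moreover have "\<dots> = (\<integral>\<^sup>+x. 0 \<partial>M)"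
        by (intro nn_integral_cong) (auto simp: d_def indicator_def)
      ultimately show False by simp
    qed
  qed
  then have "\<sigma> \<in> compact_probs B"
    using prob s\<sigma> K bounded_subset[OF compact_imp_bounded[OF K(2)]] by (auto simp: compact_probs_iff)
  with B have "log_energy \<sigma> = \<infinity>" by (auto simp: polar_def)
  moreover have "AE y in \<sigma>. norm y \<le> \<rho>"
    unfolding \<sigma>_def by (subst AE_density) (use M in auto)
  note log_energy_eq[OF prob_space.finite_measure[OF prob] s\<sigma> this R]
  ultimately have "mutual_energy R \<sigma> \<sigma> = \<infinity>"
    by (cases "mutual_energy R \<sigma> \<sigma>") auto
  moreover have "mutual_energy R \<sigma> \<sigma> \<le> ennreal (1 / m) * (ennreal (1 / m) * mutual_energy R M M)"
  proof -
    have "mutual_energy R \<sigma> \<sigma> = (\<integral>\<^sup>+x. d x * (\<integral>\<^sup>+y. d y * log_kernel R (x - y) \<partial>M) \<partial>M)"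
      unfolding mutual_energy_def by (simp add: nn)
    also have "\<dots> \<le> (\<integral>\<^sup>+x. ennreal (1 / m) * (\<integral>\<^sup>+y. ennreal (1 / m) * log_kernel R (x - y) \<partial>M) \<partial>M)"
      by (intro nn_integral_mono mult_mono) (auto simp: d_def indicator_def)
    also have "\<dots> = ennreal (1 / m) * (ennreal (1 / m) * mutual_energy R M M)"
      unfolding mutual_energy_def by (simp add: nn_integral_cmult)
    finally show ?thesis .
  qed
  ultimately show False using fin by (auto simp: ennreal_mult_eq_top_iff top_unique)
qed

lemma polar_singleton: "polar {a :: complex}"
  unfolding polar_def
proof
  fix \<sigma> assume "\<sigma> \<in> compact_probs {a}"
  then have p: "prob_space \<sigma>" and s[measurable_cong]: "sets \<sigma> = sets borel" and sup: "measure_support \<sigma> \<subseteq> {a}"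
    by (auto simp: compact_probs_def)
  interpret prob_space \<sigma> by fact
  have a: "AE y in \<sigma>. y = a"
    using AE_measure_support[OF s] by eventually_elim (use sup in auto)
  have e: "emeasure \<sigma> (space \<sigma>) = 1" by (rule emeasure_space_1)
  have "(\<integral>\<^sup>+y. log_kernel R (a - y) \<partial>\<sigma>) = (\<integral>\<^sup>+y. \<infinity> \<partial>\<sigma>)" for R
    by (rule nn_integral_cong_AE) (use a in \<open>eventually_elim, simp add: log_kernel_def\<close>)
  then have inner: "(\<integral>\<^sup>+y. log_kernel R (a - y) \<partial>\<sigma>) = \<infinity>" for R using e by (simp add: ennreal_top_mult)
  have "mutual_energy R \<sigma> \<sigma> = (\<integral>\<^sup>+y. \<infinity> \<partial>\<sigma>)" for R
    unfolding mutual_energy_def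
    by (rule nn_integral_cong_AE) (use a in \<open>eventually_elim, simp add: inner\<close>)
  then have "mutual_energy R \<sigma> \<sigma> = \<infinity>" for R using e by (simp add: ennreal_top_mult)
  then show "log_energy \<sigma> = \<infinity>"
    using a by (subst log_energy_eq[where \<rho>="norm a" and R="1 + 2 * norm a"])
      (auto simp: finite_measure_axioms s top_ennreal.rep_eq)
qed

section \<open>Balayage and minimal energy\<close>

text \<open>The sum of two measures on the same \<open>\<sigma>\<close>-algebra.\<close>

definition measure_add :: "'a measure \<Rightarrow> 'a measure \<Rightarrow> 'a measure" where
  "measure_add M N = measure_of (space M) (sets M) (\<lambda>A. emeasure M A + emeasure N A)"

lemma sets_measure_add[simp, measurable_cong]: "sets (measure_add M N) = sets M"
  by (simp add: measure_add_def)

lemma space_measure_add[simp]: "space (measure_add M N) = space M"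
  by (simp add: measure_add_def)

lemma emeasure_measure_add:
  assumes "sets N = sets M" "A \<in> sets M"
  shows "emeasure (measure_add M N) A = emeasure M A + emeasure N A"
proof (rule emeasure_measure_of[OF measure_add_def])
  show "countably_additive (sets (measure_add M N)) (\<lambda>A. emeasure M A + emeasure N A)"
    unfolding countably_additive_def using assms(1)
    by (auto simp: suminf_add[symmetric] suminf_emeasure)
qed (use assms sets.space_closed in \<open>auto simp: positive_def\<close>)

lemma nn_integral_measure_add:
  assumes s: "sets N = sets M" and f: "f \<in> borel_measurable M"
  shows "(\<integral>\<^sup>+x. f x \<partial>measure_add M N) = (\<integral>\<^sup>+x. f x \<partial>M) + (\<integral>\<^sup>+x. f x \<partial>N)"
  using f
proof induction
  case (cong f h)
  have "space N = space M" using s by (rule sets_eq_imp_space_eq)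
  with cong show ?case by (metis (no_types, lifting) nn_integral_cong space_measure_add)
next
  case (set A)
  then show ?case using s by (simp add: emeasure_measure_add)
next
  case (mult u c)
  note [measurable_cong] = s and [measurable] = mult(2)
  from mult show ?case by (simp add: nn_integral_cmult distrib_left)
next
  case (add u v)
  note [measurable_cong] = s and [measurable] = add(1) add(3)
  from add show ?case by (simp add: nn_integral_add ac_simps)
next
  case (seq U)
  note [measurable_cong] = s and [measurable] = seq(1)
  have "(\<integral>\<^sup>+x. (SUP i. U i x) \<partial>L) = (SUP i. \<integral>\<^sup>+x. U i x \<partial>L)" if [measurable_cong]: "sets L = sets M" for L
    by (rule nn_integral_monotone_convergence_SUP[OF seq(3)]) measurable
  note e = this
  have "(\<integral>\<^sup>+x. (SUP i. U i x) \<partial>measure_add M N) = (SUP i. (\<integral>\<^sup>+x. U i x \<partial>M) + (\<integral>\<^sup>+x. U i x \<partial>N))"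
    by (subst e) (simp_all add: seq)
  also have "\<dots> = (SUP i. \<integral>\<^sup>+x. U i x \<partial>M) + (SUP i. \<integral>\<^sup>+x. U i x \<partial>N)"
    by (intro ennreal_SUP_add incseq_nn_integral seq)
  also have "\<dots> = (\<integral>\<^sup>+x. (SUP i. U i x) \<partial>M) + (\<integral>\<^sup>+x. (SUP i. U i x) \<partial>N)"
    by (subst (1 2) e) (simp_all add: s)
  finally show ?case by (simp add: image_comp)
qed

lemma AE_measure_add:
  assumes s: "sets N = sets M" and "AE x in M. P x" "AE x in N. P x"
  shows "AE x in measure_add M N. P x"
proof -
  obtain A where A: "{x \<in> space M. \<not> P x} \<subseteq> A" "A \<in> sets M" "emeasure M A = 0" using assms(2) by (rule AE_E)
  obtain B where B: "{x \<in> space N. \<not> P x} \<subseteq> B" "B \<in> sets N" "emeasure N B = 0" using assms(3) by (rule AE_E)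
  have sp: "space N = space M" using s by (rule sets_eq_imp_space_eq)
  have "emeasure M (A \<inter> B) = 0" "emeasure N (A \<inter> B) = 0"
    using A B s emeasure_mono[of "A \<inter> B" A M] emeasure_mono[of "A \<inter> B" B N] by auto
  then have "emeasure (measure_add M N) (A \<inter> B) = 0"
    using A B s by (subst emeasure_measure_add) auto
  then show ?thesis using A B s sp by (intro AE_I[of _ _ "A \<inter> B"]) auto
qed

context radial_field begin

lemma g_measurable[measurable]: "(\<lambda>z. g (norm z)) \<in> borel_measurable (borel :: 'a :: real_normed_vector measure)"
proof -
  have "mono (\<lambda>x. g (max 0 x))"
    by (auto simp: mono_def intro!: mono_onD[OF g_mono])
  then have "(\<lambda>x. g (max 0 x)) \<in> borel_measurable borel" by (rule borel_measurable_mono)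
  then have "(\<lambda>z::'a. g (max 0 (norm z))) \<in> borel_measurable borel"
    by (rule measurable_compose[rotated]) measurable
  then show ?thesis by simp
qed

lemma nn_integral_g_halves:
  fixes M :: "complex measure"
  assumes [measurable_cong]: "sets M = sets borel"
  shows "(\<integral>\<^sup>+z. ennreal (g (norm z)) \<partial>M)
    = (\<integral>\<^sup>+z. ennreal (g (norm z) / 2) \<partial>M) + (\<integral>\<^sup>+z. ennreal (g (norm z) / 2) \<partial>M)"
  by (subst nn_integral_add[symmetric])
    (auto intro!: nn_integral_cong simp: g_nonneg simp flip: ennreal_plus)

lemma weighted_energy_eq:
  assumes "prob_space M" and s[measurable_cong]: "sets M = sets borel"
    and M: "AE y in M. norm y \<le> \<rho>" and R: "R \<ge> 1" "2 * \<rho> \<le> R"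
  shows "weighted_energy g M =
    enn2ereal (mutual_energy R M M + (\<integral>\<^sup>+z. ennreal (g (norm z)) \<partial>M)) - ereal (ln R)"
proof -
  interpret prob_space M by fact
  have sp: "space M = UNIV" using sets_eq_imp_space_eq[OF s] by simp
  have "eintegral M (\<lambda>z. ereal (g (norm z))) = enn2ereal (\<integral>\<^sup>+z. ennreal (g (norm z)) \<partial>M)"
  proof -
    have "(\<integral>\<^sup>+z. ennreal (- g (norm z)) \<partial>M) = 0" by (simp add: ennreal_neg g_nonneg)
    then show ?thesis by (simp add: eintegral_def zero_ennreal.rep_eq)
  qed
  moreover have "log_energy M = enn2ereal (mutual_energy R M M) - ereal (ln R)"
    using log_energy_eq[OF finite_measure_axioms s M R] prob_space by (simp add: sp)
  ultimately show ?thesis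
    unfolding weighted_energy_def
    by (cases "mutual_energy R M M"; cases "\<integral>\<^sup>+z. ennreal (g (norm z)) \<partial>M")
      (auto simp: top_ennreal.rep_eq simp flip: ennreal_plus)
qed

text \<open>The constant value on the disc of \<open>g / 2\<close> plus the potential of \<open>\<mu>\<close> for the kernel
  \<open>log (R / |z|)\<close>.\<close>

definition level :: "real \<Rightarrow> real" where "level R = ln R - ln T + g T / 2"

lemma potential_mu_add_g:
  assumes R: "norm z + T \<le> R" and z: "z \<noteq> 0" "norm z \<le> T"
  shows "(\<integral>\<^sup>+w. log_kernel R (z - w) \<partial>\<mu>) + ennreal (g (norm z) / 2) = ennreal (level R)"
proof -
  have "g (norm z) \<le> g T" "ln T \<le> ln R" "0 \<le> g (norm z)"
    using mono_onD[OF g_mono, of "norm z" T] z T_pos R g_nonneg[of "norm z"]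
    by (auto intro!: ln_mono simp del: ln_le_cancel_iff) (smt (verit) norm_ge_zero)
  then have "ennreal (ln R - ln T + (g T - g (norm z)) / 2) + ennreal (g (norm z) / 2)
      = ennreal (ln R - ln T + (g T - g (norm z)) / 2 + g (norm z) / 2)"
    by (intro ennreal_plus[symmetric]) auto
  also have "ln R - ln T + (g T - g (norm z)) / 2 + g (norm z) / 2 = level R"
    by (simp add: level_def field_simps)
  finally show ?thesis unfolding potential_mu_inside[OF R z] .
qed

lemma mutual_energy_mu_finite:
  assumes R: "2 * T \<le> R"
  shows "mutual_energy R \<mu> \<mu> < \<infinity>"
proof -
  interpret prob_space \<mu> by (rule prob_space_mu)
  have "mutual_energy R \<mu> \<mu> \<le> (\<integral>\<^sup>+z. ennreal (level R) \<partial>\<mu>)"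
    unfolding mutual_energy_def
  proof (rule nn_integral_mono_AE)
    show "AE z in \<mu>. (\<integral>\<^sup>+w. log_kernel R (z - w) \<partial>\<mu>) \<le> ennreal (level R)"
      using AE_mu
    proof eventually_elim
      case (elim z)
      have "(\<integral>\<^sup>+w. log_kernel R (z - w) \<partial>\<mu>) + ennreal (g (norm z) / 2) = ennreal (level R)"
        using elim R by (intro potential_mu_add_g) auto
      then show ?case by (metis add_increasing2 order_refl zero_le)
    qed
  qed
  also have "\<dots> < \<infinity>" using emeasure_space_1 by (simp add: ennreal_mult_less_top)
  finally show ?thesis .
qed

end

text \<open>An open set \<open>V\<close> in the equilibrium disc together with the balayage \<open>\<nu>\<close> of \<open>\<mu>\<close> restricted to
  \<open>V\<close>.\<close>

locale swept_field = radial_field +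
  fixes V :: "complex set" and \<nu> :: "complex measure"
  assumes open_V: "open V" and V_sub: "V \<subseteq> ball 0 T"
    and balayage: "is_balayage V (restrict_measure \<mu> V) \<nu>"
begin

lemma V_measurable[measurable]: "V \<in> sets borel" using open_V by simp

lemma sets_restrict[simp, measurable_cong]: "sets (restrict_measure \<mu> A) = sets borel"
  by (simp add: restrict_measure_def)

lemma space_restrict[simp]: "space (restrict_measure \<mu> A) = UNIV"
  by (simp add: restrict_measure_def)

lemma nn_integral_restrict:
  assumes [measurable]: "f \<in> borel_measurable borel" "A \<in> sets borel"
  shows "(\<integral>\<^sup>+x. f x \<partial>restrict_measure \<mu> A) = (\<integral>\<^sup>+x. f x * indicator A x \<partial>\<mu>)"
  unfolding restrict_measure_def by (subst nn_integral_density) (auto simp: mult.commute)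

lemma AE_restrict:
  assumes [measurable]: "A \<in> sets borel" and "AE x in \<mu>. x \<in> A \<longrightarrow> P x"
  shows "AE x in restrict_measure \<mu> A. P x"
  unfolding restrict_measure_def by (subst AE_density) (use assms(2) in \<open>auto simp: indicator_def\<close>)

lemma emeasure_restrict:
  assumes [measurable]: "A \<in> sets borel" "B \<in> sets borel"
  shows "emeasure (restrict_measure \<mu> A) B = emeasure \<mu> (A \<inter> B)"
  unfolding restrict_measure_def
  by (subst emeasure_density) (auto simp: nn_integral_indicator[symmetric] indicator_inter_arith simp del: nn_integral_indicator)

lemma finite_restrict: "A \<in> sets borel \<Longrightarrow> finite_measure (restrict_measure \<mu> A)"
  using finite_measure.emeasure_finite[OF prob_space.finite_measure[OF prob_space_mu]]
  by (intro finite_measureI) (simp add: emeasure_restrict)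

lemma sets_nu[simp, measurable_cong]: "sets \<nu> = sets borel"
  using balayage by (simp add: is_balayage_def)

lemma space_nu[simp]: "space \<nu> = UNIV"
  using sets_eq_imp_space_eq[OF sets_nu] by simp

lemma AE_nu: "AE z in \<nu>. z \<in> frontier V"
  using balayage by (intro AE_I'[of "- frontier V"]) (auto simp: is_balayage_def null_sets_def)

lemma emeasure_nu: "emeasure \<nu> UNIV = emeasure \<mu> V"
proof -
  have "emeasure \<nu> UNIV = emeasure \<nu> (frontier V)"
    by (rule emeasure_eq_AE) (use AE_nu in \<open>auto elim: eventually_mono\<close>)
  also have "\<dots> = emeasure \<mu> V" using balayage by (simp add: is_balayage_def emeasure_restrict)
  finally show ?thesis .
qed

lemma finite_nu: "finite_measure \<nu>"
  using finite_measure.emeasure_finite[OF prob_space.finite_measure[OF prob_space_mu]]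
  by (intro finite_measureI) (simp add: emeasure_nu)

lemma nu_polar: "B \<in> sets borel \<Longrightarrow> polar B \<Longrightarrow> emeasure \<nu> B = 0"
  using balayage by (simp add: is_balayage_def)

lemma frontier_V: "frontier V \<subseteq> cball 0 T - V"
proof -
  have "closure V \<subseteq> cball 0 T"
    using V_sub closure_minimal[of V "cball 0 T"] ball_subset_cball by blast
  then show ?thesis using open_V by (auto simp: frontier_def interior_open)
qed

lemma AE_nu_disc: "AE z in \<nu>. z \<noteq> 0 \<and> norm z \<le> T \<and> z \<notin> V"
proof -
  have "AE z in \<nu>. z \<noteq> 0"
    using nu_polar[OF _ polar_singleton[of 0]] by (intro AE_I'[of "{0}"]) (auto simp: null_sets_def)
  with AE_nu show ?thesis by eventually_elim (use frontier_V in auto)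
qed

text \<open>The measure \<open>\<mu>\<close> after its part in \<open>V\<close> has been swept to the boundary of \<open>V\<close>.\<close>

definition \<sigma> :: "complex measure" where "\<sigma> = measure_add (restrict_measure \<mu> (- V)) \<nu>"

lemma sets_sigma[simp, measurable_cong]: "sets \<sigma> = sets borel"
  by (simp add: \<sigma>_def)

lemma nn_integral_sigma:
  assumes [measurable]: "f \<in> borel_measurable borel"
  shows "(\<integral>\<^sup>+x. f x \<partial>\<sigma>) = (\<integral>\<^sup>+x. f x * indicator (- V) x \<partial>\<mu>) + (\<integral>\<^sup>+x. f x \<partial>\<nu>)"
  unfolding \<sigma>_def by (subst nn_integral_measure_add) (auto simp: nn_integral_restrict)

lemma emeasure_sigma:
  assumes [measurable]: "A \<in> sets borel"
  shows "emeasure \<sigma> A = emeasure \<mu> (- V \<inter> A) + emeasure \<nu> A"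
  unfolding \<sigma>_def by (subst emeasure_measure_add) (auto simp: emeasure_restrict)

lemma prob_space_sigma: "prob_space \<sigma>"
proof (rule prob_spaceI)
  have "emeasure \<sigma> (space \<sigma>) = emeasure \<mu> (- V) + emeasure \<mu> V"
    using emeasure_sigma[of UNIV] by (simp add: \<sigma>_def emeasure_nu)
  also have "\<dots> = emeasure \<mu> (- V \<union> V)" by (rule plus_emeasure) auto
  also have "- V \<union> V = space \<mu>" by auto
  finally show "emeasure \<sigma> (space \<sigma>) = 1" using prob_space.emeasure_space_1[OF prob_space_mu] by simp
qed

lemma AE_sigma: "AE z in \<sigma>. z \<noteq> 0 \<and> norm z \<le> T \<and> z \<notin> V"
  unfolding \<sigma>_def
proof (rule AE_measure_add)
  show "AE z in restrict_measure \<mu> (- V). z \<noteq> 0 \<and> norm z \<le> T \<and> z \<notin> V"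
    by (rule AE_restrict) (use AE_mu in \<open>auto elim: eventually_mono\<close>)
qed (use AE_nu_disc in auto)

text \<open>Sweeping does not change the potential quasi-everywhere off \<open>V\<close>. The exceptional set \<open>B\<close> is
  independent of \<open>R\<close>.\<close>

lemma potential_sigma:
  obtains B where "B \<in> sets borel" "polar B"
    "\<And>R z. norm z + T \<le> R \<Longrightarrow> 1 \<le> R \<Longrightarrow> z \<notin> V \<Longrightarrow> z \<notin> B \<Longrightarrow>
      (\<integral>\<^sup>+w. log_kernel R (z - w) \<partial>\<sigma>) = (\<integral>\<^sup>+w. log_kernel R (z - w) \<partial>\<mu>)"
proof -
  obtain B where B: "B \<in> sets borel" "polar B"
    and eq: "\<And>z. z \<notin> V \<Longrightarrow> z \<notin> B \<Longrightarrow> log_potential \<nu> z = log_potential (restrict_measure \<mu> V) z"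
    using balayage by (auto simp: is_balayage_def quasi_everywhere_def)
  show ?thesis
  proof (rule that[OF B])
    fix R :: real and z :: complex
    assume R: "norm z + T \<le> R" "1 \<le> R" and z: "z \<notin> V" "z \<notin> B"
    have bd: "norm (z - w) \<le> R" if "norm w \<le> T" for w
      using norm_triangle_ineq4[of z w] R that by linarith
    have m: "measure \<nu> UNIV = measure (restrict_measure \<mu> V) UNIV"
      by (simp add: measure_def emeasure_nu emeasure_restrict)
    have 1: "log_potential \<nu> z = enn2ereal (\<integral>\<^sup>+y. log_kernel R (z - y) \<partial>\<nu>) - ereal (ln R * measure \<nu> UNIV)"
      by (rule log_potential_eq[OF finite_nu sets_nu _ R(2)])
        (use AE_nu_disc in \<open>eventually_elim, auto intro: bd\<close>)
    have 2: "log_potential (restrict_measure \<mu> V) z =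
        enn2ereal (\<integral>\<^sup>+y. log_kernel R (z - y) \<partial>restrict_measure \<mu> V) - ereal (ln R * measure \<nu> UNIV)"
      unfolding m
    proof (rule log_potential_eq[OF finite_restrict sets_restrict _ R(2)])
      have "AE y in \<mu>. y \<in> V \<longrightarrow> norm (z - y) \<le> R"
        using AE_mu by eventually_elim (auto intro!: bd)
      then show "AE y in restrict_measure \<mu> V. norm (z - y) \<le> R"
        by (intro AE_restrict) auto
    qed simp
    have "(\<integral>\<^sup>+y. log_kernel R (z - y) \<partial>\<nu>) = (\<integral>\<^sup>+y. log_kernel R (z - y) \<partial>restrict_measure \<mu> V)"
      using eq[OF z] unfolding 1 2
      by (cases "\<integral>\<^sup>+y. log_kernel R (z - y) \<partial>\<nu>"; cases "\<integral>\<^sup>+y. log_kernel R (z - y) \<partial>restrict_measure \<mu> V")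
        (auto simp: top_ennreal.rep_eq)
    then have "(\<integral>\<^sup>+w. log_kernel R (z - w) \<partial>\<sigma>) =
        (\<integral>\<^sup>+w. log_kernel R (z - w) * indicator (- V) w \<partial>\<mu>) + (\<integral>\<^sup>+w. log_kernel R (z - w) * indicator V w \<partial>\<mu>)"
      by (simp add: nn_integral_sigma nn_integral_restrict)
    also have "\<dots> = (\<integral>\<^sup>+w. log_kernel R (z - w) * indicator (- V) w + log_kernel R (z - w) * indicator V w \<partial>\<mu>)"
      by (rule nn_integral_add[symmetric]) auto
    also have "\<dots> = (\<integral>\<^sup>+w. log_kernel R (z - w) \<partial>\<mu>)"
      by (intro nn_integral_cong) (auto simp: indicator_def)
    finally show "(\<integral>\<^sup>+w. log_kernel R (z - w) \<partial>\<sigma>) = (\<integral>\<^sup>+w. log_kernel R (z - w) \<partial>\<mu>)" .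
  qed
qed

lemma energy_sigma:
  assumes R: "2 * T \<le> R" "1 \<le> R"
  shows "mutual_energy R \<sigma> \<sigma> + (\<integral>\<^sup>+z. ennreal (g (norm z) / 2) \<partial>\<sigma>) = ennreal (level R)"
proof -
  interpret prob_space \<sigma> by (rule prob_space_sigma)
  obtain B where B: "B \<in> sets borel" "polar B"
    and eq: "\<And>z. norm z + T \<le> R \<Longrightarrow> z \<notin> V \<Longrightarrow> z \<notin> B \<Longrightarrow>
      (\<integral>\<^sup>+w. log_kernel R (z - w) \<partial>\<sigma>) = (\<integral>\<^sup>+w. log_kernel R (z - w) \<partial>\<mu>)"
    using potential_sigma R(2) by metis
  have "emeasure \<mu> B = 0"
    by (rule emeasure_polar_eq_0[OF prob_space.finite_measure[OF prob_space_mu] sets_mu _ R(2,1) mutual_energy_mu_finite[OF R(1)] B(2,1)])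
      (use AE_mu in \<open>auto elim: eventually_mono\<close>)
  then have "emeasure \<mu> (- V \<inter> B) = 0"
    using emeasure_mono[of "- V \<inter> B" B \<mu>] B by auto
  then have "emeasure \<sigma> B = 0" using B nu_polar by (simp add: emeasure_sigma)
  then have "AE z in \<sigma>. z \<notin> B" using B by (intro AE_I'[of B]) (auto simp: null_sets_def)
  have "mutual_energy R \<sigma> \<sigma> + (\<integral>\<^sup>+z. ennreal (g (norm z) / 2) \<partial>\<sigma>) =
      (\<integral>\<^sup>+z. (\<integral>\<^sup>+w. log_kernel R (z - w) \<partial>\<sigma>) + ennreal (g (norm z) / 2) \<partial>\<sigma>)"
    unfolding mutual_energy_def by (rule nn_integral_add[symmetric]) measurable
  also have "\<dots> = (\<integral>\<^sup>+z. ennreal (level R) \<partial>\<sigma>)"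
  proof (rule nn_integral_cong_AE)
    show "AE z in \<sigma>. (\<integral>\<^sup>+w. log_kernel R (z - w) \<partial>\<sigma>) + ennreal (g (norm z) / 2) = ennreal (level R)"
      using AE_sigma \<open>AE z in \<sigma>. z \<notin> B\<close>
    proof eventually_elim
      case (elim z)
      then show ?case using R by (subst eq) (auto intro!: potential_mu_add_g)
    qed
  qed
  also have "\<dots> = ennreal (level R)" using emeasure_space_1 by simp
  finally show ?thesis .
qed

lemma weighted_energy_sigma:
  shows "weighted_energy g \<sigma> = ereal (g T / 2 - ln T) + enn2ereal (\<integral>\<^sup>+z. ennreal (g (norm z) / 2) \<partial>\<sigma>)"
    and "(\<integral>\<^sup>+z. ennreal (g (norm z) / 2) \<partial>\<sigma>) < \<infinity>"
proof -
  define R where "R = max 1 (2 * T)"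
  have R: "2 * T \<le> R" "1 \<le> R" by (auto simp: R_def)
  define I where "I = (\<integral>\<^sup>+z. ennreal (g (norm z) / 2) \<partial>\<sigma>)"
  have lev: "level R \<ge> 0" using R T_pos g_nonneg[of T] by (auto simp: level_def)
  have eq: "mutual_energy R \<sigma> \<sigma> + I = ennreal (level R)"
    unfolding I_def by (rule energy_sigma[OF R])
  have two: "(\<integral>\<^sup>+z. ennreal (g (norm z)) \<partial>\<sigma>) = I + I"
    unfolding I_def by (rule nn_integral_g_halves) simp
  show "I < \<infinity>" using eq by (metis ennreal_add_eq_top ennreal_neq_top infinity_ennreal_def less_top)
  then obtain i e where i: "I = ennreal i" "i \<ge> 0" and e: "mutual_energy R \<sigma> \<sigma> = ennreal e" "e \<ge> 0"
    using eq by (cases I; cases "mutual_energy R \<sigma> \<sigma>") auto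
  with eq lev have "e + i = level R" by (simp flip: ennreal_plus)
  moreover have "weighted_energy g \<sigma> = ereal (e + (i + i)) - ereal (ln R)"
    using weighted_energy_eq[OF prob_space_sigma sets_sigma _ R(2,1)] AE_sigma i e
    by (auto elim: eventually_mono simp: two enn2ereal_ennreal simp flip: ennreal_plus)
  ultimately show "weighted_energy g \<sigma> = ereal (g T / 2 - ln T) + enn2ereal I"
    using i by (simp add: level_def enn2ereal_ennreal)
qed

text \<open>The swept measure minimises the weighted energy among the compactly supported
  probability measures off \<open>V\<close>. With \<open>E\<close> the mutual energy, \<open>E(M, M) \<ge> 2 E(M, \<sigma>) - E(\<sigma>, \<sigma>)\<close>, and both
  terms on the right can be computed with the potential of \<open>\<mu>\<close> instead of that of \<open>\<sigma>\<close>, since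
  neither \<open>M\<close> nor \<open>\<sigma>\<close> charges polar sets.\<close>

lemma weighted_energy_ge:
  assumes "M \<in> compact_probs (- V)"
  shows "weighted_energy g \<sigma> \<le> weighted_energy g M"
proof -
  from assms have pM: "prob_space M" and sM[measurable_cong]: "sets M = sets borel"
    and bd: "bounded (measure_support M)" and sub: "measure_support M \<subseteq> - V"
    by (auto simp: compact_probs_iff)
  interpret M: prob_space M by fact
  interpret S: prob_space \<sigma> by (rule prob_space_sigma)
  from bd obtain b where b: "\<And>x. x \<in> measure_support M \<Longrightarrow> norm x \<le> b" by (auto simp: bounded_iff)
  define \<rho> where "\<rho> = max 1 (max T b)"
  define R where "R = 2 * \<rho>"
  have \<rho>: "1 \<le> \<rho>" "T \<le> \<rho>" "b \<le> \<rho>" by (auto simp: \<rho>_def)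
  then have R: "1 \<le> R" "2 * \<rho> \<le> R" "2 * T \<le> R" "0 < R" by (auto simp: R_def)
  have AE_M: "AE x in M. norm x \<le> \<rho> \<and> x \<notin> V"
    using AE_measure_support[OF sM]
    by eventually_elim (use sub b \<rho> in \<open>force\<close>)
  then have AE_\<rho>: "AE x in M. norm x \<le> \<rho>" by (auto elim: eventually_mono)
  have AE_\<sigma>: "AE x in \<sigma>. norm x \<le> \<rho>" using AE_sigma by eventually_elim (use \<rho> in auto)
  have lev: "level R \<ge> 0" using R T_pos g_nonneg[of T] by (auto simp: level_def)
  note wM = weighted_energy_eq[OF pM sM AE_\<rho> R(1,2)]
    and wS = weighted_energy_eq[OF prob_space_sigma sets_sigma AE_\<sigma> R(1,2)]
  show ?thesis
  proof (cases "mutual_energy R M M < \<infinity>")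
    case False
    then show ?thesis unfolding wM by (simp add: top_unique not_less top_ennreal.rep_eq)
  next
    case True
    obtain B where B: "B \<in> sets borel" "polar B"
      and eq: "\<And>z. norm z + T \<le> R \<Longrightarrow> z \<notin> V \<Longrightarrow> z \<notin> B \<Longrightarrow>
        (\<integral>\<^sup>+w. log_kernel R (z - w) \<partial>\<sigma>) = (\<integral>\<^sup>+w. log_kernel R (z - w) \<partial>\<mu>)"
      using potential_sigma R(1) by metis
    have null: "AE z in M. z \<notin> C" if "C \<in> sets borel" "polar C" for C
      using emeasure_polar_eq_0[OF M.finite_measure_axioms sM AE_\<rho> R(1,2) True that(2,1)] that
      by (intro AE_I'[of C]) (auto simp: null_sets_def sM)
    have "AE z in M. z \<notin> {0}" by (rule null) (auto intro: polar_singleton)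
    define I where "I = (\<integral>\<^sup>+z. ennreal (g (norm z) / 2) \<partial>\<sigma>)"
    define K where "K = (\<integral>\<^sup>+z. ennreal (g (norm z) / 2) \<partial>M)"
    have two: "(\<integral>\<^sup>+z. ennreal (g (norm z)) \<partial>\<sigma>) = I + I" "(\<integral>\<^sup>+z. ennreal (g (norm z)) \<partial>M) = K + K"
      unfolding I_def K_def by (auto intro!: nn_integral_g_halves simp: sM)
    have 1: "mutual_energy R \<sigma> \<sigma> + I = ennreal (level R)"
      unfolding I_def by (rule energy_sigma[OF R(3,1)])
    have "ennreal (level R) = (\<integral>\<^sup>+z. ennreal (level R) \<partial>M)" using M.emeasure_space_1 by simp
    also have "\<dots> \<le> (\<integral>\<^sup>+z. (\<integral>\<^sup>+w. log_kernel R (z - w) \<partial>\<sigma>) + ennreal (g (norm z) / 2) \<partial>M)"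
    proof (rule nn_integral_mono_AE)
      show "AE z in M. ennreal (level R) \<le> (\<integral>\<^sup>+w. log_kernel R (z - w) \<partial>\<sigma>) + ennreal (g (norm z) / 2)"
        using AE_M \<open>AE z in M. z \<notin> {0}\<close> null[OF B]
      proof eventually_elim
        case (elim z)
        then show ?case using R \<rho> unfolding level_def
          by (subst eq) (auto intro!: potential_mu_ge)
      qed
    qed
    also have "\<dots> = mutual_energy R M \<sigma> + K"
      unfolding mutual_energy_def K_def by (rule nn_integral_add)
        measurable
    finally have 2: "ennreal (level R) \<le> mutual_energy R M \<sigma> + K" .
    have 3: "2 * mutual_energy R M \<sigma> \<le> mutual_energy R M M + mutual_energy R \<sigma> \<sigma>"
      by (rule mutual_energy_le[OF pM prob_space_sigma sM sets_sigma AE_\<rho> AE_\<sigma> R(4,2)])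
    have "2 * ennreal (level R) \<le> 2 * mutual_energy R M \<sigma> + 2 * K"
      using mult_left_mono[OF 2, of 2] by (simp add: distrib_left)
    also have "\<dots> \<le> mutual_energy R M M + mutual_energy R \<sigma> \<sigma> + (K + K)"
      using 3 by (auto simp: mult_2 intro: add_mono)
    finally have "mutual_energy R \<sigma> \<sigma> + (mutual_energy R \<sigma> \<sigma> + (I + I)) \<le> mutual_energy R \<sigma> \<sigma> + (mutual_energy R M M + (K + K))"
      unfolding 1[symmetric] by (simp add: mult_2 mult_2_right ac_simps)
    moreover have "mutual_energy R \<sigma> \<sigma> \<noteq> \<infinity>" using 1
      by (metis ennreal_add_eq_top ennreal_neq_top infinity_ennreal_def)
    ultimately have "mutual_energy R \<sigma> \<sigma> + (I + I) \<le> mutual_energy R M M + (K + K)"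
      by (simp add: ennreal_add_left_cancel_le)
    then show ?thesis unfolding wM wS two
      by (intro ereal_minus_mono) (auto simp: less_eq_ennreal.rep_eq)
  qed
qed

end

section \<open>Smoothing\<close>

text \<open>The uniform probability density on the disc of radius \<open>\<delta>\<close>.\<close>

definition disc_kernel :: "real \<Rightarrow> complex \<Rightarrow> ennreal" where
  "disc_kernel \<delta> a = ennreal (1 / (pi * \<delta>\<^sup>2)) * indicator {..<\<delta>} (norm a)"

lemma disc_kernel_measurable[measurable]: "disc_kernel \<delta> \<in> borel_measurable borel"
  unfolding disc_kernel_def by measurable

lemma disc_kernel_eq_0: "norm a \<ge> \<delta> \<Longrightarrow> disc_kernel \<delta> a = 0"
  by (simp add: disc_kernel_def)

lemma nn_integral_disc_kernel:
  assumes d: "\<delta> > 0"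
  shows "(\<integral>\<^sup>+a. disc_kernel \<delta> a \<partial>lborel) = 1"
proof -
  have "(\<integral>\<^sup>+a. disc_kernel \<delta> a \<partial>lborel) = (\<integral>\<^sup>+a. ennreal (1 / (pi * \<delta>\<^sup>2)) * indicator (ball 0 \<delta>) (a::complex) \<partial>lborel)"
    unfolding disc_kernel_def by (intro nn_integral_cong) (auto simp: indicator_def)
  also have "\<dots> = ennreal (1 / (pi * \<delta>\<^sup>2)) * ennreal (pi * \<delta>\<^sup>2)"
    using d by (subst nn_integral_cmult_indicator) (auto simp: emeasure_ball eval_unit_ball_vol)
  also have "\<dots> = 1" using d by (simp flip: ennreal_mult)
  finally show ?thesis .
qed

text \<open>The kernel is superharmonic: its averages over discs do not exceed its value at the centre.\<close>

lemma disc_average_log_kernel_le: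
  assumes d: "\<delta> > 0" and R: "norm u + \<delta> \<le> R"
  shows "(\<integral>\<^sup>+a. log_kernel R (u - a) * disc_kernel \<delta> a \<partial>lborel) \<le> log_kernel R u"
proof (cases "u = 0")
  case False
  have "(\<integral>\<^sup>+a. log_kernel R (u - a) * disc_kernel \<delta> a \<partial>lborel) =
      (\<integral>\<^sup>+a. ennreal (ln (R / max (norm u) (norm (a::complex)))) * disc_kernel \<delta> a \<partial>lborel)"
    unfolding disc_kernel_def
    by (rule nn_integral_log_kernel_radial[where h="\<lambda>r. ennreal (1 / (pi * \<delta>\<^sup>2)) * indicator {..<\<delta>} r", OF _ _ R]) auto
  also have "\<dots> \<le> (\<integral>\<^sup>+a. log_kernel R u * disc_kernel \<delta> a \<partial>lborel)"
  proof (intro nn_integral_mono mult_right_mono)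
    fix a :: complex
    have "R > 0" using R d norm_ge_zero[of u] by linarith
    then have "ln (R / max (norm u) (norm a)) \<le> ln (R / norm u)"
      using False by (intro ln_mono divide_left_mono mult_pos_pos divide_pos_pos) (auto simp: max_def)
    then show "ennreal (ln (R / max (norm u) (norm a))) \<le> log_kernel R u"
      using False by (simp add: log_kernel_def ennreal_leI)
  qed simp
  also have "\<dots> = log_kernel R u"
    using nn_integral_disc_kernel[OF d] by (simp add: nn_integral_cmult)
  finally show ?thesis .
qed (simp add: log_kernel_def)

text \<open>The convolution of \<open>\<sigma>\<close> with the uniform density on the disc of radius \<open>\<delta>\<close>, as a density and as a
  measure.\<close>

definition smooth_density :: "real \<Rightarrow> complex measure \<Rightarrow> complex \<Rightarrow> ennreal" where
  "smooth_density \<delta> \<sigma> x = (\<integral>\<^sup>+w. disc_kernel \<delta> (x - w) \<partial>\<sigma>)"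

definition smoothed :: "real \<Rightarrow> complex measure \<Rightarrow> complex measure" where
  "smoothed \<delta> \<sigma> = density lborel (smooth_density \<delta> \<sigma>)"

locale smoothing = prob_space \<sigma> for \<sigma> :: "complex measure" +
  fixes \<delta> :: real
  assumes sets_sigma[measurable_cong, simp]: "sets \<sigma> = sets borel" and d: "\<delta> > 0"
begin

lemma smooth_density_measurable[measurable]: "smooth_density \<delta> \<sigma> \<in> borel_measurable borel"
  unfolding smooth_density_def by measurable

lemma sets_smoothed[simp, measurable_cong]: "sets (smoothed \<delta> \<sigma>) = sets borel"
  by (simp add: smoothed_def)

lemma nn_integral_smoothed:
  assumes [measurable]: "f \<in> borel_measurable borel"
  shows "(\<integral>\<^sup>+x. f x \<partial>smoothed \<delta> \<sigma>) = (\<integral>\<^sup>+w. \<integral>\<^sup>+a. f (w + a) * disc_kernel \<delta> a \<partial>lborel \<partial>\<sigma>)"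
proof -
  interpret pair_sigma_finite \<sigma> "lborel :: complex measure" ..
  have "(\<integral>\<^sup>+x. f x \<partial>smoothed \<delta> \<sigma>) = (\<integral>\<^sup>+x. smooth_density \<delta> \<sigma> x * f x \<partial>lborel)"
    unfolding smoothed_def by (rule nn_integral_density) measurable
  also have "\<dots> = (\<integral>\<^sup>+x. \<integral>\<^sup>+w. f x * disc_kernel \<delta> (x - w) \<partial>\<sigma> \<partial>lborel)"
    unfolding smooth_density_def by (simp add: nn_integral_cmult mult.commute[of _ "f _"])
  also have "\<dots> = (\<integral>\<^sup>+w. \<integral>\<^sup>+x. f x * disc_kernel \<delta> (x - w) \<partial>lborel \<partial>\<sigma>)"
    by (rule Fubini') measurable
  also have "\<dots> = (\<integral>\<^sup>+w. \<integral>\<^sup>+a. f (w + a) * disc_kernel \<delta> a \<partial>lborel \<partial>\<sigma>)"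
  proof (rule nn_integral_cong)
    fix w
    show "(\<integral>\<^sup>+x. f x * disc_kernel \<delta> (x - w) \<partial>lborel) = (\<integral>\<^sup>+a. f (w + a) * disc_kernel \<delta> a \<partial>lborel)"
      using nn_integral_translate[of "\<lambda>x. f x * disc_kernel \<delta> (x - w)" w] by simp
  qed
  finally show ?thesis .
qed

lemma prob_space_smoothed: "prob_space (smoothed \<delta> \<sigma>)"
proof (rule prob_spaceI)
  have "emeasure (smoothed \<delta> \<sigma>) (space (smoothed \<delta> \<sigma>)) = (\<integral>\<^sup>+x. 1 \<partial>smoothed \<delta> \<sigma>)" by simp
  also have "\<dots> = 1" by (subst nn_integral_smoothed) (simp_all add: nn_integral_disc_kernel[OF d] emeasure_space_1)
  finally show "emeasure (smoothed \<delta> \<sigma>) (space (smoothed \<delta> \<sigma>)) = 1" .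
qed

lemma smooth_density_le: "smooth_density \<delta> \<sigma> x \<le> ennreal (1 / (pi * \<delta>\<^sup>2))"
proof -
  have "smooth_density \<delta> \<sigma> x \<le> (\<integral>\<^sup>+w. ennreal (1 / (pi * \<delta>\<^sup>2)) \<partial>\<sigma>)"
    unfolding smooth_density_def by (intro nn_integral_mono) (auto simp: disc_kernel_def indicator_def)
  then show ?thesis by (simp add: emeasure_space_1)
qed

lemma smooth_density_eq_0:
  assumes "AE w in \<sigma>. \<delta> \<le> dist x w"
  shows "smooth_density \<delta> \<sigma> x = 0"
proof -
  have "smooth_density \<delta> \<sigma> x = (\<integral>\<^sup>+w. 0 \<partial>\<sigma>)" unfolding smooth_density_def
    by (rule nn_integral_cong_AE) (use assms in \<open>eventually_elim, auto simp: dist_norm intro: disc_kernel_eq_0\<close>)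
  then show ?thesis by simp
qed

lemma mutual_energy_smoothed_le:
  assumes \<rho>: "AE w in \<sigma>. norm w \<le> \<rho>" and R: "2 * \<rho> + 2 * \<delta> \<le> R"
  shows "mutual_energy R (smoothed \<delta> \<sigma>) (smoothed \<delta> \<sigma>) \<le> mutual_energy R \<sigma> \<sigma>"
proof -
  interpret pair_sigma_finite "lborel :: complex measure" \<sigma> ..
  interpret sm: prob_space "smoothed \<delta> \<sigma>" by (rule prob_space_smoothed)
  have tri: "norm (x - y) \<le> 2 * \<rho>" if "norm x \<le> \<rho>" "norm y \<le> \<rho>" for x y :: complex
    using norm_triangle_ineq4[of x y] that by linarith
  have "mutual_energy R (smoothed \<delta> \<sigma>) (smoothed \<delta> \<sigma>) =
    (\<integral>\<^sup>+w. \<integral>\<^sup>+a. (\<integral>\<^sup>+y. log_kernel R (w + a - y) \<partial>smoothed \<delta> \<sigma>) * disc_kernel \<delta> a \<partial>lborel \<partial>\<sigma>)"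
    unfolding mutual_energy_def by (rule nn_integral_smoothed) measurable
  also have "\<dots> \<le> (\<integral>\<^sup>+w. \<integral>\<^sup>+a. (\<integral>\<^sup>+w'. log_kernel R (w + a - w') \<partial>\<sigma>) * disc_kernel \<delta> a \<partial>lborel \<partial>\<sigma>)"
  proof (rule nn_integral_mono_AE)
    show "AE w in \<sigma>. (\<integral>\<^sup>+a. (\<integral>\<^sup>+y. log_kernel R (w + a - y) \<partial>smoothed \<delta> \<sigma>) * disc_kernel \<delta> a \<partial>lborel)
      \<le> (\<integral>\<^sup>+a. (\<integral>\<^sup>+w'. log_kernel R (w + a - w') \<partial>\<sigma>) * disc_kernel \<delta> a \<partial>lborel)"
      using \<rho>
    proof eventually_elim
      case (elim w)
      show ?case
      proof (rule nn_integral_mono)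
        fix a :: complex
        show "(\<integral>\<^sup>+y. log_kernel R (w + a - y) \<partial>smoothed \<delta> \<sigma>) * disc_kernel \<delta> a
          \<le> (\<integral>\<^sup>+w'. log_kernel R (w + a - w') \<partial>\<sigma>) * disc_kernel \<delta> a"
        proof (cases "norm a < \<delta>")
          case True
          have "(\<integral>\<^sup>+y. log_kernel R (w + a - y) \<partial>smoothed \<delta> \<sigma>) =
              (\<integral>\<^sup>+w'. \<integral>\<^sup>+b. log_kernel R (w + a - (w' + b)) * disc_kernel \<delta> b \<partial>lborel \<partial>\<sigma>)"
            by (rule nn_integral_smoothed) measurable
          also have "\<dots> \<le> (\<integral>\<^sup>+w'. log_kernel R (w + a - w') \<partial>\<sigma>)"
          proof (rule nn_integral_mono_AE)
            show "AE w' in \<sigma>. (\<integral>\<^sup>+b. log_kernel R (w + a - (w' + b)) * disc_kernel \<delta> b \<partial>lborel) \<le> log_kernel R (w + a - w')"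
              using \<rho>
            proof eventually_elim
              case (elim w')
              have "norm (w + a - w') \<le> norm (w - w') + norm a"
                using norm_triangle_ineq[of "w - w'" a] by (simp add: algebra_simps)
              then have "norm (w + a - w') + \<delta> \<le> R"
                using tri[OF \<open>norm w \<le> \<rho>\<close> elim] True R by linarith
              from disc_average_log_kernel_le[OF d this] show ?case by (simp add: diff_diff_eq)
            qed
          qed
          finally show ?thesis by (intro mult_right_mono) auto
        qed (simp add: disc_kernel_eq_0)
      qed
    qed
  qed
  also have "\<dots> = (\<integral>\<^sup>+w. \<integral>\<^sup>+a. \<integral>\<^sup>+w'. log_kernel R (w + a - w') * disc_kernel \<delta> a \<partial>\<sigma> \<partial>lborel \<partial>\<sigma>)"
    by (simp add: nn_integral_multc)
  also have "\<dots> = (\<integral>\<^sup>+w. \<integral>\<^sup>+w'. \<integral>\<^sup>+a. log_kernel R (w + a - w') * disc_kernel \<delta> a \<partial>lborel \<partial>\<sigma> \<partial>\<sigma>)"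
    by (intro nn_integral_cong Fubini'[symmetric]) measurable
  also have "\<dots> \<le> mutual_energy R \<sigma> \<sigma>" unfolding mutual_energy_def
  proof (rule nn_integral_mono_AE)
    show "AE w in \<sigma>. (\<integral>\<^sup>+w'. \<integral>\<^sup>+a. log_kernel R (w + a - w') * disc_kernel \<delta> a \<partial>lborel \<partial>\<sigma>)
        \<le> (\<integral>\<^sup>+w'. log_kernel R (w - w') \<partial>\<sigma>)"
      using \<rho>
    proof eventually_elim
      case (elim w)
      show ?case
      proof (rule nn_integral_mono_AE)
        show "AE w' in \<sigma>. (\<integral>\<^sup>+a. log_kernel R (w + a - w') * disc_kernel \<delta> a \<partial>lborel) \<le> log_kernel R (w - w')"
          using \<rho>
        proof eventually_elim
          case (elim w')
          have "norm (w' - w) + \<delta> \<le> R"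
            using tri[OF elim \<open>norm w \<le> \<rho>\<close>] d R by linarith
          from disc_average_log_kernel_le[OF d this]
          have "(\<integral>\<^sup>+a. log_kernel R (w' - w - a) * disc_kernel \<delta> a \<partial>lborel) \<le> log_kernel R (w - w')"
            by (simp only: log_kernel_minus[of R w w'])
          moreover have "log_kernel R (w' - w - a) = log_kernel R (w + a - w')" for a
            using log_kernel_minus[of R w' "w + a"] by (simp add: diff_diff_eq)
          ultimately show ?case by simp
        qed
      qed
    qed
  qed
  finally show ?thesis .
qed

end

context radial_field begin

lemma nn_integral_g_smoothed_le:
  assumes "smoothing \<sigma> \<delta>"
  shows "(\<integral>\<^sup>+x. ennreal (g (norm x)) \<partial>smoothed \<delta> \<sigma>) \<le> (\<integral>\<^sup>+w. ennreal (g (norm w + \<delta>)) \<partial>\<sigma>)"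
proof -
  interpret smoothing \<sigma> \<delta> by fact
  have "(\<integral>\<^sup>+x. ennreal (g (norm x)) \<partial>smoothed \<delta> \<sigma>) =
      (\<integral>\<^sup>+w. \<integral>\<^sup>+a. ennreal (g (norm (w + a))) * disc_kernel \<delta> a \<partial>lborel \<partial>\<sigma>)"
    by (rule nn_integral_smoothed) measurable
  also have "\<dots> \<le> (\<integral>\<^sup>+w. \<integral>\<^sup>+a. ennreal (g (norm w + \<delta>)) * disc_kernel \<delta> a \<partial>lborel \<partial>\<sigma>)"
  proof (intro nn_integral_mono)
    fix w a :: complex
    show "ennreal (g (norm (w + a))) * disc_kernel \<delta> a \<le> ennreal (g (norm w + \<delta>)) * disc_kernel \<delta> a"
    proof (cases "norm a < \<delta>")
      case True
      then have "norm (w + a) \<le> norm w + \<delta>" using norm_triangle_ineq[of w a] by linarith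
      then have "g (norm (w + a)) \<le> g (norm w + \<delta>)" using d by (intro mono_onD[OF g_mono]) auto
      then show ?thesis by (intro mult_right_mono ennreal_leI) auto
    qed (simp add: disc_kernel_eq_0)
  qed
  also have "\<dots> = (\<integral>\<^sup>+w. ennreal (g (norm w + \<delta>)) \<partial>\<sigma>)"
    by (simp add: nn_integral_cmult nn_integral_disc_kernel[OF d])
  finally show ?thesis .
qed

text \<open>The point \<open>0\<close> is excluded because \<open>g\<close> need not be continuous there.\<close>

lemma g_shift_tendsto:
  fixes \<sigma> :: "complex measure"
  assumes "prob_space \<sigma>" and s[measurable_cong]: "sets \<sigma> = sets borel"
    and AE: "AE w in \<sigma>. w \<noteq> 0 \<and> norm w \<le> T"
  shows "(\<lambda>n. \<integral>\<^sup>+w. ennreal (g (norm w + inverse (real (Suc n)))) \<partial>\<sigma>) \<longlonglongrightarrow> (\<integral>\<^sup>+w. ennreal (g (norm w)) \<partial>\<sigma>)"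
proof (rule nn_integral_dominated_convergence[where w="\<lambda>_. ennreal (g (T + 1))"])
  interpret prob_space \<sigma> by fact
  have "mono (\<lambda>x. g (max 0 x))"
    by (auto simp: mono_def intro!: mono_onD[OF g_mono])
  then have m: "(\<lambda>x. g (max 0 x)) \<in> borel_measurable borel" by (rule borel_measurable_mono)
  show "(\<lambda>w. ennreal (g (norm w + inverse (real (Suc n))))) \<in> borel_measurable \<sigma>" for n
  proof -
    have "(\<lambda>w::complex. g (max 0 (norm w + inverse (real (Suc n))))) \<in> borel_measurable borel"
      by (rule measurable_compose[OF _ m, of "\<lambda>w::complex. norm w + inverse (real (Suc n))"]) measurable
    also have "(\<lambda>w::complex. g (max 0 (norm w + inverse (real (Suc n))))) = (\<lambda>w. g (norm w + inverse (real (Suc n))))"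
      by (auto simp: max_def intro!: ext add_nonneg_nonneg)
    finally have "(\<lambda>w::complex. g (norm w + inverse (real (Suc n)))) \<in> borel_measurable borel" .
    then show ?thesis
      unfolding measurable_cong_sets[OF s refl] by (rule measurable_compose[OF _ measurable_ennreal])
  qed
  show "(\<lambda>w. ennreal (g (norm w))) \<in> borel_measurable \<sigma>" by measurable
  show "AE w in \<sigma>. ennreal (g (norm w + inverse (real (Suc j)))) \<le> ennreal (g (T + 1))" for j
    using AE
  proof eventually_elim
    case (elim w)
    have "inverse (real (Suc j)) \<le> 1" by (simp add: field_simps)
    then show ?case using elim T_pos by (intro ennreal_leI mono_onD[OF g_mono]) (auto intro: add_mono)
  qed
  show "(\<integral>\<^sup>+w. ennreal (g (T + 1)) \<partial>\<sigma>) < \<infinity>" by (simp add: emeasure_space_1)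
  show "AE w in \<sigma>. (\<lambda>n. ennreal (g (norm w + inverse (real (Suc n))))) \<longlonglongrightarrow> ennreal (g (norm w))"
    using AE
  proof eventually_elim
    case (elim w)
    then have "isCont g (norm w)" using DERIV_isCont[OF DERIV_g] by simp
    moreover have "(\<lambda>n. norm w + inverse (real (Suc n))) \<longlonglongrightarrow> norm w + 0"
      by (intro tendsto_add tendsto_const LIMSEQ_inverse_real_of_nat)
    ultimately have "(\<lambda>n. g (norm w + inverse (real (Suc n)))) \<longlonglongrightarrow> g (norm w)"
      using isCont_tendsto_compose[of "norm w" g] by simp
    then show ?case by (rule tendsto_ennrealI)
  qed
qed simp

text \<open>A probability measure on the disc at positive distance from \<open>U\<close> can be replaced, at a cost of
  at most \<open>\<epsilon>\<close> in weighted energy, by one with a bounded density that vanishes on \<open>U\<close>.\<close>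

lemma exists_bounded_density:
  fixes \<sigma> :: "complex measure"
  assumes "prob_space \<sigma>" and s[measurable_cong]: "sets \<sigma> = sets borel"
    and AE: "AE w in \<sigma>. w \<noteq> 0 \<and> norm w \<le> T \<and> w \<notin> W"
    and U: "bounded U" and W: "open W" "closure U \<subseteq> W" and \<epsilon>: "\<epsilon> > 0"
  obtains d b where "d \<in> borel_measurable borel" "prob_space (density lborel d)" "0 < b"
    "\<And>x. d x \<le> ennreal b" "\<And>x. x \<in> U \<Longrightarrow> d x = 0"
    "mutual_energy (2 * T + 2) (density lborel d) (density lborel d) \<le> mutual_energy (2 * T + 2) \<sigma> \<sigma>"
    "(\<integral>\<^sup>+x. ennreal (g (norm x)) \<partial>density lborel d) \<le> (\<integral>\<^sup>+x. ennreal (g (norm x)) \<partial>\<sigma>) + ennreal \<epsilon>"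
proof -
  interpret prob_space \<sigma> by fact
  \<comment> \<open>the smoothing radius stays below the distance of \<open>U\<close> from the complement of \<open>W\<close>\<close>
  obtain \<eta> where \<eta>: "\<eta> > 0" "\<And>x y. x \<in> closure U \<Longrightarrow> y \<notin> W \<Longrightarrow> \<eta> \<le> dist x y"
  proof -
    have "compact (closure U)" "closed (- W)" "closure U \<inter> - W = {}"
      using U W by (auto simp: compact_closure)
    from separate_compact_closed[OF this] that show ?thesis by auto
  qed
  have AE2: "AE w in \<sigma>. w \<noteq> 0 \<and> norm w \<le> T" and AE3: "AE w in \<sigma>. norm w \<le> T"
    using AE by (auto elim: eventually_mono)
  have "(\<integral>\<^sup>+x. ennreal (g (norm x)) \<partial>\<sigma>) \<le> (\<integral>\<^sup>+x. ennreal (g T) \<partial>\<sigma>)"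
  proof (rule nn_integral_mono_AE)
    show "AE x in \<sigma>. ennreal (g (norm x)) \<le> ennreal (g T)"
      using AE2 by eventually_elim (use T_pos in \<open>auto intro!: ennreal_leI mono_onD[OF g_mono]\<close>)
  qed
  also have "\<dots> < \<infinity>" by (simp add: emeasure_space_1)
  finally have "(\<integral>\<^sup>+x. ennreal (g (norm x)) \<partial>\<sigma>) < (\<integral>\<^sup>+x. ennreal (g (norm x)) \<partial>\<sigma>) + ennreal \<epsilon>"
    using \<epsilon> by (simp add: ennreal_add_left_cancel_less[of _ 0, simplified])
  from order_tendstoD(2)[OF g_shift_tendsto[OF assms(1) s AE2] this]
  have "\<forall>\<^sub>F n in sequentially. (\<integral>\<^sup>+w. ennreal (g (norm w + inverse (real (Suc n)))) \<partial>\<sigma>) < (\<integral>\<^sup>+x. ennreal (g (norm x)) \<partial>\<sigma>) + ennreal \<epsilon>" .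
  moreover have "\<forall>\<^sub>F n in sequentially. inverse (real (Suc n)) < \<eta>"
    using order_tendstoD(2)[OF LIMSEQ_inverse_real_of_nat \<eta>(1)] .
  ultimately obtain n where n: "(\<integral>\<^sup>+w. ennreal (g (norm w + inverse (real (Suc n)))) \<partial>\<sigma>) < (\<integral>\<^sup>+x. ennreal (g (norm x)) \<partial>\<sigma>) + ennreal \<epsilon>"
    "inverse (real (Suc n)) < \<eta>"
    using eventually_happens'[OF sequentially_bot eventually_conj] by blast
  define \<delta> where "\<delta> = inverse (real (Suc n))"
  have \<delta>: "0 < \<delta>" "\<delta> \<le> 1" "\<delta> < \<eta>" using n(2) by (auto simp: \<delta>_def field_simps)
  interpret smoothing \<sigma> \<delta> by unfold_locales (simp_all add: s \<delta>)
  show ?thesis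
  proof (rule that[of "smooth_density \<delta> \<sigma>" "1 / (pi * \<delta>\<^sup>2)"])
    show "smooth_density \<delta> \<sigma> x = 0" if "x \<in> U" for x
    proof (rule smooth_density_eq_0)
      show "AE w in \<sigma>. \<delta> \<le> dist x w" using AE
      proof eventually_elim
        case (elim w)
        then show ?case using \<eta>(2)[of x w] that closure_subset[of U] \<delta> by force
      qed
    qed
    show "mutual_energy (2 * T + 2) (density lborel (smooth_density \<delta> \<sigma>)) (density lborel (smooth_density \<delta> \<sigma>)) \<le> mutual_energy (2 * T + 2) \<sigma> \<sigma>"
      using mutual_energy_smoothed_le[OF AE3, of "2 * T + 2"] \<delta> by (simp add: smoothed_def)
    show "(\<integral>\<^sup>+x. ennreal (g (norm x)) \<partial>density lborel (smooth_density \<delta> \<sigma>)) \<le> (\<integral>\<^sup>+x. ennreal (g (norm x)) \<partial>\<sigma>) + ennreal \<epsilon>"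
      using nn_integral_g_smoothed_le[OF smoothing_axioms] n(1) by (simp add: smoothed_def \<delta>_def)
  qed (use prob_space_smoothed smooth_density_le \<delta> in \<open>auto simp: smoothed_def\<close>)
qed

end

section \<open>A lower bound by Jensen's inequality\<close>

text \<open>The function \<open>exp (- s)\<close> on \<open>[0, \<infinity>]\<close>, with value \<open>0\<close> at \<open>\<infinity>\<close>.\<close>

definition exp_neg :: "ennreal \<Rightarrow> real" where
  "exp_neg s = (if s = \<infinity> then 0 else exp (- enn2real s))"

lemma exp_neg_nonneg: "0 \<le> exp_neg s" by (simp add: exp_neg_def)

lemma exp_neg_ennreal: "0 \<le> r \<Longrightarrow> exp_neg (ennreal r) = exp (- r)"
  by (simp add: exp_neg_def)

lemma exp_neg_add: "exp_neg (a + b) = exp_neg a * exp_neg b"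
  by (cases a; cases b) (auto simp: exp_neg_def enn2real_plus exp_add[symmetric] less_top[symmetric])

lemma exp_neg_0: "exp_neg 0 = 1" by (simp add: exp_neg_def)

lemma exp_neg_sum: "finite A \<Longrightarrow> exp_neg (\<Sum>i\<in>A. f i) = (\<Prod>i\<in>A. exp_neg (f i))"
  by (induction A rule: finite_induct) (auto simp: exp_neg_add exp_neg_0)

lemma exp_neg_measurable[measurable]: "exp_neg \<in> borel_measurable borel"
  unfolding exp_neg_def by measurable

lemma exp_neg_tangent:
  assumes "0 \<le> s"
  shows "ennreal (exp (- s) * (1 + s)) \<le> ennreal (exp_neg x) + ennreal (exp (- s)) * x"
proof (cases x)
  case (real r)
  have "1 + (s - r) \<le> exp (s - r)" by (rule exp_ge_add_one_self)
  then have "exp (- s) * (1 + (s - r)) \<le> exp (- s) * exp (s - r)" by (intro mult_left_mono) auto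
  also have "\<dots> = exp (- r)" by (simp flip: exp_add)
  finally have "exp (- s) * (1 + s) \<le> exp (- r) + exp (- s) * r" by (simp add: algebra_simps)
  then have "ennreal (exp (- s) * (1 + s)) \<le> ennreal (exp (- r) + exp (- s) * r)" by (rule ennreal_leI)
  also have "\<dots> = ennreal (exp_neg x) + ennreal (exp (- s)) * x"
    using real by (simp add: exp_neg_ennreal ennreal_mult)
  finally show ?thesis .
qed (simp add: ennreal_mult_top)

text \<open>Jensen's inequality for \<open>exp_neg\<close>, from its tangent at the mean \<open>s\<close>. Since infinite values of
  \<open>f\<close> are allowed, coinciding points need no separate treatment below.\<close>

lemma nn_integral_exp_neg_ge:
  assumes "prob_space Q" and [measurable]: "f \<in> borel_measurable Q"
    and f: "(\<integral>\<^sup>+x. f x \<partial>Q) = ennreal s" and s: "0 \<le> s"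
  shows "ennreal (exp (- s)) \<le> (\<integral>\<^sup>+x. ennreal (exp_neg (f x)) \<partial>Q)"
proof -
  interpret prob_space Q by fact
  have "ennreal (exp (- s)) + ennreal (exp (- s) * s) = ennreal (exp (- s) * (1 + s))"
    using s by (simp add: distrib_left flip: ennreal_plus)
  also have "\<dots> = (\<integral>\<^sup>+x. ennreal (exp (- s) * (1 + s)) \<partial>Q)"
    by (simp add: emeasure_space_1)
  also have "\<dots> \<le> (\<integral>\<^sup>+x. ennreal (exp_neg (f x)) + ennreal (exp (- s)) * f x \<partial>Q)"
    by (intro nn_integral_mono exp_neg_tangent s)
  also have "\<dots> = (\<integral>\<^sup>+x. ennreal (exp_neg (f x)) \<partial>Q) + ennreal (exp (- s)) * ennreal s"
    by (subst nn_integral_add) (auto simp: nn_integral_cmult f)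
  also have "ennreal (exp (- s)) * ennreal s = ennreal (exp (- s) * s)"
    using s by (simp add: ennreal_mult)
  finally have "ennreal (exp (- s) * s) + ennreal (exp (- s)) \<le> ennreal (exp (- s) * s) + (\<integral>\<^sup>+x. ennreal (exp_neg (f x)) \<partial>Q)"
    by (simp add: add.commute)
  then show ?thesis by (simp add: ennreal_add_left_cancel_le)
qed

lemma exp_neg_log_kernel_le:
  assumes "R > 0"
  shows "exp_neg (2 * log_kernel R z) * R\<^sup>2 \<le> (norm z)\<^sup>2"
proof (cases "z = 0")
  case True
  then show ?thesis by (simp add: log_kernel_def exp_neg_def ennreal_mult_top)
next
  case False
  show ?thesis
  proof (cases "norm z \<le> R")
    case True
    have l: "0 \<le> ln (R / norm z)" using True False by (intro ln_ge_zero) simp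
    have "2 * log_kernel R z = ennreal (2 * ln (R / norm z))"
      using False l by (simp add: log_kernel_def ennreal_mult)
    then have "exp_neg (2 * log_kernel R z) = exp (- (2 * ln (R / norm z)))"
      using l by (simp only: exp_neg_ennreal)
    also have "\<dots> = (exp (- ln (R / norm z)))\<^sup>2" by (simp add: power2_eq_square flip: exp_add)
    also have "exp (- ln (R / norm z)) = norm z / R"
      using False assms by (simp add: exp_minus)
    finally show ?thesis using assms by (simp add: power_divide)
  next
    case gt: False
    then have "0 < R / norm z" "R / norm z \<le> 1" using assms False by (auto simp: divide_simps)
    then have "ln (R / norm z) \<le> 0" by simp
    then have "log_kernel R z = 0" using False by (simp add: log_kernel_def ennreal_neg)
    then show ?thesis using gt assms by (simp add: exp_neg_0 power_mono)
  qed
qed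

lemma PiM_density:
  fixes M :: "'a measure" and d :: "'a \<Rightarrow> ennreal"
  assumes "sigma_finite_measure M" "sigma_finite_measure (density M d)"
    and [measurable]: "d \<in> borel_measurable M" and I: "finite I"
  shows "PiM I (\<lambda>_. density M d) = density (PiM I (\<lambda>_. M)) (\<lambda>z. \<Prod>i\<in>I. d (z i))"
proof -
  interpret P: product_sigma_finite "\<lambda>_. M" unfolding product_sigma_finite_def using assms by simp
  interpret Q: product_sigma_finite "\<lambda>_. density M d" unfolding product_sigma_finite_def using assms by simp
  have "density (PiM I (\<lambda>_. M)) (\<lambda>z. \<Prod>i\<in>I. d (z i)) = PiM I (\<lambda>_. density M d)"
  proof (rule Q.PiM_eqI[OF I])
    show "sets (density (PiM I (\<lambda>_. M)) (\<lambda>z. \<Prod>i\<in>I. d (z i))) = sets (PiM I (\<lambda>_. density M d))"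
      by (simp cong: sets_PiM_cong)
    fix A assume "\<And>i. i \<in> I \<Longrightarrow> A i \<in> sets (density M d)"
    then have A[measurable]: "i \<in> I \<Longrightarrow> A i \<in> sets M" for i by simp
    have "Pi\<^sub>E I A \<in> sets (PiM I (\<lambda>_. M))" using I A by (intro sets_PiM_I_finite) auto
    then have "emeasure (density (PiM I (\<lambda>_. M)) (\<lambda>z. \<Prod>i\<in>I. d (z i))) (Pi\<^sub>E I A) =
        (\<integral>\<^sup>+z. (\<Prod>i\<in>I. d (z i)) * indicator (Pi\<^sub>E I A) z \<partial>PiM I (\<lambda>_. M))"
      using I by (subst emeasure_density) auto
    also have "\<dots> = (\<integral>\<^sup>+z. (\<Prod>i\<in>I. d (z i) * indicator (A i) (z i)) \<partial>PiM I (\<lambda>_. M))"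
    proof (rule nn_integral_cong)
      fix z assume z: "z \<in> space (PiM I (\<lambda>_. M))"
      have "indicator (Pi\<^sub>E I A) z = (\<Prod>i\<in>I. indicator (A i) (z i) :: ennreal)"
      proof (cases "\<forall>i\<in>I. z i \<in> A i")
        case True
        then show ?thesis using z by (auto simp: indicator_def PiE_iff space_PiM)
      next
        case False
        then have "(\<Prod>i\<in>I. indicator (A i) (z i) :: ennreal) = 0" using I by (intro prod_zero) (auto simp: indicator_def)
        then show ?thesis using False by (auto simp: indicator_def PiE_iff)
      qed
      then show "(\<Prod>i\<in>I. d (z i)) * indicator (Pi\<^sub>E I A) z = (\<Prod>i\<in>I. d (z i) * indicator (A i) (z i))"
        by (simp add: prod.distrib)
    qed
    also have "\<dots> = (\<Prod>i\<in>I. \<integral>\<^sup>+x. d x * indicator (A i) x \<partial>M)"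
      by (rule P.product_nn_integral_prod[OF I]) measurable
    also have "\<dots> = (\<Prod>i\<in>I. emeasure (density M d) (A i))"
      by (intro prod.cong refl emeasure_density[symmetric]) auto
    finally show "emeasure (density (PiM I (\<lambda>_. M)) (\<lambda>z. \<Prod>i\<in>I. d (z i))) (Pi\<^sub>E I A) = (\<Prod>i\<in>I. emeasure (density M d) (A i))" .
  qed
  then show ?thesis by simp
qed

context
  fixes N :: "complex measure" and n :: nat
  assumes pN: "prob_space N" and sN: "sets N = sets borel"
begin

interpretation N: prob_space N by (rule pN)
interpretation PN: product_prob_space "\<lambda>_::nat. N" "{..<n}" ..

lemma nn_integral_PiM_component:
  assumes [measurable]: "f \<in> borel_measurable borel" and i: "i < n"
  shows "(\<integral>\<^sup>+z. f (z i) \<partial>PiM {..<n} (\<lambda>_. N)) = (\<integral>\<^sup>+x. f x \<partial>N)"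
proof -
  note [measurable_cong] = sN
  have "(\<integral>\<^sup>+x. f x \<partial>N) = (\<integral>\<^sup>+x. f x \<partial>distr (PiM {..<n} (\<lambda>_. N)) N (\<lambda>z. z i))"
    by (subst PN.PiM_component) (use i in auto)
  also have "\<dots> = (\<integral>\<^sup>+z. f (z i) \<partial>PiM {..<n} (\<lambda>_. N))"
  proof (rule nn_integral_distr)
    show "(\<lambda>z. z i) \<in> measurable (PiM {..<n} (\<lambda>_. N)) N"
      by (rule measurable_component_singleton) (use i in simp)
  qed measurable
  finally show ?thesis by simp
qed

lemma nn_integral_PiM_pair:
  assumes [measurable]: "case_prod f \<in> borel_measurable (borel \<Otimes>\<^sub>M borel)" and ij: "i < n" "j < n" "i \<noteq> j"
  shows "(\<integral>\<^sup>+z. f (z i) (z j) \<partial>PiM {..<n} (\<lambda>_. N)) = (\<integral>\<^sup>+x. \<integral>\<^sup>+y. f x y \<partial>N \<partial>N)"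
proof -
  note [measurable_cong] = sN
  have "(\<integral>\<^sup>+x. \<integral>\<^sup>+y. f x y \<partial>N \<partial>N) = (\<integral>\<^sup>+p. f (fst p) (snd p) \<partial>(N \<Otimes>\<^sub>M N))"
    by (subst N.nn_integral_fst[symmetric]) auto
  also have "\<dots> = (\<integral>\<^sup>+z. f (z i) (z j) \<partial>PiM {i, j} (\<lambda>_. N))"
    by (rule PN.product_nn_integral_pair[symmetric]) (use ij in auto)
  also have "\<dots> = (\<integral>\<^sup>+z. f (z i) (z j) \<partial>distr (PiM {..<n} (\<lambda>_. N)) (PiM {i, j} (\<lambda>_. N)) (\<lambda>z. restrict z {i, j}))"
    by (subst PN.distr_restrict[of "{i, j}" "{..<n}"]) (use ij in auto)
  also have "\<dots> = (\<integral>\<^sup>+z. f (restrict z {i, j} i) (restrict z {i, j} j) \<partial>PiM {..<n} (\<lambda>_. N))"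
    by (rule nn_integral_distr) (use ij in \<open>auto intro!: measurable_restrict_subset\<close>)
  finally show ?thesis by simp
qed

end

text \<open>The unnormalised probability that all \<open>n\<close> points avoid \<open>U\<close>.\<close>

definition hole_integral :: "(real \<Rightarrow> real) \<Rightarrow> nat \<Rightarrow> complex set \<Rightarrow> ennreal" where
  "hole_integral g n U = (\<integral>\<^sup>+z. ennreal (gibbs_weight g n z) * indicator {z. \<forall>i<n. z i \<notin> U} z \<partial>(\<Pi>\<^sub>M i\<in>{..<n}. lborel))"

lemma sum_lessThan_real: "2 * real (\<Sum>j<n. j) = real n * (real n - 1)"
  by (induction n) (auto simp: algebra_simps)

lemma (in radial_field) gibbs_weight_measurable[measurable]:
  "gibbs_weight g n \<in> borel_measurable (\<Pi>\<^sub>M i\<in>{..<n}. lborel)"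
  unfolding gibbs_weight_def by measurable

text \<open>The integral is bounded below by the product of \<open>n\<close> copies of the law with density \<open>d\<close>: since
  \<open>d \<le> b\<close> vanishes on \<open>U\<close>, the indicator of the hole event is at least \<open>(1 / b)\<^sup>n\<close> times the product
  density, and Jensen's inequality applies to the expectation of the weight. The product has
  \<open>n (n - 1) / 2\<close> factors \<open>|z\<^sub>i - z\<^sub>j|\<^sup>2\<close>, each of mean logarithm at least \<open>2 (log R - e)\<close>.\<close>

lemma (in radial_field) hole_integral_ge:
  assumes [measurable]: "d \<in> borel_measurable borel" and U[measurable]: "U \<in> sets borel"
    and prob: "prob_space (density lborel d)" and b: "0 < b"
    and d_le: "\<And>x. d x \<le> ennreal b" and d_0: "\<And>x. x \<in> U \<Longrightarrow> d x = 0" and R: "R > 0"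
    and e: "mutual_energy R (density lborel d) (density lborel d) = ennreal e" "0 \<le> e"
    and i: "(\<integral>\<^sup>+x. ennreal (g (norm x)) \<partial>density lborel d) = ennreal i" "0 \<le> i"
  shows "ennreal (exp (- real n * ln b + real n * (real n - 1) * (ln R - e) - (real n)\<^sup>2 * i)) \<le> hole_integral g n U"
proof -
  define N where "N = density lborel d"
  have sN[measurable_cong]: "sets N = sets borel" by (simp add: N_def)
  have pN: "prob_space N" using prob by (simp add: N_def)
  interpret N: prob_space N by (rule pN)
  interpret PN: product_prob_space "\<lambda>_::nat. N" "{..<n}" ..
  define P where "P = (\<Pi>\<^sub>M i\<in>{..<n}. (lborel :: complex measure))"
  define Q where "Q = PiM {..<n} (\<lambda>_. N)"
  have sP[measurable_cong]: "sets P = sets (PiM {..<n} (\<lambda>_. borel))"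
    unfolding P_def by (intro sets_PiM_cong) auto
  have sQ[measurable_cong]: "sets Q = sets (PiM {..<n} (\<lambda>_. borel))"
    unfolding Q_def by (intro sets_PiM_cong) (auto simp: sN)
  have pQ: "prob_space Q" unfolding Q_def by (rule PN.prob_space_axioms)
  have QP: "Q = density P (\<lambda>z. \<Prod>i<n. d (z i))"
    unfolding Q_def P_def N_def
    by (rule PiM_density) (use prob_space.finite_measure[OF prob] in \<open>auto simp: finite_measure_def sigma_finite_lborel\<close>)
  have wm[measurable]: "gibbs_weight g n \<in> borel_measurable P" unfolding P_def by measurable
  have wmQ[measurable]: "gibbs_weight g n \<in> borel_measurable Q"
    using wm by (simp add: measurable_def sets_eq_imp_space_eq[OF sP] sets_eq_imp_space_eq[OF sQ] sP sQ)
  \<comment> \<open>up to an additive constant, minus the logarithm of the weight when all distances are at most \<open>R\<close>\<close>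
  define S where "S z = (\<Sum>j<n. \<Sum>i<j. 2 * log_kernel R (z i - z j)) + (\<Sum>k<n. ennreal (real n) * ennreal (g (norm (z k))))"
    for z :: "nat \<Rightarrow> complex"
  have [measurable]: "S \<in> borel_measurable Q" unfolding S_def by measurable
  define s where "s = real n * (real n - 1) * e + (real n)\<^sup>2 * i"
  have nn1: "0 \<le> real n * (real n - 1)" by (cases n) auto
  have s0: "s \<ge> 0" unfolding s_def using e i nn1 by auto
  have "(\<integral>\<^sup>+z. S z \<partial>Q) = (\<Sum>j<n. \<Sum>i<j. 2 * (\<integral>\<^sup>+z. log_kernel R (z i - z j) \<partial>Q)) +
      (\<Sum>k<n. ennreal (real n) * (\<integral>\<^sup>+z. ennreal (g (norm (z k))) \<partial>Q))"
  proof -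
    have k[measurable]: "(\<lambda>z. log_kernel R (z i - z j)) \<in> borel_measurable Q" if "i < n" "j < n" for i j
    proof -
      have [measurable]: "(\<lambda>z. z l) \<in> borel_measurable Q" if "l < n" for l
        using measurable_component_singleton[of l "{..<n}" "\<lambda>_. borel"] that
        by (simp add: measurable_cong_sets[OF sQ refl])
      show ?thesis using that by measurable
    qed
    have "(\<integral>\<^sup>+z. (\<Sum>j<n. \<Sum>i<j. 2 * log_kernel R (z i - z j)) \<partial>Q)
        = (\<Sum>j<n. \<integral>\<^sup>+z. (\<Sum>i<j. 2 * log_kernel R (z i - z j)) \<partial>Q)"
      by (rule nn_integral_sum) (auto intro!: borel_measurable_sum borel_measurable_times k)
    also have "\<dots> = (\<Sum>j<n. \<Sum>i<j. \<integral>\<^sup>+z. 2 * log_kernel R (z i - z j) \<partial>Q)"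
      by (intro sum.cong refl nn_integral_sum) (auto intro!: borel_measurable_times k)
    also have "\<dots> = (\<Sum>j<n. \<Sum>i<j. 2 * (\<integral>\<^sup>+z. log_kernel R (z i - z j) \<partial>Q))"
      by (intro sum.cong refl nn_integral_cmult) (auto intro!: k)
    finally have 1: "(\<integral>\<^sup>+z. (\<Sum>j<n. \<Sum>i<j. 2 * log_kernel R (z i - z j)) \<partial>Q) = \<dots>" .
    have "(\<integral>\<^sup>+z. (\<Sum>k<n. ennreal (real n) * ennreal (g (norm (z k)))) \<partial>Q)
        = (\<Sum>k<n. ennreal (real n) * (\<integral>\<^sup>+z. ennreal (g (norm (z k))) \<partial>Q))"
      by (subst nn_integral_sum) (auto simp: nn_integral_cmult)
    with 1 show ?thesis
      unfolding S_def by (subst nn_integral_add) auto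
  qed
  also have "(\<Sum>j<n. \<Sum>i<j. 2 * (\<integral>\<^sup>+z. log_kernel R (z i - z j) \<partial>Q)) = (\<Sum>j<n. \<Sum>i<j. 2 * ennreal e)"
  proof (intro sum.cong refl arg_cong2[where f="(*)"])
    fix j i assume "j \<in> {..<n}" "i \<in> {..<j}"
    then have "(\<integral>\<^sup>+z. log_kernel R (z i - z j) \<partial>Q) = (\<integral>\<^sup>+x. \<integral>\<^sup>+y. log_kernel R (x - y) \<partial>N \<partial>N)"
      unfolding Q_def by (intro nn_integral_PiM_pair[OF pN sN]) auto
    then show "(\<integral>\<^sup>+z. log_kernel R (z i - z j) \<partial>Q) = ennreal e"
      using e by (simp add: mutual_energy_def N_def)
  qed
  also have "(\<Sum>k<n. ennreal (real n) * (\<integral>\<^sup>+z. ennreal (g (norm (z k))) \<partial>Q)) = (\<Sum>k<n. ennreal (real n) * ennreal i)"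
  proof (intro sum.cong refl arg_cong2[where f="(*)"])
    fix k assume "k \<in> {..<n}"
    then show "(\<integral>\<^sup>+z. ennreal (g (norm (z k))) \<partial>Q) = ennreal i"
      unfolding Q_def using nn_integral_PiM_component[OF pN sN, of "\<lambda>x. ennreal (g (norm x))" k n] i
      by (simp add: N_def)
  qed
  also have "(\<Sum>j<n. \<Sum>i<j. 2 * ennreal e) + (\<Sum>k<n. ennreal (real n) * ennreal i) = ennreal ((\<Sum>j<n. \<Sum>i<j. 2 * e) + (\<Sum>k<n. real n * i))"
  proof -
    have a: "2 * ennreal e = ennreal (2 * e)" "ennreal (real n) * ennreal i = ennreal (real n * i)"
      using e i by (simp_all add: ennreal_mult)
    have "(\<Sum>i<j. ennreal (2 * e)) = ennreal (\<Sum>i<j. 2 * e)" for j :: nat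
      by (rule sum_ennreal) (use e in simp)
    then have "(\<Sum>j<n. \<Sum>i<j. ennreal (2 * e)) = ennreal (\<Sum>j<n. \<Sum>i<j. 2 * e)"
      using e by (simp only:) (rule sum_ennreal, auto intro: sum_nonneg)
    moreover have "(\<Sum>k<n. ennreal (real n * i)) = ennreal (\<Sum>k<n. real n * i)"
      by (rule sum_ennreal) (use i in simp)
    moreover have "ennreal ((\<Sum>j<n. \<Sum>i<j. 2 * e) + (\<Sum>k<n. real n * i))
        = ennreal (\<Sum>j<n. \<Sum>i<j. 2 * e) + ennreal (\<Sum>k<n. real n * i)"
      by (rule ennreal_plus) (use e i in \<open>auto intro!: sum_nonneg\<close>)
    ultimately show ?thesis unfolding a by (simp only:)
  qed
  also have "(\<Sum>j<n. \<Sum>i<j. 2 * e) + (\<Sum>k<n. real n * i) = s"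
  proof -
    have "(\<Sum>j<n. \<Sum>i<j. 2 * e) = 2 * real (\<Sum>j<n. j) * e" by (simp add: sum_distrib_left sum_distrib_right ac_simps)
    then show ?thesis unfolding sum_lessThan_real s_def by (simp add: power2_eq_square)
  qed
  finally have "ennreal (exp (- s)) \<le> (\<integral>\<^sup>+z. ennreal (exp_neg (S z)) \<partial>Q)"
    by (intro nn_integral_exp_neg_ge pQ s0) auto
  have pw: "exp_neg (S z) * (R\<^sup>2) ^ (\<Sum>j<n. j) \<le> gibbs_weight g n z" for z
  proof -
    have "exp_neg (S z) = (\<Prod>j<n. \<Prod>i<j. exp_neg (2 * log_kernel R (z i - z j))) *
        (\<Prod>k<n. exp_neg (ennreal (real n) * ennreal (g (norm (z k)))))"
      unfolding S_def by (simp add: exp_neg_add exp_neg_sum)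
    also have "(\<Prod>k<n. exp_neg (ennreal (real n) * ennreal (g (norm (z k))))) = exp (- real n * (\<Sum>k<n. g (norm (z k))))"
      by (simp add: exp_neg_ennreal g_nonneg sum_distrib_left exp_sum sum_negf[symmetric] flip: ennreal_mult)
    finally have eq: "exp_neg (S z) * (R\<^sup>2) ^ (\<Sum>j<n. j) =
        ((\<Prod>j<n. \<Prod>i<j. exp_neg (2 * log_kernel R (z i - z j))) * (\<Prod>j<n. (R\<^sup>2) ^ j)) * exp (- real n * (\<Sum>k<n. g (norm (z k))))"
      by (simp add: power_sum)
    have "(\<Prod>j<n. \<Prod>i<j. exp_neg (2 * log_kernel R (z i - z j))) * (\<Prod>j<n. (R\<^sup>2) ^ j)
        = (\<Prod>j<n. \<Prod>i<j. exp_neg (2 * log_kernel R (z i - z j)) * R\<^sup>2)"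
      by (simp add: prod.distrib)
    also have "\<dots> \<le> (\<Prod>j<n. \<Prod>i<j. (norm (z i - z j))\<^sup>2)"
      by (intro prod_mono conjI prod_nonneg exp_neg_log_kernel_le R mult_nonneg_nonneg exp_neg_nonneg) auto
    finally show ?thesis unfolding eq gibbs_weight_def by (intro mult_right_mono) auto
  qed
  have ind: "ennreal ((1 / b) ^ n) * (\<Prod>i<n. d (z i)) \<le> indicator {z. \<forall>i<n. z i \<notin> U} z" for z
  proof -
    have "(\<Prod>i<n. d (z i)) \<le> (\<Prod>i<n. ennreal b)" by (intro prod_mono_ennreal d_le)
    then have "ennreal ((1 / b) ^ n) * (\<Prod>i<n. d (z i)) \<le> ennreal ((1 / b) ^ n) * ennreal b ^ n"
      by (intro mult_left_mono) auto
    also have "\<dots> = 1" using b by (simp add: ennreal_power power_divide flip: ennreal_mult)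
    finally have 1: "ennreal ((1 / b) ^ n) * (\<Prod>i<n. d (z i)) \<le> 1" .
    show ?thesis
    proof (cases "\<forall>i<n. z i \<notin> U")
      case False
      then have "(\<Prod>i<n. d (z i)) = 0" using d_0 by (intro prod_zero) auto
      then show ?thesis by (simp only: mult_zero_right zero_le)
    qed (use 1 in simp)
  qed
  have "ennreal (exp (- real n * ln b + real n * (real n - 1) * (ln R - e) - (real n)\<^sup>2 * i))
      = ennreal ((1 / b) ^ n) * (ennreal ((R\<^sup>2) ^ (\<Sum>j<n. j)) * ennreal (exp (- s)))"
  proof -
    have "(1 / b) ^ n = exp (- real n * ln b)"
      using b by (simp add: exp_minus exp_of_nat_mult power_divide divide_inverse power_inverse)
    moreover have "(R\<^sup>2) ^ (\<Sum>j<n. j) = exp (real n * (real n - 1) * ln R)"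
      unfolding sum_lessThan_real[symmetric] using R
      by (simp add: mult.assoc exp_of_nat_mult mult.left_commute[of 2] del: of_nat_sum)
         (simp add: exp_double power2_eq_square)
    ultimately show ?thesis
      by (simp add: s_def algebra_simps flip: ennreal_mult exp_add)
  qed
  also have "\<dots> \<le> ennreal ((1 / b) ^ n) * (ennreal ((R\<^sup>2) ^ (\<Sum>j<n. j)) * (\<integral>\<^sup>+z. ennreal (exp_neg (S z)) \<partial>Q))"
    by (intro mult_left_mono) (auto intro: \<open>ennreal (exp (- s)) \<le> _\<close>)
  also have "\<dots> = ennreal ((1 / b) ^ n) * (\<integral>\<^sup>+z. ennreal (exp_neg (S z) * (R\<^sup>2) ^ (\<Sum>j<n. j)) \<partial>Q)"
    by (subst nn_integral_cmult[symmetric]) (auto intro!: nn_integral_cong arg_cong2[where f="(*)"] simp: exp_neg_nonneg mult.commute simp flip: ennreal_mult)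
  also have "\<dots> \<le> ennreal ((1 / b) ^ n) * (\<integral>\<^sup>+z. ennreal (gibbs_weight g n z) \<partial>Q)"
    by (intro mult_left_mono nn_integral_mono ennreal_leI pw) auto
  also have "(\<integral>\<^sup>+z. ennreal (gibbs_weight g n z) \<partial>Q) = (\<integral>\<^sup>+z. (\<Prod>i<n. d (z i)) * ennreal (gibbs_weight g n z) \<partial>P)"
    unfolding QP by (rule nn_integral_density) measurable
  also have "ennreal ((1 / b) ^ n) * \<dots> = (\<integral>\<^sup>+z. ennreal ((1 / b) ^ n) * ((\<Prod>i<n. d (z i)) * ennreal (gibbs_weight g n z)) \<partial>P)"
    by (rule nn_integral_cmult[symmetric]) measurable
  also have "\<dots> \<le> (\<integral>\<^sup>+z. ennreal (gibbs_weight g n z) * indicator {z. \<forall>i<n. z i \<notin> U} z \<partial>P)"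
  proof (rule nn_integral_mono)
    fix z
    show "ennreal ((1 / b) ^ n) * ((\<Prod>i<n. d (z i)) * ennreal (gibbs_weight g n z)) \<le>
        ennreal (gibbs_weight g n z) * indicator {z. \<forall>i<n. z i \<notin> U} z"
      using mult_left_mono[OF ind[of z], of "ennreal (gibbs_weight g n z)"] by (simp add: ac_simps)
  qed
  finally show ?thesis by (simp add: hole_integral_def P_def)
qed

section \<open>The hole probability\<close>

lemma hole_integral_le: "hole_integral g n U \<le> partition_function g n"
  unfolding hole_integral_def partition_function_def
  by (intro nn_integral_mono) (auto simp: indicator_def)

lemma (in radial_field) hole_prob_eq:
  assumes [measurable]: "U \<in> sets borel"
  shows "hole_prob g n U = hole_integral g n U / partition_function g n"
proof -
  define P where "P = (\<Pi>\<^sub>M i\<in>{..<n}. (lborel :: complex measure))"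
  define Z where "Z = partition_function g n"
  have [measurable]: "gibbs_weight g n \<in> borel_measurable P" unfolding P_def by measurable
  have comp[measurable]: "(\<lambda>z. z i) \<in> borel_measurable P" if "i < n" for i
    using measurable_component_singleton[of i "{..<n}" "\<lambda>_. lborel :: complex measure"] that
    by (simp add: P_def)
  define A where "A = {z \<in> space P. \<forall>i<n. z i \<notin> U}"
  have "A = space P - (\<Union>i\<in>{..<n}. (\<lambda>z. z i) -` U \<inter> space P)" by (auto simp: A_def)
  also have "\<dots> \<in> sets P"
    by (intro sets.Diff sets.top sets.finite_UN measurable_sets[OF comp]) auto
  finally have A[measurable]: "A \<in> sets P" .
  have "{z \<in> space P. num_points n U z = 0} = A"
    by (auto simp: num_points_def A_def)
  then have "hole_prob g n U = emeasure (density P (\<lambda>z. ennreal (gibbs_weight g n z) / Z)) A"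
    by (simp add: hole_prob_def points_law_def P_def[symmetric] Z_def)
  also have "\<dots> = (\<integral>\<^sup>+z. (ennreal (gibbs_weight g n z) / Z) * indicator A z \<partial>P)"
    by (rule emeasure_density) measurable
  also have "\<dots> = (\<integral>\<^sup>+z. (ennreal (gibbs_weight g n z) * indicator A z) * inverse Z \<partial>P)"
    by (simp add: divide_ennreal_def ac_simps)
  also have "\<dots> = (\<integral>\<^sup>+z. ennreal (gibbs_weight g n z) * indicator A z \<partial>P) * inverse Z"
    by (rule nn_integral_multc) measurable
  also have "(\<integral>\<^sup>+z. ennreal (gibbs_weight g n z) * indicator A z \<partial>P) = hole_integral g n U"
    unfolding hole_integral_def P_def[symmetric]
    by (rule nn_integral_cong) (auto simp: A_def indicator_def)
  finally show ?thesis by (simp add: divide_ennreal_def Z_def)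
qed

lemma elog_divide_ge:
  assumes h: "ennreal (exp l) \<le> h" "h \<le> Z" and Z: "Z < \<infinity>"
  shows "ereal l - elog Z \<le> elog (h / Z)"
proof -
  obtain z where z: "Z = ennreal z" "0 \<le> z" using Z by (cases Z) auto
  obtain x where x: "h = ennreal x" "0 \<le> x" using h Z z by (cases h) (auto simp: top_unique)
  have lx: "exp l \<le> x" using h x by simp
  then have x0: "0 < x" using exp_gt_zero[of l] by linarith
  have z0: "0 < z" using h x z x0 by simp
  have "l \<le> ln x" using lx x0 by (metis ln_exp exp_gt_zero ln_le_cancel_iff)
  moreover have "h / Z = ennreal (x / z)" using x z x0 z0 by (simp add: divide_ennreal)
  ultimately show ?thesis
    using x0 z0 z by (simp add: elog_def ln_div)
qed

text \<open>If the upper limit is \<open>\<infinity>\<close> the bound is trivial; otherwise the partition functions are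
  eventually finite.\<close>

lemma (in radial_field) liminf_hole_prob_ge:
  assumes d: "d \<in> borel_measurable borel" and U: "U \<in> sets borel"
    and prob: "prob_space (density lborel d)" and b: "0 < b"
    and d_le: "\<And>x. d x \<le> ennreal b" and d_0: "\<And>x. x \<in> U \<Longrightarrow> d x = 0" and R: "R > 0"
    and e: "mutual_energy R (density lborel d) (density lborel d) = ennreal e" "0 \<le> e"
    and i: "(\<integral>\<^sup>+x. ennreal (g (norm x)) \<partial>density lborel d) = ennreal i" "0 \<le> i"
  shows "ereal (ln R - e - i) - limsup (\<lambda>n. ereal (1 / (real n)\<^sup>2) * elog (partition_function g n))
    \<le> liminf (\<lambda>n. ereal (1 / (real n)\<^sup>2) * elog (hole_prob g n U))"
proof -
  define \<zeta> where "\<zeta> n = ereal (1 / (real n)\<^sup>2) * elog (partition_function g n)" for n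
  define l where "l n = - real n * ln b + real n * (real n - 1) * (ln R - e) - (real n)\<^sup>2 * i" for n
  show ?thesis
  proof (cases "limsup \<zeta> = \<infinity>")
    case True
    then show ?thesis by (simp add: \<zeta>_def[abs_def])
  next
    case False
    then have ev: "\<forall>\<^sub>F n in sequentially. \<zeta> n < \<infinity>"
      by (intro Limsup_lessD) (simp add: less_top)
    have "\<forall>\<^sub>F n in sequentially. ereal (l n / (real n)\<^sup>2) - \<zeta> n \<le> ereal (1 / (real n)\<^sup>2) * elog (hole_prob g n U)"
      using ev eventually_gt_at_top[of 0]
    proof eventually_elim
      case (elim n)
      have Z: "partition_function g n < \<infinity>"
      proof (rule ccontr)
        assume "\<not> partition_function g n < \<infinity>"
        then have "elog (partition_function g n) = \<infinity>" by (simp add: elog_def less_top)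
        then show False using elim by (simp add: \<zeta>_def)
      qed
      have "ereal (l n) - elog (partition_function g n) \<le> elog (hole_prob g n U)"
        unfolding hole_prob_eq[OF U] l_def
        by (rule elog_divide_ge[OF hole_integral_ge[OF d U prob b d_le d_0 R e i] hole_integral_le Z])
      then have "ereal (1 / (real n)\<^sup>2) * (ereal (l n) - elog (partition_function g n)) \<le> ereal (1 / (real n)\<^sup>2) * elog (hole_prob g n U)"
        by (rule ereal_mult_left_mono) simp
      moreover have "ereal (1 / (real n)\<^sup>2) * (ereal (l n) - elog (partition_function g n)) = ereal (l n / (real n)\<^sup>2) - \<zeta> n"
        using elim by (cases "elog (partition_function g n)") (auto simp: \<zeta>_def field_simps)
      ultimately show ?case by simp
    qed
    then have "liminf (\<lambda>n. ereal (l n / (real n)\<^sup>2) - \<zeta> n) \<le> liminf (\<lambda>n. ereal (1 / (real n)\<^sup>2) * elog (hole_prob g n U))"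
      by (rule Liminf_mono)
    moreover have "(\<lambda>n. ereal (l n / (real n)\<^sup>2)) \<longlonglongrightarrow> ereal (ln R - e - i)"
    proof -
      have "(\<lambda>n. - ln b * (1 / real n) + (ln R - e) * (1 - 1 / real n) - i) \<longlonglongrightarrow> - ln b * 0 + (ln R - e) * (1 - 0) - i"
        by (intro tendsto_intros lim_1_over_n)
      moreover have "\<forall>\<^sub>F n in sequentially. - ln b * (1 / real n) + (ln R - e) * (1 - 1 / real n) - i = l n / (real n)\<^sup>2"
        using eventually_gt_at_top[of 0]
        by eventually_elim (simp add: l_def field_simps power2_eq_square)
      ultimately have "(\<lambda>n. l n / (real n)\<^sup>2) \<longlonglongrightarrow> - ln b * 0 + (ln R - e) * (1 - 0) - i"
        by (rule Lim_transform_eventually)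
      then show ?thesis by simp
    qed
    then have "liminf (\<lambda>n. ereal (l n / (real n)\<^sup>2) + - \<zeta> n) = ereal (ln R - e - i) + liminf (\<lambda>n. - \<zeta> n)"
      by (rule ereal_liminf_lim_add) simp
    ultimately show ?thesis
      by (simp add: minus_ereal_def ereal_Liminf_uminus \<zeta>_def[abs_def])
  qed
qed

context radial_field begin

lemma g_right_limit: obtains c where "(g \<longlongrightarrow> c) (at_right 0)" "0 \<le> c" "c \<le> g T"
proof -
  define c where "c = (INF r\<in>{0<..}. g r)"
  have bdd: "bdd_below (g ` {0<..})" by (rule bdd_belowI2[of _ 0]) (auto intro: g_nonneg)
  have le: "c \<le> g r" if "0 < r" for r unfolding c_def using that bdd by (intro cINF_lower) auto
  have "0 \<le> c" unfolding c_def by (rule cINF_greatest) (auto intro: g_nonneg)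
  moreover have "c \<le> g T" by (rule le[OF T_pos])
  moreover have "(g \<longlongrightarrow> c) (at_right 0)"
  proof (rule order_tendstoI)
    fix a assume "a < c"
    then show "\<forall>\<^sub>F r in at_right 0. a < g r"
      using le by (auto simp: eventually_at_right_field intro!: exI[of _ 1] intro: less_le_trans)
  next
    fix a assume "c < a"
    then obtain r where r: "0 < r" "g r < a"
      unfolding c_def using cINF_less_iff[OF _ bdd, of a] by auto
    have "g x < a" if "0 < x" "x < r" for x
      using mono_onD[OF g_mono, of x r] that r by auto
    then show "\<forall>\<^sub>F x in at_right 0. g x < a"
      using r by (auto simp: eventually_at_right_field)
  qed
  ultimately show ?thesis using that by blast
qed

text \<open>A test function for weak convergence that agrees with \<open>g / 2\<close> on the punctured disc.
  It replaces \<open>g(0)\<close> by the right limit of \<open>g\<close> at \<open>0\<close>,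
  where \<open>g\<close> may jump.\<close>

lemma continuous_extension_g:
  obtains f :: "complex \<Rightarrow> real" where "continuous_on UNIV f" "bounded (range f)" "\<And>z. 0 \<le> f z"
    "\<And>z. z \<noteq> 0 \<Longrightarrow> norm z \<le> T \<Longrightarrow> f z = g (norm z) / 2"
proof -
  obtain c where c: "(g \<longlongrightarrow> c) (at_right 0)" "0 \<le> c" "c \<le> g T" by (rule g_right_limit)
  define \<phi> where "\<phi> r = (if r = 0 then c else g r)" for r
  have cont: "continuous_on {0..} \<phi>"
    unfolding continuous_on_eq_continuous_within
  proof
    fix r :: real assume "r \<in> {0..}"
    then consider "r = 0" | "0 < r" by force
    then show "continuous (at r within {0..}) \<phi>"
    proof cases
      case 1
      have "\<forall>\<^sub>F x in at_right 0. g x = \<phi> x"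
        by (auto simp: eventually_at_right_field \<phi>_def intro!: exI[of _ 1])
      with c(1) have "(\<phi> \<longlongrightarrow> c) (at_right 0)" by (rule Lim_transform_eventually)
      moreover have "{0::real..} - {0} = {0<..} - {0}" by auto
      then have "at 0 within {0..} = at_right (0::real)" by (simp only: at_within_def)
      moreover have "\<phi> 0 = c" by (simp add: \<phi>_def)
      ultimately show ?thesis unfolding 1 continuous_within by (simp only:)
    next
      case 2
      have "\<forall>\<^sub>F x in nhds r. \<phi> x = g x"
      proof -
        have "\<forall>\<^sub>F x in nhds r. 0 < x"
          using eventually_nhds_in_open[of "{0<..}" r] 2 by simp
        then show ?thesis by eventually_elim (simp add: \<phi>_def)
      qed
      then have "isCont \<phi> r"
        using DERIV_isCont[OF DERIV_g[OF 2]] by (subst isCont_cong)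
      then show ?thesis by (rule continuous_at_imp_continuous_at_within)
    qed
  qed
  define f where "f z = \<phi> (min (norm z) T) / 2" for z :: complex
  have \<phi>_bd: "0 \<le> \<phi> (min (norm z) T)" "\<phi> (min (norm z) T) \<le> g T" for z :: complex
    using c T_pos mono_onD[OF g_mono, of "min (norm z) T" T] by (auto simp: \<phi>_def g_nonneg)
  show ?thesis
  proof (rule that[of f])
    show "continuous_on UNIV f" unfolding f_def
      by (intro continuous_intros continuous_on_compose2[OF cont]) (use T_pos in auto)
    show "bounded (range f)"
      by (rule boundedI[of _ "g T / 2"]) (use \<phi>_bd in \<open>auto simp: f_def\<close>)
    show "0 \<le> f z" for z using \<phi>_bd by (simp add: f_def)
    show "f z = g (norm z) / 2" if "z \<noteq> 0" "norm z \<le> T" for z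
      using that by (simp add: f_def \<phi>_def)
  qed
qed

end

context swept_field begin

lemma nn_integral_nu_g:
  assumes f: "continuous_on UNIV f" "bounded (range f)" "\<And>z. 0 \<le> f z"
    "\<And>z. z \<noteq> 0 \<Longrightarrow> norm z \<le> T \<Longrightarrow> f z = g (norm z) / 2"
  shows "(\<integral>\<^sup>+z. ennreal (g (norm z) / 2) \<partial>\<nu>) = ennreal (\<integral>z. f z \<partial>\<nu>)"
proof -
  interpret finite_measure \<nu> by (rule finite_nu)
  have [measurable]: "f \<in> borel_measurable borel" using f(1) by (rule borel_measurable_continuous_onI)
  obtain B where B: "\<And>z. norm (f z) \<le> B" using f(2) by (auto simp: bounded_iff)
  have "(\<integral>\<^sup>+z. ennreal (g (norm z) / 2) \<partial>\<nu>) = (\<integral>\<^sup>+z. ennreal (f z) \<partial>\<nu>)"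
  proof (rule nn_integral_cong_AE)
    show "AE z in \<nu>. ennreal (g (norm z) / 2) = ennreal (f z)"
      using AE_nu_disc by eventually_elim (simp add: f(4))
  qed
  also have "\<dots> = ennreal (\<integral>z. f z \<partial>\<nu>)"
  proof (rule nn_integral_eq_integral)
    show "integrable \<nu> f" by (rule integrable_const_bound[of _ B]) (use B in auto)
  qed (use f(3) in auto)
  finally show ?thesis .
qed

text \<open>The bound for a set \<open>U\<close> whose closure lies inside \<open>V\<close>, in terms of the energy of the measure
  swept out of \<open>V\<close>.\<close>

lemma liminf_hole_prob_ge_swept:
  assumes U: "U \<in> sets borel" "closure U \<subseteq> V" and i: "(\<integral>\<^sup>+z. ennreal (g (norm z) / 2) \<partial>\<sigma>) \<le> ennreal i"
    and i0: "0 \<le> i" and \<epsilon>: "0 < \<epsilon>"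
  shows "ereal (ln T - g T / 2 - i - \<epsilon>) - limsup (\<lambda>n. ereal (1 / (real n)\<^sup>2) * elog (partition_function g n))
    \<le> liminf (\<lambda>n. ereal (1 / (real n)\<^sup>2) * elog (hole_prob g n U))"
proof -
  \<comment> \<open>smoothing with a radius of at most \<open>1\<close> keeps measures in the disc of radius \<open>T + 1\<close>\<close>
  define R where "R = 2 * T + 2"
  have R: "2 * T \<le> R" "1 \<le> R" "0 < R" using T_pos by (auto simp: R_def)
  define I where "I = (\<integral>\<^sup>+z. ennreal (g (norm z) / 2) \<partial>\<sigma>)"
  have lev: "level R \<ge> 0" using R T_pos g_nonneg[of T] by (auto simp: level_def)
  obtain j where j: "I = ennreal j" "0 \<le> j" "j \<le> i"
    using i i0 unfolding I_def[symmetric] by (cases I) (auto simp: top_unique)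
  have "mutual_energy R \<sigma> \<sigma> + I = ennreal (level R)"
    unfolding I_def by (rule energy_sigma[OF R(1,2)])
  then obtain E where E: "mutual_energy R \<sigma> \<sigma> = ennreal E" "0 \<le> E" "E + j = level R"
    using j lev by (cases "mutual_energy R \<sigma> \<sigma>") (auto simp flip: ennreal_plus)
  have "U \<subseteq> ball 0 T" using closure_subset[of U] U V_sub by blast
  then have "bounded U" by (rule bounded_subset[OF bounded_ball])
  then obtain d b where d: "d \<in> borel_measurable borel" "prob_space (density lborel d)" "0 < b"
    "\<And>x. d x \<le> ennreal b" "\<And>x. x \<in> U \<Longrightarrow> d x = 0"
    and e_le: "mutual_energy R (density lborel d) (density lborel d) \<le> mutual_energy R \<sigma> \<sigma>"
    and i_le: "(\<integral>\<^sup>+x. ennreal (g (norm x)) \<partial>density lborel d) \<le> (\<integral>\<^sup>+x. ennreal (g (norm x)) \<partial>\<sigma>) + ennreal \<epsilon>"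
    by (rule exists_bounded_density[OF prob_space_sigma sets_sigma AE_sigma _ open_V U(2) \<epsilon>, folded R_def]) (rule that; (assumption | simp))
  obtain e where e: "mutual_energy R (density lborel d) (density lborel d) = ennreal e" "0 \<le> e" "e \<le> E"
    using e_le E by (cases "mutual_energy R (density lborel d) (density lborel d)") (auto simp: top_unique)
  have "(\<integral>\<^sup>+x. ennreal (g (norm x)) \<partial>\<sigma>) + ennreal \<epsilon> = ennreal (2 * j + \<epsilon>)"
  proof -
    have "ennreal (j + j + \<epsilon>) = ennreal j + ennreal j + ennreal \<epsilon>"
      using j \<epsilon> by (simp only: ennreal_plus add_nonneg_nonneg less_imp_le)
    then show ?thesis
      unfolding nn_integral_g_halves[OF sets_sigma] I_def[symmetric] j(1) by (simp only: mult_2)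
  qed
  note i_le' = i_le[unfolded this]
  then obtain k where k: "(\<integral>\<^sup>+x. ennreal (g (norm x)) \<partial>density lborel d) = ennreal k" "0 \<le> k"
    by (cases "\<integral>\<^sup>+x. ennreal (g (norm x)) \<partial>density lborel d") (auto simp: top_unique)
  have "k \<le> 2 * j + \<epsilon>"
    using i_le' j \<epsilon> unfolding k(1) by (subst (asm) ennreal_le_iff) auto
  have "ln T - g T / 2 - i - \<epsilon> \<le> ln R - e - k"
    using E e k j \<open>k \<le> 2 * j + \<epsilon>\<close> by (simp add: level_def)
  then have "ereal (ln T - g T / 2 - i - \<epsilon>) - limsup (\<lambda>n. ereal (1 / (real n)\<^sup>2) * elog (partition_function g n))
      \<le> ereal (ln R - e - k) - limsup (\<lambda>n. ereal (1 / (real n)\<^sup>2) * elog (partition_function g n))"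
    by (intro ereal_minus_mono) auto
  also have "\<dots> \<le> liminf (\<lambda>n. ereal (1 / (real n)\<^sup>2) * elog (hole_prob g n U))"
    by (rule liminf_hole_prob_ge[OF d(1) U(1) d(2-5) R(3) e(1,2) k(1,2)])
  finally show ?thesis .
qed

end

theorem theorem3p6:
  fixes g :: "real \<Rightarrow> real" and T :: real
    and U :: "complex set" and Us :: "nat \<Rightarrow> complex set"
    and \<nu> :: "complex measure" and \<nu>s :: "nat \<Rightarrow> complex measure"
  assumes g_nonneg: "\<And>r. r \<ge> 0 \<Longrightarrow> g r \<ge> 0"
    and g_mono: "mono_on {0..} g"
    and g_growth: "((\<lambda>r. r * exp (- g r / 2)) \<longlongrightarrow> 0) at_top"
    and g_diff: "\<And>r. r > 0 \<Longrightarrow> g differentiable (at r)"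
    and g_diff2: "\<And>r. r > 0 \<Longrightarrow> deriv g differentiable (at r)"
    and rg'_lim: "((\<lambda>r. r * deriv g r) \<longlongrightarrow> 0) (at_right 0)"
    and rg'_mono: "mono_on {0<..} (\<lambda>r. r * deriv g r)"
    and g_moments: "\<And>k::nat. (\<integral>\<^sup>+r\<in>{0..}. ennreal (r ^ (2 * k + 1) * exp (- g r)) \<partial>lborel) < \<infinity>"
    and T: "T > 0" "T * deriv g T = 2"
    and U: "open U" "U \<subseteq> ball 0 T"
    and Us_open: "\<And>n. n \<ge> 1 \<Longrightarrow> open (Us n)"
    and Us_sub: "\<And>n. n \<ge> 1 \<Longrightarrow> closure U \<subseteq> Us n \<and> Us n \<subseteq> ball 0 T"
    and Us_dec: "\<And>n. n \<ge> 1 \<Longrightarrow> Us (n + 1) \<subseteq> Us n"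
    and Us_Inter: "(\<Inter>n\<in>{1..}. Us n) = closure U"
    and bal_Us: "\<And>n. n \<ge> 1 \<Longrightarrow>
      is_balayage (Us n) (restrict_measure (radial_measure g T) (Us n)) (\<nu>s n)"
    and bal_U: "is_balayage U (restrict_measure (radial_measure g T) U) \<nu>"
    and conv: "weakly_converges \<nu>s \<nu>"
  shows "liminf (\<lambda>n. ereal (1 / (real n)\<^sup>2) * elog (hole_prob g n U))
    \<ge> - hole_energy g U
      - limsup (\<lambda>n. ereal (1 / (real n)\<^sup>2) * elog (partition_function g n))"
proof -
  define \<Lambda> where "\<Lambda> = limsup (\<lambda>n. ereal (1 / (real n)\<^sup>2) * elog (partition_function g n))"
  define X where "X = liminf (\<lambda>n. ereal (1 / (real n)\<^sup>2) * elog (hole_prob g n U))"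
  interpret radial_field g T
    using g_nonneg g_mono g_diff g_diff2 rg'_lim rg'_mono T by unfold_locales
  interpret S: swept_field g T U \<nu>
    by unfold_locales (use U bal_U in \<open>simp_all add: \<mu>_def\<close>)
  obtain i where i: "(\<integral>\<^sup>+z. ennreal (g (norm z) / 2) \<partial>S.\<sigma>) = ennreal i" "0 \<le> i"
    using S.weighted_energy_sigma(2) by (cases "\<integral>\<^sup>+z. ennreal (g (norm z) / 2) \<partial>S.\<sigma>") auto
  have "ereal (g T / 2 - ln T + i) \<le> hole_energy g U"
    unfolding hole_energy_def
  proof (rule INF_greatest)
    fix M assume "M \<in> compact_probs (- U)"
    then have "weighted_energy g S.\<sigma> \<le> weighted_energy g M" by (rule S.weighted_energy_ge)
    then show "ereal (g T / 2 - ln T + i) \<le> weighted_energy g M"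
      by (simp add: S.weighted_energy_sigma(1) i enn2ereal_ennreal)
  qed
  then have "- hole_energy g U \<le> ereal (- (g T / 2 - ln T + i))"
    by (metis ereal_minus_le_minus uminus_ereal.simps(1))
  then have le: "- hole_energy g U - \<Lambda> \<le> ereal (- (g T / 2 - ln T + i)) - \<Lambda>"
    by (intro ereal_minus_mono) auto
  have key: "ereal (ln T - g T / 2 - i - \<epsilon>) - \<Lambda> \<le> X" if \<epsilon>: "0 < \<epsilon>" for \<epsilon>
  proof -
    obtain f :: "complex \<Rightarrow> real" where f: "continuous_on UNIV f" "bounded (range f)" "\<And>z. 0 \<le> f z"
      "\<And>z. z \<noteq> 0 \<Longrightarrow> norm z \<le> T \<Longrightarrow> f z = g (norm z) / 2"
      by (rule continuous_extension_g) (rule that; simp)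
    have "(\<lambda>n. \<integral>z. f z \<partial>\<nu>s n) \<longlonglongrightarrow> (\<integral>z. f z \<partial>\<nu>)"
      using conv f(1,2) by (simp add: weakly_converges_def)
    then have "\<forall>\<^sub>F n in sequentially. (\<integral>z. f z \<partial>\<nu>s n) < (\<integral>z. f z \<partial>\<nu>) + \<epsilon> / 2"
      by (rule order_tendstoD) (use \<epsilon> in simp)
    then obtain n where n: "n \<ge> 1" "(\<integral>z. f z \<partial>\<nu>s n) < (\<integral>z. f z \<partial>\<nu>) + \<epsilon> / 2"
      using eventually_happens'[OF sequentially_bot eventually_conj[OF eventually_ge_at_top[of 1]]] by metis
    interpret N: swept_field g T "Us n" "\<nu>s n"
      by unfold_locales (use n Us_open Us_sub bal_Us in \<open>simp_all add: \<mu>_def\<close>)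
    have "(\<integral>\<^sup>+z. ennreal (g (norm z) / 2) \<partial>N.\<sigma>) =
        (\<integral>\<^sup>+z. ennreal (g (norm z) / 2) * indicator (- Us n) z \<partial>\<mu>) + ennreal (\<integral>z. f z \<partial>\<nu>s n)"
      using N.nn_integral_sigma[of "\<lambda>z. ennreal (g (norm z) / 2)"] by (simp add: N.nn_integral_nu_g[OF f])
    \<comment> \<open>\<open>U\<close> lies in \<open>Us n\<close>, so the unswept part can only grow when \<open>Us n\<close> is replaced by \<open>U\<close>\<close>
    also have "\<dots> \<le> (\<integral>\<^sup>+z. ennreal (g (norm z) / 2) * indicator (- U) z \<partial>\<mu>) + ennreal ((\<integral>z. f z \<partial>\<nu>) + \<epsilon> / 2)"
      using n Us_sub[OF n(1)] closure_subset[of U]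
      by (intro add_mono nn_integral_mono ennreal_leI) (auto simp: indicator_def)
    also have "\<dots> = (\<integral>\<^sup>+z. ennreal (g (norm z) / 2) \<partial>S.\<sigma>) + ennreal (\<epsilon> / 2)"
    proof -
      have "ennreal ((\<integral>z. f z \<partial>\<nu>) + \<epsilon> / 2) = ennreal (\<integral>z. f z \<partial>\<nu>) + ennreal (\<epsilon> / 2)"
        using \<epsilon> f(3) by (intro ennreal_plus) auto
      moreover have "(\<integral>\<^sup>+z. ennreal (g (norm z) / 2) \<partial>S.\<sigma>) =
          (\<integral>\<^sup>+z. ennreal (g (norm z) / 2) * indicator (- U) z \<partial>\<mu>) + ennreal (\<integral>z. f z \<partial>\<nu>)"
        using S.nn_integral_sigma[of "\<lambda>z. ennreal (g (norm z) / 2)"] by (simp add: S.nn_integral_nu_g[OF f])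
      ultimately show ?thesis by (simp add: add.assoc)
    qed
    also have "\<dots> = ennreal (i + \<epsilon> / 2)" using i \<epsilon> by simp
    finally have "(\<integral>\<^sup>+z. ennreal (g (norm z) / 2) \<partial>N.\<sigma>) \<le> ennreal (i + \<epsilon> / 2)" .
    from N.liminf_hole_prob_ge_swept[OF _ _ this, of U "\<epsilon> / 2"] show ?thesis
      using U i \<epsilon> Us_sub[OF n(1)] by (simp add: \<Lambda>_def X_def algebra_simps)
  qed
  have "ereal (- (g T / 2 - ln T + i)) - \<Lambda> \<le> X"
  proof (cases \<Lambda>)
    case (real r)
    show ?thesis
    proof (rule ereal_le_epsilon2)
      fix \<epsilon> :: real assume "0 < \<epsilon>"
      from key[OF this] show "ereal (- (g T / 2 - ln T + i)) - \<Lambda> \<le> X + ereal \<epsilon>"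
        unfolding real by (cases X) auto
    qed
  qed (use key[of 1] in auto)
  with le show ?thesis unfolding \<Lambda>_def[symmetric] X_def[symmetric] by (rule order_trans)
qed

end
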